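(* Let $\lambda\in\mathcal{SP}_n$ and $\mu=(\mu_1,\dots,\mu_m)\in\mathcal{OP}_n$ with $l(\mu)=m$. Then $$\zeta^{\lambda}_{\mu}(q)=2^{-\epsilon(\lambda)}(q-1)^{-m}\sum_{\underline{\lambda}}\ \prod_{i=1}^{m}wt_q(\lambda^{(i-1)}/\lambda^{(i)}),$$ where the sum runs over all sequences of strict partitions $\underline{\lambda}=(\lambda^{(0)},\lambda^{(1)},\dots,\lambda^{(m)})$ with $\lambda^{(0)}=\lambda$ and $\lambda^{(0)}\supset\lambda^{(1)}\supset\cdots\supset\lambda^{(m)}$ such that $\lambda^{(i-1)}/\lambda^{(i)}$ is a $\mu_i$-generalized double strip for each $i=1,2,\dots,m$.
   Context: Partitions: $l(\lambda)$ is the number of nonzero parts; $\mathcal{SP}_n$ (resp. $\mathcal{OP}_n$) is the set of strict partitions (resp. partitions with all parts odd) of $n$; $\delta(\lambda)\in\{0,1\}$ is the parity of $l(\lambda)$; $\epsilon(\lambda)=\lfloor l(\lambda)/2\rfloor$; $z_\lambda=\prod_{i\ge1}i^{m_i}m_i!$ with $m_i$ the multiplicity of $i$ in $\lambda$. Characters: $\Gamma=\mathbb{Q}(q)[p_1,p_3,p_5,\dots]$ is generated by the odd power sums, with the bilinear form $\langle p_\lambda,p_\mu\rangle=2^{-l(\lambda)}z_\lambda\delta_{\lambda\mu}$ for odd partitions. Operators $Q_n$ ($n\in\mathbb Z$) on $\Gamma$ are defined by $\sum_{n}Q_nz^n=\exp\big(\sum_{n\ge1,\,\mathrm{odd}}\frac2n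 p_nz^n\big)\exp\big(-\sum_{n\ge1,\,\mathrm{odd}}\frac{\partial}{\partial p_n}z^{-n}\big)$, and for strict $\lambda=(\lambda_1,\dots,\lambda_l)$, $Q_\lambda=Q_{\lambda_1}\cdots Q_{\lambda_l}.1$ is Schur's $Q$-function; $\langle Q_\lambda,Q_\mu\rangle=2^{l(\lambda)}\delta_{\lambda\mu}$. Let $\sum_{n\ge0}g_nz^n=\exp\big(\sum_{n\ge1,\,\mathrm{odd}}\frac{2(q^n-1)}{n}p_nz^n\big)$ and $g_\mu=g_{\mu_1}g_{\mu_2}\cdots$. $\zeta^\lambda_\mu(q)$ is the value of the irreducible character of the Hecke-Clifford algebra $\mathcal H^c_n$ labelled by $\lambda$ at the standard element $T_{\gamma_\mu}$; it is determined by the Frobenius formula $\frac{g_\mu}{(q-1)^{l(\mu)}}=\sum_{\lambda\in\mathcal{SP}_n}2^{-\frac{l(\lambda)+\delta(\lambda)}2}\zeta^\lambda_\mu(q)Q_\lambda$, equivalently $\zeta^\lambda_\mu(q)=2^{-\epsilon(\lambda)}(q-1)^{-l(\mu)}\langle g_\mu,Q_\lambda\rangle$, which may be taken as its definition. Strips: the shifted diagram $\lambda^*$ of a strict partition $\lambda$ is the set of squares $(i,j)$ with $1\le i\le l(\lambda)$, $i\le j\le i+\lambda_i-1$ (row $i$, column $j$). For strict $\mu\subset\lambda$, $\lambda^*/\mu^*$ is the set difference. It is a generalized strip if it contains no $2\times2$ block of squares and at most one square of the main diagonal $\{(i,i)\}$; a shifted border strip is a connected generalized strip (connectedness via squares sharing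 an edge). $\lambda/\mu$ is a generalized double strip if there is a strict partition $\nu$, $\mu\subset\nu\subset\lambda$, with $\lambda^*/\nu^*$ and $\nu^*/\mu^*$ both generalized strips (possibly empty); it is a $k$-generalized double strip if moreover $|\lambda|-|\mu|=k$. In this case each diagonal $\{(i,j):j-i=\mathrm{const}\}$ meets $\lambda^*/\mu^*$ in at most two squares. Let $c(\lambda/\mu)$ be the number of diagonals meeting $\lambda^*/\mu^*$ in exactly two squares, and let $\beta(\lambda/\mu)$ be the set of squares of $\lambda^*/\mu^*$ on the diagonals meeting it in exactly one square. The connected components $\xi^{(1)},\dots,\xi^{(r)}$ of $\beta(\lambda/\mu)$ are shifted border strips; each $\xi^{(i)}$ is identified with the composition of its row lengths (numbers of squares in its successive nonempty rows, top to bottom), and $l(\xi^{(i)})$ is its number of rows. Weight: $f_0=1$, $f_i=2(t-1)\frac{t^i-(-1)^i}{t+1}$ for $i\ge1$, $f_\tau=f_{\tau_1}f_{\tau_2}\cdots$. For compositions $\rho,\tau$ with positive parts, $\rho\prec\tau$ means that $\tau$ is obtained from $\rho$ by summing consecutive blocks of parts ($\rho$ refines $\tau$; $\tau\prec\tau$). Then $$wt_t(\lambda/\mu)=(-t)^{c(\lambda/\mu)}\,2^{\delta_{l(\lambda),l(\mu)+2}}\prod_{i=1}^r\Big(\sum_{\tau:\ \xi^{(i)}\prec\tau}(-1)^{l(\xi^{(i)})-l(\tau)}f_\tau\Big),$$ with $\delta_{a,b}$ the Kronecker delta, and $wt_q$ is $wt_t$ at $t=q$. *)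

theory Defs
  imports
    "HOL-Library.Poly_Mapping"
    "HOL-Library.Multiset"
    "HOL-Computational_Algebra.Formal_Power_Series"
    "HOL-Computational_Algebra.Polynomial_Factorial"
begin

section \<open>Partitions\<close>

text \<open>
  A partition is the list of its nonzero parts, so \<open>l(\<lambda>)\<close> is \<open>length\<close> and \<open>|\<lambda>|\<close> is
  \<open>sum_list\<close>.
\<close>

definition strict_partition :: "nat list \<Rightarrow> bool" where
  "strict_partition lam \<longleftrightarrow> sorted_wrt (>) lam \<and> 0 \<notin> set lam"

definition SP :: "nat \<Rightarrow> nat list set" where
  "SP n = {lam. strict_partition lam \<and> sum_list lam = n}"

definition OP :: "nat \<Rightarrow> nat list set" where
  "OP n = {mu. sorted_wrt (\<ge>) mu \<and> (\<forall>i\<in>set mu. odd i) \<and> sum_list mu = n}"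

definition eps :: "nat list \<Rightarrow> nat" where
  "eps lam = length lam div 2"

definition z_part :: "nat list \<Rightarrow> nat" where
  "z_part mu = (\<Prod>i\<in>set mu. i ^ count (mset mu) i * fact (count (mset mu) i))"


section \<open>The ring generated by the odd power sums\<close>

type_synonym ratq = "rat poly fract"

definition qq :: ratq where
  "qq = to_fract [:0, 1:]"

text \<open>
  Polynomials over \<open>\<rat>(q)\<close> in countably many variables; the variable with index \<open>i\<close> is the
  power sum \<open>p\<^bsub>2i+1\<^esub>\<close>.
\<close>

type_synonym Gam = "(nat \<Rightarrow>\<^sub>0 nat) \<Rightarrow>\<^sub>0 ratq"

definition scal :: "ratq \<Rightarrow> Gam" where
  "scal c = Poly_Mapping.single 0 c"

text \<open>\<open>psum n\<close> and \<open>pdiff n\<close> below are only used for odd \<open>n\<close>.\<close>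

definition psum :: "nat \<Rightarrow> Gam" where
  "psum n = Poly_Mapping.single (Poly_Mapping.single (n div 2) 1) 1"

definition pdiff :: "nat \<Rightarrow> Gam \<Rightarrow> Gam" where
  "pdiff n f = (\<Sum>m\<in>Poly_Mapping.keys f.
     Poly_Mapping.single (m - Poly_Mapping.single (n div 2) 1)
       (of_nat (Poly_Mapping.lookup m (n div 2)) * Poly_Mapping.lookup f m))"

text \<open>
  \<open>2\<^bsup>-l(\<lambda>)\<^esup> z\<^sub>\<lambda>\<close> for the odd partition \<open>\<lambda>\<close> in which \<open>2i+1\<close> has multiplicity \<open>m\<^sub>i\<close>; see
  \<open>form_power_sums\<close> below.
\<close>

definition mono_norm :: "(nat \<Rightarrow>\<^sub>0 nat) \<Rightarrow> ratq" where
  "mono_norm m = (\<Prod>i\<in>Poly_Mapping.keys m.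
     of_nat ((2 * i + 1) ^ Poly_Mapping.lookup m i * fact (Poly_Mapping.lookup m i))
       / 2 ^ Poly_Mapping.lookup m i)"

definition form :: "Gam \<Rightarrow> Gam \<Rightarrow> ratq" where
  "form f g = (\<Sum>m\<in>Poly_Mapping.keys f. \<Sum>m'\<in>Poly_Mapping.keys g.
     Poly_Mapping.lookup f m * Poly_Mapping.lookup g m' * (if m = m' then mono_norm m else 0))"


section \<open>Schur Q-functions and the characters\<close>

text \<open>The exponential of a power series over \<open>Gam\<close> with zero constant term.\<close>

definition gexp :: "Gam fps \<Rightarrow> Gam fps" where
  "gexp F = Abs_fps (\<lambda>k. scal (1 / fact k)) oo F"

definition creation :: "Gam fps" where
  "creation = gexp (Abs_fps (\<lambda>n. if odd n then scal (2 / of_nat n) * psum n else 0))"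

text \<open>
  With \<open>w = z\<^sup>-\<^sup>1\<close>, \<open>ann_log\<close> is the operator \<open>-\<Sum> w\<^sup>n \<partial>/\<partial>p\<^sub>n\<close> (\<open>n\<close> odd) on power series in \<open>w\<close>
  over \<open>Gam\<close>, and \<open>annihilation f\<close> is its exponential applied to the constant series \<open>f\<close>. As
  \<open>ann_log\<close> raises the order in \<open>w\<close>, only its powers up to \<open>k\<close> contribute to the coefficient
  of \<open>w\<^sup>k\<close>.
\<close>

definition ann_log :: "Gam fps \<Rightarrow> Gam fps" where
  "ann_log F = Abs_fps (\<lambda>k. - (\<Sum>n | odd n \<and> n \<le> k. pdiff n (fps_nth F (k - n))))"

definition annihilation :: "Gam \<Rightarrow> Gam fps" where
  "annihilation f =
     Abs_fps (\<lambda>k. \<Sum>j\<le>k. scal (1 / fact j) * fps_nth ((ann_log ^^ j) (fps_const f)) k)"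

text \<open>
  The coefficient of \<open>z\<^sup>n\<close>. The index set is finite: the coefficients of \<open>annihilation f\<close> vanish
  beyond the degree of \<open>f\<close> for the grading \<open>deg p\<^sub>n = n\<close>.
\<close>

definition Qop :: "int \<Rightarrow> Gam \<Rightarrow> Gam" where
  "Qop n f = (\<Sum>k | fps_nth (annihilation f) k \<noteq> 0 \<and> 0 \<le> n + int k.
     fps_nth creation (nat (n + int k)) * fps_nth (annihilation f) k)"

definition schurQ :: "nat list \<Rightarrow> Gam" where
  "schurQ lam = foldr (\<lambda>n f. Qop (int n) f) lam 1"

definition g_series :: "Gam fps" where
  "g_series =
     gexp (Abs_fps (\<lambda>n. if odd n then scal (2 * (qq ^ n - 1) / of_nat n) * psum n else 0))"

definition g_part :: "nat list \<Rightarrow> Gam" where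
  "g_part mu = prod_list (map (fps_nth g_series) mu)"

text \<open>
  The value at \<open>T\<^bsub>\<gamma>\<^sub>\<mu>\<^esub>\<close> of the irreducible character of the Hecke-Clifford algebra labelled by
  \<open>\<lambda>\<close>, defined through the Frobenius formula.
\<close>

definition zeta :: "nat list \<Rightarrow> nat list \<Rightarrow> ratq" where
  "zeta lam mu = 2 powi (- int (eps lam)) * (qq - 1) powi (- int (length mu))
     * form (g_part mu) (schurQ lam)"


section \<open>Shifted diagrams and strips\<close>

type_synonym square = "nat \<times> nat"

text \<open>Rows are numbered from 1, lists from 0.\<close>

definition shifted_diagram :: "nat list \<Rightarrow> square set" where
  "shifted_diagram lam =
     {(i, j). 1 \<le> i \<and> i \<le> length lam \<and> i \<le> j \<and> j \<le> i + lam ! (i - 1) - 1}"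

definition contained :: "nat list \<Rightarrow> nat list \<Rightarrow> bool" where
  "contained mu lam \<longleftrightarrow> shifted_diagram mu \<subseteq> shifted_diagram lam"

definition skew :: "nat list \<Rightarrow> nat list \<Rightarrow> square set" where
  "skew lam mu = shifted_diagram lam - shifted_diagram mu"

definition generalized_strip :: "square set \<Rightarrow> bool" where
  "generalized_strip S \<longleftrightarrow>
     (\<nexists>i j. {(i, j), (i, j + 1), (i + 1, j), (i + 1, j + 1)} \<subseteq> S)
     \<and> card {s \<in> S. fst s = snd s} \<le> 1"

definition generalized_double_strip :: "nat list \<Rightarrow> nat list \<Rightarrow> bool" where
  "generalized_double_strip lam mu \<longleftrightarrow>
     (\<exists>nu. strict_partition nu \<and> contained mu nu \<and> contained nu lam
        \<and> generalized_strip (skew lam nu) \<and> generalized_strip (skew nu mu))"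

definition k_generalized_double_strip :: "nat \<Rightarrow> nat list \<Rightarrow> nat list \<Rightarrow> bool" where
  "k_generalized_double_strip k lam mu \<longleftrightarrow>
     generalized_double_strip lam mu \<and> int (sum_list lam) - int (sum_list mu) = int k"

definition on_diagonal :: "int \<Rightarrow> square set \<Rightarrow> square set" where
  "on_diagonal d S = {(i, j) \<in> S. int j - int i = d}"

definition c_strip :: "nat list \<Rightarrow> nat list \<Rightarrow> nat" where
  "c_strip lam mu = card {d. card (on_diagonal d (skew lam mu)) = 2}"

definition beta :: "nat list \<Rightarrow> nat list \<Rightarrow> square set" where
  "beta lam mu = (\<Union>d\<in>{d. card (on_diagonal d (skew lam mu)) = 1}. on_diagonal d (skew lam mu))"

definition adjacent :: "square \<Rightarrow> square \<Rightarrow> bool" where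
  "adjacent s s' \<longleftrightarrow>
     \<bar>int (fst s) - int (fst s')\<bar> + \<bar>int (snd s) - int (snd s')\<bar> = 1"

definition components :: "square set \<Rightarrow> square set set" where
  "components S = S // {(a, b). a \<in> S \<and> b \<in> S
     \<and> (a, b) \<in> {(s, s'). s \<in> S \<and> s' \<in> S \<and> adjacent s s'}\<^sup>*}"

definition row_lengths :: "square set \<Rightarrow> nat list" where
  "row_lengths S = map (\<lambda>i. card {j. (i, j) \<in> S}) (sorted_list_of_set (fst ` S))"


section \<open>The weight\<close>

text \<open>\<open>refines rho tau\<close> is \<open>\<rho> \<prec> \<tau>\<close>.\<close>

definition refines :: "nat list \<Rightarrow> nat list \<Rightarrow> bool" where
  "refines rho tau \<longleftrightarrow>
     (\<exists>blocks. (\<forall>b\<in>set blocks. b \<noteq> []) \<and> concat blocks = rho \<and> map sum_list blocks = tau)"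

text \<open>For \<open>i \<ge> 1\<close> the formula presupposes \<open>t \<noteq> -1\<close>, as is the case for \<open>t = q\<close>.\<close>

definition f_num :: "'a::field \<Rightarrow> nat \<Rightarrow> 'a" where
  "f_num t i = (if i = 0 then 1 else 2 * (t - 1) * (t ^ i - (- 1) ^ i) / (t + 1))"

definition f_comp :: "'a::field \<Rightarrow> nat list \<Rightarrow> 'a" where
  "f_comp t tau = prod_list (map (f_num t) tau)"

definition wt :: "'a::field \<Rightarrow> nat list \<Rightarrow> nat list \<Rightarrow> 'a" where
  "wt t lam mu =
     (- t) ^ c_strip lam mu * 2 ^ (if length lam = length mu + 2 then 1 else 0)
     * (\<Prod>xi\<in>components (beta lam mu).
          \<Sum>tau | refines (row_lengths xi) tau.
            (- 1) ^ (length (row_lengths xi) - length tau) * f_comp t tau)"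

text \<open>The sequences \<open>(\<lambda>\<^sup>0, \<dots>, \<lambda>\<^sup>m)\<close>, with \<open>L ! i\<close> for the \<open>i\<close>-th member; \<open>\<mu>\<^sub>i\<close> is \<open>mu ! (i - 1)\<close>.\<close>

definition strip_sequences :: "nat list \<Rightarrow> nat list \<Rightarrow> nat list list set" where
  "strip_sequences lam mu =
     {L. length L = length mu + 1 \<and> L ! 0 = lam
       \<and> (\<forall>i\<le>length mu. strict_partition (L ! i))
       \<and> (\<forall>i\<in>{1..length mu}. contained (L ! i) (L ! (i - 1))
            \<and> k_generalized_double_strip (mu ! (i - 1)) (L ! (i - 1)) (L ! i))}"


section \<open>The form on products of power sums\<close>

definition expo :: "nat list \<Rightarrow> (nat \<Rightarrow>\<^sub>0 nat)" where
  "expo mu = sum_list (map (\<lambda>n. Poly_Mapping.single (n div 2) 1) mu)"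

lemma prod_psum: "prod_list (map psum mu) = Poly_Mapping.single (expo mu) 1"
  by (induction mu) (simp_all add: psum_def expo_def Poly_Mapping.mult_single)

lemma lookup_expo:
  assumes "\<forall>n\<in>set mu. odd n"
  shows "Poly_Mapping.lookup (expo mu) i = count (mset mu) (2 * i + 1)"
  using assms
proof (induction mu)
  case Nil
  then show ?case by (simp add: expo_def)
next
  case (Cons a mu)
  have "a div 2 = i \<longleftrightarrow> a = 2 * i + 1"
    using Cons.prems by (auto elim!: oddE)
  then show ?case
    using Cons by (auto simp: expo_def lookup_add lookup_single when_def)
qed

lemma mono_norm_expo:
  assumes odd: "\<forall>n\<in>set mu. odd n"
  shows "mono_norm (expo mu) = of_nat (z_part mu) / 2 ^ length mu"
proof -
  have keys: "set mu = (\<lambda>i. 2 * i + 1) ` Poly_Mapping.keys (expo mu)"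
  proof (intro set_eqI iffI)
    fix n assume n: "n \<in> set mu"
    then obtain i where i: "n = 2 * i + 1" using odd oddE by blast
    have "i \<in> Poly_Mapping.keys (expo mu)"
      using n i by (simp add: in_keys_iff lookup_expo[OF odd])
    then show "n \<in> (\<lambda>i. 2 * i + 1) ` Poly_Mapping.keys (expo mu)" using i by blast
  qed (auto simp: in_keys_iff lookup_expo[OF odd])
  have inj: "inj_on (\<lambda>i::nat. 2 * i + 1) A" for A by (auto simp: inj_on_def)
  have "length mu = (\<Sum>n\<in>set mu. count (mset mu) n)"
    using size_multiset_overloaded_eq[of "mset mu"] by simp
  also have "\<dots> = (\<Sum>i\<in>Poly_Mapping.keys (expo mu). Poly_Mapping.lookup (expo mu) i)"
    unfolding keys by (subst sum.reindex[OF inj]) (simp add: lookup_expo[OF odd])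
  finally have len: "length mu = \<dots>" .
  have z: "z_part mu = (\<Prod>i\<in>Poly_Mapping.keys (expo mu).
      (2 * i + 1) ^ Poly_Mapping.lookup (expo mu) i * fact (Poly_Mapping.lookup (expo mu) i))"
    unfolding z_part_def keys
    by (subst prod.reindex[OF inj]) (simp add: lookup_expo[OF odd])
  show ?thesis
    unfolding mono_norm_def prod_dividef z len
    by (simp add: power_sum)
qed

lemma form_power_sums:
  assumes "lam \<in> OP n" "mu \<in> OP n'"
  shows "form (prod_list (map psum lam)) (prod_list (map psum mu))
    = (if lam = mu then of_nat (z_part lam) / 2 ^ length lam else 0)"
proof -
  have odd: "\<forall>i\<in>set lam. odd i" "\<forall>i\<in>set mu. odd i"
    and sorted: "sorted_wrt (\<ge>) lam" "sorted_wrt (\<ge>) mu"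
    using assms by (auto simp: OP_def)
  have "lam = mu" if eq: "expo lam = expo mu"
  proof -
    have "mset lam = mset mu"
    proof (rule multiset_eqI)
      fix n
      show "count (mset lam) n = count (mset mu) n"
      proof (cases "odd n")
        case True
        then obtain i where "n = 2 * i + 1" using oddE by blast
        then show ?thesis using lookup_expo[OF odd(1), of i] lookup_expo[OF odd(2), of i] eq by simp
      next
        case False
        then have "n \<notin> set lam" "n \<notin> set mu" using odd by auto
        then show ?thesis by (metis count_mset_0_iff)
      qed
    qed
    moreover have "sorted (rev lam)" "sorted (rev mu)"
      using sorted by (simp_all add: sorted_wrt_rev)
    ultimately have "rev lam = rev mu"
      by (metis mset_rev properties_for_sort)
    then show ?thesis by simp
  qed
  then have "expo lam = expo mu \<longleftrightarrow> lam = mu" by auto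
  then show ?thesis
    by (auto simp: prod_psum form_def mono_norm_expo[OF odd(1)] mono_norm_expo[OF odd(2)])
qed

end

theory Submission
  imports Defs
begin

text \<open>
  Let \<open>q(z) = \<Sum> q\<^sub>k z\<^sup>k\<close> be the series of creation coefficients and \<open>q\<^sub>k\<^sup>\<bottom>\<close> the adjoint of multiplication
  by \<open>q\<^sub>k\<close>. From \<open>q\<^sup>\<bottom>(z) Q(w) = (1 + zw) / (1 - zw) Q(w) q\<^sup>\<bottom>(z)\<close> and \<open>Q\<^sub>a Q\<^sub>a = 0\<close> for \<open>a > 0\<close> one gets the
  Pieri rule: \<open>q\<^sub>k\<^sup>\<bottom> Q\<^sub>\<lambda>\<close> is the sum of \<open>2\<^sup>c Q\<^sub>\<nu>\<close> over the generalized strips \<open>\<lambda>/\<nu>\<close> of size \<open>k\<close>, with \<open>c\<close> the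
  number of connected components. As \<open>g(z) = q(qz) q(-z)\<close>, the coefficient of \<open>Q\<^sub>\<mu>\<close> in \<open>g\<^sub>k\<^sup>\<bottom> Q\<^sub>\<lambda>\<close> is a
  signed sum over the intermediate partitions \<open>\<nu>\<close>. Scanning the diagonals from the top right and
  recording which of the two strips contains the single square of a diagonal turns this sum into a
  two-state transfer recursion, whose value is the weight of the double strip.
\<close>

section \<open>The bilinear form\<close>

unbundle fps_syntax

text \<open>Operator identities are obtained through the form: an identity between multiplications
  gives one between adjoints, by nondegeneracy. Identities between exponential series are checked on
  logarithmic derivatives. Clearing the denominator 1 - zw of the commutation relation leaves a
  relation that lowers an index of \<open>Qop\<close> by one, which turns the Pieri rule into an
  induction on the largest part. The combinatorial obstacle is that strips, components and row
  lengths are global notions. They become local in \<open>above lam d\<close>, because this number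
  changes by at most one between neighbouring diagonals: being a strip is a bound on differences, a
  component is an interval of diagonals, and an intermediate partition is a yes-no choice for each
  part size. On a run of single diagonals the two states evolve by triangular matrices with
  eigenvalues -1 and t, the origin of the quotient in f_i. The factor 2 for a length difference of 2
  is held by a stretch of double diagonals until the next single diagonal takes it over, and it
  remains if the stretch reaches the main diagonal.\<close>

abbreviation coef :: "Gam \<Rightarrow> (nat \<Rightarrow>\<^sub>0 nat) \<Rightarrow> ratq" where "coef \<equiv> Poly_Mapping.lookup"
abbreviation mvar :: "nat \<Rightarrow> (nat \<Rightarrow>\<^sub>0 nat)" where "mvar n \<equiv> Poly_Mapping.single (n div 2) 1"

lemma of_nat_ratq_eq_0_iff: "of_nat n = (0::ratq) \<longleftrightarrow> n = 0"
  by (simp only: of_nat_eq_0_iff)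

lemma Gam_induct [case_names zero add]:
  fixes f :: Gam
  assumes "P 0" and "\<And>m c f. P f \<Longrightarrow> P (Poly_Mapping.single m c + f)"
  shows "P f"
proof (induction f rule: Poly_Mapping.update_induct)
  case const
  show ?case by (rule assms(1))
next
  case (update f a b)
  have "Poly_Mapping.update a b f = Poly_Mapping.single a b + f"
    using update(1) by (intro poly_mapping_eqI)
      (auto simp: lookup_update lookup_add lookup_single when_def in_keys_iff)
  then show ?case using assms(2) update by simp
qed

lemma coef_single_mult:
  "coef (Poly_Mapping.single k c * f) (k + m) = c * coef f m"
proof (induction f rule: Gam_induct)
  case (add m' c' f)
  then show ?case
    by (simp add: distrib_left lookup_add mult_single lookup_single when_def algebra_simps)
qed simp

lemma coef_scal_mult [simp]: "coef (scal c * f) m = c * coef f m"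
  using coef_single_mult[of 0 c f m] by (simp add: scal_def)

lemma coef_mult_scal [simp]: "coef (f * scal c) m = c * coef f m"
  by (simp add: mult.commute[of f])

lemma scal_0 [simp]: "scal 0 = 0" and scal_1 [simp]: "scal 1 = 1"
  by (simp_all add: scal_def)

lemma scal_add: "scal (a + b) = scal a + scal b"
  by (simp add: scal_def single_add)

lemma scal_mult: "scal (a * b) = scal a * scal b"
  by (simp add: scal_def mult_single)

lemma scal_uminus: "scal (- a) = - scal a"
  by (simp add: scal_def single_uminus)

lemma scal_of_nat: "scal (of_nat n) = of_nat n"
  by (simp add: scal_def)

lemma scal_numeral: "scal (numeral n) = numeral n"
  by (simp add: scal_def)

lemma scal_power: "scal (a ^ n) = scal a ^ n"
  by (induction n) (simp_all add: scal_mult)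

lemma scal_neg1_power: "scal ((- 1) ^ n) = (- 1) ^ n"
  by (simp add: scal_power scal_uminus)

lemma of_nat_cancel_Gam:
  fixes f g :: Gam
  assumes "of_nat n * f = of_nat n * g" "n > 0"
  shows "f = g"
  using assms by (metis mult_left_cancel of_nat_eq_0_iff less_not_refl)

text \<open>The definition subtracts exponents with truncation, so a monomial free of the variable
  keeps its exponents but receives the coefficient 0. The coefficientwise formula no longer shows
  the truncation.\<close>

lemma coef_pdiff: "coef (pdiff n f) m = of_nat (Poly_Mapping.lookup m (n div 2) + 1) * coef f (m + mvar n)"
proof -
  have eq: "m' - mvar n = m \<longleftrightarrow> m' = m + mvar n" if "Poly_Mapping.lookup m' (n div 2) \<noteq> 0" for m'
  proof
    assume a: "m' - mvar n = m"
    have "m' = m' - mvar n + mvar n"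
      using that by (intro poly_mapping_eqI)
        (auto simp: lookup_add lookup_minus lookup_single when_def)
    then show "m' = m + mvar n" using a by simp
  qed auto
  have "coef (pdiff n f) m = (\<Sum>m'\<in>Poly_Mapping.keys f.
      if m' = m + mvar n then of_nat (Poly_Mapping.lookup m' (n div 2)) * coef f m' else 0)"
    unfolding pdiff_def lookup_sum
  proof (rule sum.cong[OF refl], goal_cases)
    case (1 m')
    show ?case
    proof (cases "Poly_Mapping.lookup m' (n div 2) = 0")
      case True
      then show ?thesis by (auto simp: lookup_add)
    next
      case False
      then show ?thesis using eq[OF False] by (simp add: lookup_single when_def del: One_nat_def)
    qed
  qed
  also have "\<dots> = of_nat (Poly_Mapping.lookup m (n div 2) + 1) * coef f (m + mvar n)"
    by (simp add: sum.delta lookup_add lookup_single in_keys_iff)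
  finally show ?thesis .
qed

lemma pdiff_0 [simp]: "pdiff n 0 = 0"
  by (simp add: pdiff_def)

lemma pdiff_add: "pdiff n (f + g) = pdiff n f + pdiff n g"
  by (rule poly_mapping_eqI) (simp add: coef_pdiff lookup_add algebra_simps)

lemma pdiff_scal: "pdiff n (scal c * f) = scal c * pdiff n f"
  by (rule poly_mapping_eqI) (simp add: coef_pdiff algebra_simps)

lemma pdiff_single:
  "pdiff n (Poly_Mapping.single m c) =
     Poly_Mapping.single (m - mvar n) (of_nat (Poly_Mapping.lookup m (n div 2)) * c)"
  by (simp add: pdiff_def)

text \<open>Leibniz rule. Among odd numbers the variable index \<open>n div 2\<close> determines
  \<open>n\<close>.\<close>

lemma pdiff_psum_mult:
  assumes "odd n" "odd k"
  shows "pdiff n (psum k * f) = (if n = k then f else 0) + psum k * pdiff n f"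
proof (induction f rule: Gam_induct)
  case (add m c f)
  have nk: "n div 2 = k div 2 \<longleftrightarrow> n = k" "k div 2 = n div 2 \<longleftrightarrow> n = k" using assms by (auto elim!: oddE)
  have shift: "mvar k + (m - mvar n) = (mvar k + m) - mvar n"
    if "Poly_Mapping.lookup m (n div 2) \<noteq> 0"
    using that by (intro poly_mapping_eqI)
      (auto simp: lookup_add lookup_minus lookup_single when_def)
  have "pdiff n (psum k * Poly_Mapping.single m c)
    = (if n = k then Poly_Mapping.single m c else 0) + psum k * pdiff n (Poly_Mapping.single m c)"
  proof (cases "Poly_Mapping.lookup m (n div 2) = 0")
    case True
    then show ?thesis
      by (auto simp: psum_def mult_single pdiff_single lookup_add lookup_single nk when_def)
  next
    case False
    have "mvar k + (m - mvar n) = m" if "n = k" using shift[OF False] that by simp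
    then show ?thesis
      using False
      by (auto simp: psum_def mult_single pdiff_single lookup_add lookup_single nk when_def
        shift[OF False, unfolded One_nat_def] distrib_right single_add)
  qed
  then show ?case using add by (simp add: distrib_left pdiff_add)
qed simp

section \<open>The form as a diagonal sum over monomials, and its nondegeneracy\<close>

lemma form_eq: "form f g = (\<Sum>m\<in>Poly_Mapping.keys f. coef f m * coef g m * mono_norm m)"
  unfolding form_def
proof (rule sum.cong[OF refl], goal_cases)
  case (1 m)
  have "(\<Sum>m'\<in>Poly_Mapping.keys g. coef f m * coef g m' * (if m = m' then mono_norm m else 0))
     = (\<Sum>m'\<in>Poly_Mapping.keys g. if m = m' then coef f m * coef g m' * mono_norm m else 0)"
    by (rule sum.cong) auto
  then show ?case by (auto simp: in_keys_iff)
qed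

lemma form_eq_superset:
  assumes "finite A" "Poly_Mapping.keys f \<subseteq> A"
  shows "form f g = (\<Sum>m\<in>A. coef f m * coef g m * mono_norm m)"
  unfolding form_eq by (rule sum.mono_neutral_left) (use assms in \<open>auto simp: in_keys_iff\<close>)

lemma form_add_left: "form (f + f') g = form f g + form f' g"
proof -
  let ?A = "Poly_Mapping.keys f \<union> Poly_Mapping.keys f'"
  have "Poly_Mapping.keys (f + f') \<subseteq> ?A" by (rule keys_add)
  then show ?thesis
    by (subst (1 2 3) form_eq_superset[of ?A])
       (auto simp: lookup_add algebra_simps sum.distrib)
qed

lemma form_add_right: "form f (g + g') = form f g + form f g'"
  by (simp add: form_eq lookup_add algebra_simps sum.distrib)

lemma form_0_left [simp]: "form 0 g = 0" and form_0_right [simp]: "form f 0 = 0"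
  by (simp_all add: form_eq)

lemma form_scal_right: "form f (scal c * g) = c * form f g"
  by (simp add: form_eq sum_distrib_left algebra_simps)

lemma form_scal_left: "form (scal c * f) g = c * form f g"
proof -
  have "Poly_Mapping.keys (scal c * f) \<subseteq> Poly_Mapping.keys f" by (auto simp: in_keys_iff)
  then show ?thesis
    by (subst (1 2) form_eq_superset[of "Poly_Mapping.keys f"])
       (auto simp: sum_distrib_left algebra_simps)
qed

lemma form_sum_left: "form (sum f A) g = (\<Sum>x\<in>A. form (f x) g)"
  by (induction A rule: infinite_finite_induct) (simp_all add: form_add_left)

lemma form_sum_right: "form f (sum g A) = (\<Sum>x\<in>A. form f (g x))"
  by (induction A rule: infinite_finite_induct) (simp_all add: form_add_right)

lemma form_1_1: "form 1 1 = 1"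
  by (simp add: form_eq mono_norm_def)

lemma mono_norm_nonzero: "mono_norm m \<noteq> 0"
proof -
  have "of_nat ((2 * i + 1) ^ a * fact a) / 2 ^ a \<noteq> (0::ratq)" for i a
  proof -
    have "(2::ratq) \<noteq> 0" using of_nat_ratq_eq_0_iff[of 2] by simp
    then show ?thesis
      unfolding divide_eq_0_iff of_nat_ratq_eq_0_iff by simp
  qed
  then show ?thesis by (simp only: mono_norm_def prod_zero_iff finite_keys) blast
qed

text \<open>A monomial paired with an element returns its coefficient there times a nonzero norm.
  This is the device that transfers identities from multiplications to their adjoints.\<close>

lemma form_nondegenerate:
  assumes "\<And>f. form f g = form f h"
  shows "g = h"
proof (rule poly_mapping_eqI)
  fix m
  have "form (Poly_Mapping.single m 1) x = coef x m * mono_norm m" for x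
    by (simp add: form_eq)
  then show "coef g m = coef h m"
    using assms[of "Poly_Mapping.single m 1"] mono_norm_nonzero[of m] by simp
qed

text \<open>Raising the exponent a of p_n by one multiplies n^a a! / 2^a by n (a + 1) / 2.\<close>

lemma mono_norm_add_mvar:
  assumes "odd n"
  shows "mono_norm (mvar n + m) =
    of_nat n / 2 * of_nat (Poly_Mapping.lookup m (n div 2) + 1) * mono_norm m"
proof -
  define i where "i = n div 2"
  have n: "n = 2 * i + 1" using assms i_def by (auto elim!: oddE)
  define w where "w j a = (of_nat ((2 * j + 1) ^ a * fact a) / 2 ^ a :: ratq)" for j a :: nat
  define A where "A = insert i (Poly_Mapping.keys m)"
  have mn: "mono_norm x = (\<Prod>j\<in>A. w j (Poly_Mapping.lookup x j))" if "Poly_Mapping.keys x \<subseteq> A" for x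
    unfolding mono_norm_def w_def
    by (rule prod.mono_neutral_left) (use that in \<open>auto simp: A_def in_keys_iff\<close>)
  have "mono_norm (mvar n + m) = (\<Prod>j\<in>A. w j (Poly_Mapping.lookup (mvar n + m) j))"
    by (rule mn) (auto simp: A_def in_keys_iff lookup_add lookup_single when_def i_def split: if_splits)
  also have "\<dots> = w i (Poly_Mapping.lookup m i + 1) * (\<Prod>j\<in>A - {i}. w j (Poly_Mapping.lookup m j))"
    by (subst prod.remove[of _ i])
       (auto simp: A_def lookup_add lookup_single i_def when_def intro!: arg_cong2[where f = "(*)"] prod.cong)
  also have "w i (Poly_Mapping.lookup m i + 1)
      = of_nat n / 2 * of_nat (Poly_Mapping.lookup m i + 1) * w i (Poly_Mapping.lookup m i)"
    by (simp add: w_def n field_simps)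
  also have "\<dots> * (\<Prod>j\<in>A - {i}. w j (Poly_Mapping.lookup m j))
      = of_nat n / 2 * of_nat (Poly_Mapping.lookup m i + 1) * mono_norm m"
    by (subst mn[of m], (auto simp: A_def)[1], subst prod.remove[of A i]) (auto simp: A_def)
  finally show ?thesis by (simp add: i_def)
qed

text \<open>The factor a + 1 gained by the norm when p_n is multiplied in is the one that
  differentiation produces; n / 2 remains.\<close>

lemma form_psum_mult:
  assumes "odd n"
  shows "form (psum n * f) h = of_nat n / 2 * form f (pdiff n h)"
proof (induction f rule: Gam_induct)
  case (add m c f)
  have s: "form (Poly_Mapping.single m c) x = c * coef x m * mono_norm m" for m c x
    by (simp add: form_eq)
  have "form (psum n * Poly_Mapping.single m c) h = of_nat n / 2 * form (Poly_Mapping.single m c) (pdiff n h)"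
    using mono_norm_add_mvar[OF assms, of m]
    by (simp add: psum_def mult_single s coef_pdiff add.commute del: One_nat_def)
  then show ?case using add by (simp add: distrib_left form_add_left)
qed simp

section \<open>Adjoints of the creation coefficients\<close>

definition euler :: "Gam fps \<Rightarrow> Gam fps" where
  "euler Y = fps_X * fps_deriv Y"

lemma euler_nth [simp]: "euler Y $ m = of_nat m * Y $ m"
  by (cases m) (simp_all add: euler_def)

lemma euler_mult: "euler (Y * Z) = euler Y * Z + Y * euler Z"
  by (simp add: euler_def algebra_simps)

text \<open>As \<open>M\<close> has zero constant term, the coefficient of z^m in
  \<open>M * Y\<close> involves only lower coefficients of \<open>Y\<close>, and m cancels in
  characteristic 0. Products of exponentials can thus be identified by their logarithmic derivatives
  alone.\<close>

lemma euler_unique: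
  assumes "euler Y = M * Y" "euler Z = M * Z" "M $ 0 = 0" "Y $ 0 = Z $ 0"
  shows "Y = Z"
proof (rule fps_ext)
  fix m
  show "Y $ m = Z $ m"
  proof (induction m rule: less_induct)
    case (less m)
    show ?case
    proof (cases "m = 0")
      case False
      have "of_nat m * Y $ m = (\<Sum>i=0..m. M $ i * Y $ (m - i))"
        using arg_cong[OF assms(1), of "\<lambda>F. F $ m"] by (simp add: fps_mult_nth)
      also have "\<dots> = (\<Sum>i=0..m. M $ i * Z $ (m - i))"
      proof (rule sum.cong[OF refl])
        fix i assume "i \<in> {0..m}"
        show "M $ i * Y $ (m - i) = M $ i * Z $ (m - i)"
          using less.IH[of "m - i"] assms(3) False by (cases "i = 0") auto
      qed
      also have "\<dots> = of_nat m * Z $ m"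
        using arg_cong[OF assms(2), of "\<lambda>F. F $ m"] by (simp add: fps_mult_nth)
      finally show ?thesis using False by (auto intro: of_nat_cancel_Gam)
    qed (use assms(4) in simp)
  qed
qed

definition dilate :: "ratq \<Rightarrow> Gam fps \<Rightarrow> Gam fps" where
  "dilate c Y = Abs_fps (\<lambda>k. scal (c ^ k) * Y $ k)"

lemma dilate_nth [simp]: "dilate c Y $ k = scal (c ^ k) * Y $ k"
  by (simp add: dilate_def)

lemma dilate_mult: "dilate c (Y * Z) = dilate c Y * dilate c Z"
proof (rule fps_ext)
  fix k
  show "dilate c (Y * Z) $ k = (dilate c Y * dilate c Z) $ k"
    unfolding dilate_nth fps_mult_nth sum_distrib_left
  proof (rule sum.cong[OF refl])
    fix i assume "i \<in> {0..k}"
    then have "c ^ k = c ^ i * c ^ (k - i)" by (simp flip: power_add)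
    then show "scal (c ^ k) * (Y $ i * Z $ (k - i)) = scal (c ^ i) * Y $ i * (scal (c ^ (k - i)) * Z $ (k - i))"
      by (simp add: scal_mult algebra_simps)
  qed
qed

lemma euler_dilate: "euler Y = M * Y \<Longrightarrow> euler (dilate c Y) = dilate c M * dilate c Y"
  by (subst dilate_mult[symmetric], drule sym) (auto simp: fps_eq_iff algebra_simps)

lemma gexp_nth_0: "gexp F $ 0 = 1"
  by (simp add: gexp_def)

lemma euler_gexp:
  assumes "F $ 0 = 0"
  shows "euler (gexp F) = euler F * gexp F"
proof -
  have "fps_deriv (Abs_fps (\<lambda>k. scal (1 / fact k))) = Abs_fps (\<lambda>k. scal (1 / fact k))"
  proof (rule fps_ext)
    fix n
    have "(1 + of_nat n) * (1 / fact (Suc n)) = (1 / fact n :: ratq)"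
      using of_nat_ratq_eq_0_iff[of "Suc n"] by (simp del: of_nat_Suc add: of_nat_Suc[symmetric])
    then have "of_nat (Suc n) * scal (1 / fact (Suc n)) = scal (1 / fact n)"
      by (simp only: scal_of_nat[symmetric] scal_mult[symmetric] of_nat_Suc)
    then show "fps_deriv (Abs_fps (\<lambda>k. scal (1 / fact k))) $ n = Abs_fps (\<lambda>k. scal (1 / fact k)) $ n"
      by simp
  qed
  then show ?thesis
    unfolding euler_def gexp_def fps_compose_deriv[OF assms] by (simp add: algebra_simps)
qed

definition log_creation :: "Gam fps" where
  "log_creation = Abs_fps (\<lambda>n. if odd n then scal (2 / of_nat n) * psum n else 0)"

text \<open>This is z d/dz of the logarithm of \<open>creation\<close>.\<close>

definition power_sums :: "Gam fps" where
  "power_sums = Abs_fps (\<lambda>n. if odd n then 2 * psum n else 0)"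

lemma scal_of_nat_divide:
  assumes "n > 0"
  shows "of_nat n * (scal (c / of_nat n) * f) = scal c * f"
proof -
  have "of_nat n * scal (c / of_nat n) = scal c"
    using assms of_nat_ratq_eq_0_iff[of n] by (simp add: scal_mult[symmetric] flip: scal_of_nat)
  then show ?thesis by (simp flip: mult.assoc)
qed

lemma creation_gexp: "creation = gexp log_creation"
  by (simp add: creation_def log_creation_def)

lemma creation_nth_0 [simp]: "creation $ 0 = 1"
  by (simp add: creation_def gexp_nth_0)

lemma euler_creation: "euler creation = power_sums * creation"
proof -
  have "euler log_creation = power_sums"
    by (rule fps_ext)
       (auto simp: log_creation_def power_sums_def scal_of_nat_divide scal_numeral odd_pos)
  then show ?thesis
    by (simp add: creation_gexp euler_gexp log_creation_def)
qed

text \<open>Only odd powers of z occur in the logarithm, so z -> -z negates it. The relation is the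
  source of \<open>Qop_Qop_self\<close>.\<close>

lemma creation_inverse: "creation * dilate (- 1) creation = 1"
proof -
  have "dilate (- 1) power_sums = - power_sums"
    by (rule fps_ext) (auto simp: power_sums_def scal_uminus)
  then have "euler (creation * dilate (- 1) creation) = 0 * (creation * dilate (- 1) creation)"
    by (simp add: euler_mult euler_creation euler_dilate[OF euler_creation] algebra_simps)
  then show ?thesis
    by (rule euler_unique) (simp_all add: euler_def)
qed

text \<open>Only odd n enter, so \<open>qq ^ n - 1\<close> is \<open>qq ^ n + (- 1) ^ n\<close> and
  the logarithmic derivative splits into those of the two factors.\<close>

lemma g_series_creation: "g_series = dilate qq creation * dilate (- 1) creation"
proof -
  define F where "F = Abs_fps (\<lambda>n. if odd n then scal (2 * (qq ^ n - 1) / of_nat n) * psum n else 0)"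
  have "euler F = dilate qq power_sums + dilate (- 1) power_sums"
  proof (rule fps_ext)
    fix n
    have "scal (2 * (qq ^ n - 1)) = 2 * scal (qq ^ n) - 2"
      unfolding right_diff_distrib diff_conv_add_uminus scal_add scal_uminus scal_mult scal_numeral
      by simp
    then have "of_nat n * (scal (2 * (qq ^ n - 1) / of_nat n) * psum n) = scal (qq ^ n) * (2 * psum n) - 2 * psum n" if "odd n"
      using that by (simp add: scal_of_nat_divide[OF odd_pos] left_diff_distrib mult.assoc mult.left_commute)
    then show "euler F $ n = (dilate qq power_sums + dilate (- 1) power_sums) $ n"
      by (auto simp: F_def power_sums_def scal_uminus)
  qed
  then have "euler g_series = (dilate qq power_sums + dilate (- 1) power_sums) * g_series"
    by (simp add: g_series_def F_def[symmetric] euler_gexp) (simp add: F_def euler_gexp)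
  moreover have "euler (dilate qq creation * dilate (- 1) creation)
      = (dilate qq power_sums + dilate (- 1) power_sums) * (dilate qq creation * dilate (- 1) creation)"
    by (simp add: euler_mult euler_dilate[OF euler_creation] algebra_simps)
  ultimately show ?thesis
    by (rule euler_unique) (simp_all add: g_series_def gexp_nth_0 power_sums_def)
qed

text \<open>The adjoint of the series \<open>creation\<close> is the exponential of the sum of z^n
  d/dp_n over odd n, while \<open>annihilation\<close> has the opposite sign in the exponent. As n
  is odd, the two differ by the substitution w = -z, whence the sign.\<close>

definition skewing :: "nat \<Rightarrow> Gam \<Rightarrow> Gam" where
  "skewing k f = (- 1) ^ k * annihilation f $ k"

text \<open>A sum of j odd exponents has the parity of j. This allows the sign (-1)^j of the j-th
  term of the exponential to be traded for (-1)^k, which does not depend on j.\<close>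

lemma log_creation_power_parity: "odd (j + k) \<Longrightarrow> (log_creation ^ j) $ k = 0"
proof (induction j arbitrary: k)
  case (Suc j)
  have "log_creation $ i * (log_creation ^ j) $ (k - i) = 0" if "i \<le> k" for i
    using Suc.prems Suc.IH[of "k - i"] that by (cases "odd i") (auto simp: log_creation_def)
  then show ?case by (simp add: fps_mult_nth del: mult_eq_0_iff)
qed (simp add: odd_pos)

lemma form_uminus_right: "form f (- g) = - form f g"
  using form_add_right[of f g "- g"] by (simp add: eq_neg_iff_add_eq_0 add.commute)

lemma form_log_creation_mult: "form (log_creation $ i * f) h = (if odd i then form f (pdiff i h) else 0)"
  using of_nat_ratq_eq_0_iff[of i]
  by (auto simp: log_creation_def mult.assoc form_scal_left form_psum_mult odd_pos)

text \<open>Each factor \<open>log_creation\<close> moved across the form becomes one application of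
  \<open>ann_log\<close>, up to the minus sign built into the latter.\<close>

lemma form_log_creation_power:
  "form ((log_creation ^ j) $ k * f) h = (- 1) ^ j * form f ((ann_log ^^ j) (fps_const h) $ k)"
proof (induction j arbitrary: k f)
  case (Suc j)
  let ?X = "(ann_log ^^ j) (fps_const h)"
  have "(log_creation ^ Suc j) $ k * f
      = (\<Sum>i=0..k. (log_creation ^ j) $ (k - i) * (log_creation $ i * f))"
    by (simp add: fps_mult_nth sum_distrib_left sum_distrib_right algebra_simps)
  then have "form ((log_creation ^ Suc j) $ k * f) h
      = (\<Sum>i=0..k. (- 1) ^ j * (if odd i then form f (pdiff i (?X $ (k - i))) else 0))"
    by (simp only: form_sum_left Suc form_log_creation_mult)
  also have "\<dots> = (- 1) ^ j * (\<Sum>i | odd i \<and> i \<le> k. form f (pdiff i (?X $ (k - i))))"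
  proof -
    have "{i. odd i \<and> i \<le> k} = {i \<in> {0..k}. odd i}" by auto
    then show ?thesis by (simp only: sum_distrib_left[symmetric] sum.inter_filter finite_atLeastAtMost)
  qed
  also have "\<dots> = (- 1) ^ Suc j * form f ((ann_log ^^ Suc j) (fps_const h) $ k)"
    by (simp add: ann_log_def form_sum_right form_uminus_right)
  finally show ?case .
qed (cases k; simp)

lemma form_creation_mult: "form (creation $ k * f) h = form f (skewing k h)"
proof -
  let ?X = "\<lambda>j. (ann_log ^^ j) (fps_const h) $ k"
  have sign: "(- 1) ^ j * form f (?X j) = (- 1) ^ k * form f (?X j)" for j
  proof (cases "odd (j + k)")
    case True
    then have "(- 1) ^ j * form f (?X j) = 0"
      using form_log_creation_power[of j k f h] log_creation_power_parity[of j k] by simp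
    then show ?thesis by simp
  next
    case False
    then have "even j \<longleftrightarrow> even k" by simp
    then show ?thesis by (cases "even j") auto
  qed
  have "creation $ k * f = (\<Sum>j\<le>k. scal (1 / fact j) * ((log_creation ^ j) $ k * f))"
    unfolding creation_gexp gexp_def fps_compose_nth atMost_atLeast0 sum_distrib_right by (simp add: mult.assoc)
  then have "form (creation $ k * f) h = (\<Sum>j\<le>k. 1 / fact j * ((- 1) ^ j * form f (?X j)))"
    by (simp add: form_sum_left form_scal_left form_log_creation_power)
  also have "\<dots> = (\<Sum>j\<le>k. 1 / fact j * ((- 1) ^ k * form f (?X j)))"
    by (simp only: sign)
  also have "\<dots> = (- 1) ^ k * form f (annihilation h $ k)"
    by (simp add: annihilation_def form_sum_right form_scal_right sum_distrib_left mult.left_commute)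
  also have "\<dots> = form f (scal ((- 1) ^ k) * annihilation h $ k)"
    by (simp add: form_scal_right)
  finally show ?thesis by (simp add: skewing_def scal_neg1_power)
qed

lemma skewing_add: "skewing k (f + g) = skewing k f + skewing k g"
  by (rule form_nondegenerate) (simp add: form_creation_mult[symmetric] form_add_right)

lemma skewing_scal: "skewing k (scal c * f) = scal c * skewing k f"
  by (rule form_nondegenerate) (simp add: form_creation_mult[symmetric] form_scal_right)

lemma skewing_zero [simp]: "skewing k 0 = 0"
  using skewing_scal[of k 0 0] by simp

lemma skewing_sum: "skewing k (sum f A) = (\<Sum>x\<in>A. skewing k (f x))"
  by (induction A rule: infinite_finite_induct) (simp_all add: skewing_add)

lemma skewing_0 [simp]: "skewing 0 f = f"
  by (rule form_nondegenerate) (simp add: form_creation_mult[symmetric])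

lemma skewing_commute: "skewing k (skewing l f) = skewing l (skewing k f)"
  by (rule form_nondegenerate) (simp add: form_creation_mult[symmetric] mult.left_commute)

text \<open>The adjoint of multiplication by the n-th coefficient of \<open>power_sums\<close>; the
  value 0 at even n permits sums over all indices.\<close>

definition ddeg :: "nat \<Rightarrow> Gam \<Rightarrow> Gam" where
  "ddeg n f = (if odd n then of_nat n * pdiff n f else 0)"

lemma form_power_sums_mult: "form (power_sums $ n * f) h = form f (ddeg n h)"
proof (cases "odd n")
  case True
  have "power_sums $ n * f = scal 2 * (psum n * f)"
    using True by (simp add: power_sums_def scal_numeral mult.assoc)
  then have "form (power_sums $ n * f) h = 2 * form (psum n * f) h"
    by (simp only: form_scal_left)
  then show ?thesis
    using True of_nat_ratq_eq_0_iff[of 2]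
    by (simp add: form_psum_mult ddeg_def form_scal_right flip: scal_of_nat)
qed (simp add: power_sums_def ddeg_def)

text \<open>Adjoint of the Euler equation for \<open>creation\<close>. It expresses the skewing
  operators recursively by derivations and drives the inductions on k.\<close>

lemma skewing_rec: "of_nat k * skewing k f = (\<Sum>n\<le>k. ddeg n (skewing (k - n) f))"
proof (rule form_nondegenerate)
  fix h
  have "of_nat k * creation $ k = (\<Sum>n\<le>k. power_sums $ n * creation $ (k - n))"
    using arg_cong[OF euler_creation, of "\<lambda>F. F $ k"] by (simp add: fps_mult_nth atMost_atLeast0)
  then have "scal (of_nat k) * (creation $ k * h) = (\<Sum>n\<le>k. creation $ (k - n) * (power_sums $ n * h))"
    unfolding scal_of_nat mult.assoc[symmetric] by (simp add: sum_distrib_left sum_distrib_right mult_ac)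
  then have "of_nat k * form (creation $ k * h) f = form (\<Sum>n\<le>k. creation $ (k - n) * (power_sums $ n * h)) f"
    by (metis form_scal_left)
  then show "form h (of_nat k * skewing k f) = form h (\<Sum>n\<le>k. ddeg n (skewing (k - n) f))"
    by (simp add: form_sum_left form_sum_right form_creation_mult form_power_sums_mult form_scal_right
        flip: scal_of_nat)
qed

section \<open>Commutation relations\<close>

lemma sum_triangle_antidiagonal:
  fixes g :: "nat \<Rightarrow> nat \<Rightarrow> 'a::comm_monoid_add"
  shows "(\<Sum>n\<le>k. \<Sum>j\<le>k - n. g n j) = (\<Sum>i\<le>k. \<Sum>n\<le>i. g n (i - n))"
  unfolding sum.triangle_reindex_eq[of g k, symmetric]
  by (subst sum.Sigma) (auto intro!: sum.cong)

lemma sum_triangle_swap: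
  fixes g :: "nat \<Rightarrow> nat \<Rightarrow> 'a::comm_monoid_add"
  shows "(\<Sum>n\<le>k. \<Sum>j\<le>k - n. g n j) = (\<Sum>j\<le>k. \<Sum>n\<le>k - j. g n j)"
  by (subst sum.Sigma, simp, simp, subst sum.Sigma, simp, simp,
      rule sum.reindex_bij_witness[where i = prod.swap and j = prod.swap]) auto

lemma ddeg_0 [simp]: "ddeg 0 f = 0"
  by (simp add: ddeg_def)

lemma ddeg_zero [simp]: "ddeg n 0 = 0"
  by (simp add: ddeg_def)

lemma ddeg_add: "ddeg n (f + g) = ddeg n f + ddeg n g"
  by (simp add: ddeg_def pdiff_add algebra_simps)

lemma ddeg_scal: "ddeg n (scal c * f) = scal c * ddeg n f"
  by (simp add: ddeg_def pdiff_scal mult.left_commute)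

lemma ddeg_of_nat: "ddeg n (of_nat c * f) = of_nat c * ddeg n f"
  using ddeg_scal[of n "of_nat c" f] by (simp add: scal_of_nat)

lemma ddeg_sum: "ddeg n (sum f A) = (\<Sum>x\<in>A. ddeg n (f x))"
  by (induction A rule: infinite_finite_induct) (simp_all add: ddeg_add)

text \<open>The coefficients of x d/dx log((1 + x) / (1 - x)).\<close>

definition odd_two :: "nat \<Rightarrow> Gam" where "odd_two n = (if odd n then 2 else 0)"

text \<open>The coefficients of \<open>(1 + x) / (1 - x)\<close>.\<close>

definition cayley_coef :: "nat \<Rightarrow> Gam" where "cayley_coef j = (if j = 0 then 1 else 2)"

text \<open>Integer indices are used because the commutation relations shift them below 0, where the
  coefficient is 0.\<close>

definition qcoef :: "int \<Rightarrow> Gam" where "qcoef n = (if n < 0 then 0 else creation $ nat n)"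

lemma qcoef_neg [simp]: "n < 0 \<Longrightarrow> qcoef n = 0"
  by (simp add: qcoef_def)

lemma qcoef_of_nat [simp]: "qcoef (int n) = creation $ n"
  by (simp add: qcoef_def)

lemma qcoef_0 [simp]: "qcoef 0 = 1"
  by (simp add: qcoef_def)

lemma qcoef_rec:
  assumes "j \<le> int m"
  shows "(\<Sum>k\<le>m. power_sums $ k * qcoef (j - int k)) = of_int j * qcoef j"
proof (cases "j < 0")
  case False
  then obtain n where j: "j = int n" by (metis nonneg_int_cases not_less)
  have "(\<Sum>k\<le>m. power_sums $ k * qcoef (j - int k)) = (\<Sum>k\<le>n. power_sums $ k * qcoef (j - int k))"
    by (rule sum.mono_neutral_right) (use assms j in auto)
  also have "\<dots> = (\<Sum>k\<le>n. power_sums $ k * creation $ (n - k))"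
    by (rule sum.cong) (simp_all add: j flip: of_nat_diff)
  also have "\<dots> = of_nat n * creation $ n"
    using arg_cong[OF euler_creation, of "\<lambda>F. F $ n"] by (simp add: fps_mult_nth atMost_atLeast0)
  finally show ?thesis by (simp add: j)
qed simp

lemma ddeg_power_sums_mult:
  "ddeg n (power_sums $ k * f) = (if k = n then of_nat n * odd_two n * f else 0) + power_sums $ k * ddeg n f"
proof (cases "odd n \<and> odd k")
  case True
  have "pdiff n (2 * psum k * f) = 2 * ((if n = k then f else 0) + psum k * pdiff n f)"
    using pdiff_scal[of n 2 "psum k * f"] True by (simp add: scal_numeral mult.assoc pdiff_psum_mult)
  then show ?thesis
    using True by (simp add: ddeg_def power_sums_def odd_two_def algebra_simps)
qed (auto simp: ddeg_def power_sums_def odd_two_def)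

text \<open>In generating functions: for odd n the logarithm of \<open>creation\<close> contains 2
  p_n w^n / n, so n d/dp_n multiplies the series by 2 w^n. The coefficients are reached by induction
  from the Euler equation.\<close>

lemma ddeg_creation_mult:
  "ddeg n (creation $ m * f) = odd_two n * qcoef (int m - int n) * f + creation $ m * ddeg n f"
proof (induction m rule: less_induct)
  case (less m)
  show ?case
  proof (cases "m = 0")
    case True
    then show ?thesis by (cases "n = 0") (auto simp: odd_two_def)
  next
    case False
    have "of_nat m * creation $ m = (\<Sum>k\<le>m. power_sums $ k * creation $ (m - k))"
      using arg_cong[OF euler_creation, of "\<lambda>F. F $ m"] by (simp add: fps_mult_nth atMost_atLeast0)
    then have "of_nat m * (creation $ m * f) = (\<Sum>k\<le>m. power_sums $ k * (creation $ (m - k) * f))"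
      by (simp add: sum_distrib_right flip: mult.assoc)
    then have "of_nat m * ddeg n (creation $ m * f)
        = (\<Sum>k\<le>m. ddeg n (power_sums $ k * (creation $ (m - k) * f)))"
      by (metis ddeg_of_nat ddeg_sum)
    also have "\<dots> = (\<Sum>k\<le>m. (if k = n then of_nat n * odd_two n * qcoef (int m - int n) * f else 0)
        + (odd_two n * f * (power_sums $ k * qcoef ((int m - int n) - int k))
        + (power_sums $ k * qcoef (int m - int k)) * ddeg n f))"
    proof (rule sum.cong[OF refl])
      fix k assume k: "k \<in> {..m}"
      have "power_sums $ k * ddeg n (creation $ (m - k) * f)
        = power_sums $ k * (odd_two n * qcoef (int (m - k) - int n) * f + creation $ (m - k) * ddeg n f)"
        using less.IH[of "m - k"] False by (cases "k = 0") (auto simp: power_sums_def)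
      moreover have "int (m - k) - int n = (int m - int n) - int k" "creation $ (m - k) = qcoef (int m - int k)"
        using k by (auto simp flip: of_nat_diff)
      ultimately show "ddeg n (power_sums $ k * (creation $ (m - k) * f))
        = (if k = n then of_nat n * odd_two n * qcoef (int m - int n) * f else 0)
        + (odd_two n * f * (power_sums $ k * qcoef ((int m - int n) - int k))
        + (power_sums $ k * qcoef (int m - int k)) * ddeg n f)"
        unfolding ddeg_power_sums_mult by (auto simp: algebra_simps)
    qed
    \<comment> \<open>The term k = n contributes the factor n, and \<open>qcoef_rec\<close> at index
      m - n contributes m - n; together they give m, which is cancelled at the end.\<close>
    also have "\<dots> = of_nat n * odd_two n * qcoef (int m - int n) * f
        + (odd_two n * f * (of_int (int m - int n) * qcoef (int m - int n)) + of_nat m * creation $ m * ddeg n f)"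
      unfolding sum.distrib sum_distrib_left[symmetric] sum_distrib_right[symmetric]
      by (simp add: qcoef_rec)
    also have "\<dots> = of_nat m * (odd_two n * qcoef (int m - int n) * f + creation $ m * ddeg n f)"
      by (simp add: algebra_simps)
    finally show ?thesis using False by (auto intro: of_nat_cancel_Gam)
  qed
qed

lemma ddeg_qcoef_mult:
  "ddeg n (qcoef m * f) = odd_two n * qcoef (m - int n) * f + qcoef m * ddeg n f"
  by (cases "m < 0") (auto simp: not_less elim!: nonneg_int_cases simp: ddeg_creation_mult)

lemma cayley_coef_rec: "(\<Sum>n\<le>i. odd_two n * cayley_coef (i - n)) = of_nat i * cayley_coef i"
proof (cases "i = 0")
  case False
  have *: "(\<Sum>n<i. 2 * odd_two n) + odd_two i = 2 * of_nat i" for i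
    by (induction i) (auto simp: odd_two_def algebra_simps)
  have "(\<Sum>n\<le>i. odd_two n * cayley_coef (i - n)) = (\<Sum>n<i. odd_two n * cayley_coef (i - n)) + odd_two i"
    by (simp add: cayley_coef_def flip: lessThan_Suc_atMost)
  also have "(\<Sum>n<i. odd_two n * cayley_coef (i - n)) = (\<Sum>n<i. 2 * odd_two n)"
    by (rule sum.cong) (auto simp: cayley_coef_def)
  finally show ?thesis using * False by (simp add: cayley_coef_def mult.commute)
qed (simp add: odd_two_def)

lemma ddeg_cayley_coef_mult: "ddeg n (cayley_coef j * f) = cayley_coef j * ddeg n f"
  using ddeg_of_nat[of n 2 f] by (simp add: cayley_coef_def)

text \<open>Coefficient form of the commutation with factor (1 + zw) / (1 - zw). By
  \<open>skewing_rec\<close>, k times the left side is a sum of derivatives: those falling on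
  \<open>qcoef\<close> yield the weight j through \<open>cayley_coef_rec\<close>, those falling on
  the skewed \<open>f\<close> yield k - j.\<close>

lemma skewing_qcoef_mult:
  "skewing k (qcoef m * f) = (\<Sum>j\<le>k. cayley_coef j * qcoef (m - int j) * skewing (k - j) f)"
proof (induction k rule: less_induct)
  case (less k)
  let ?R = "\<lambda>i. skewing i f"
  show ?case
  proof (cases "k = 0")
    case False
    have "of_nat k * skewing k (qcoef m * f) = (\<Sum>n\<le>k. ddeg n (skewing (k - n) (qcoef m * f)))"
      by (rule skewing_rec)
    also have "\<dots> = (\<Sum>n\<le>k. ddeg n (\<Sum>j\<le>k - n. cayley_coef j * qcoef (m - int j) * ?R (k - n - j)))"
    proof (rule sum.cong[OF refl])
      fix n
      show "ddeg n (skewing (k - n) (qcoef m * f))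
        = ddeg n (\<Sum>j\<le>k - n. cayley_coef j * qcoef (m - int j) * ?R (k - n - j))"
        using less.IH[of "k - n"] False by (cases "n = 0") auto
    qed
    also have "\<dots> = (\<Sum>n\<le>k. \<Sum>j\<le>k - n. odd_two n * cayley_coef j * qcoef (m - int (n + j)) * ?R (k - (n + j)))
        + (\<Sum>n\<le>k. \<Sum>j\<le>k - n. cayley_coef j * qcoef (m - int j) * ddeg n (?R (k - n - j)))"
      unfolding ddeg_sum sum.distrib[symmetric]
    proof (intro sum.cong[OF refl])
      fix n j
      have "m - int j - int n = m - int (n + j)" "k - n - j = k - (n + j)" by simp_all
      then show "ddeg n (cayley_coef j * qcoef (m - int j) * ?R (k - n - j))
        = odd_two n * cayley_coef j * qcoef (m - int (n + j)) * ?R (k - (n + j))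
          + cayley_coef j * qcoef (m - int j) * ddeg n (?R (k - n - j))"
        by (simp only: mult.assoc ddeg_cayley_coef_mult ddeg_qcoef_mult distrib_left mult.left_commute)
    qed
    also have "(\<Sum>n\<le>k. \<Sum>j\<le>k - n. odd_two n * cayley_coef j * qcoef (m - int (n + j)) * ?R (k - (n + j)))
        = (\<Sum>i\<le>k. \<Sum>n\<le>i. odd_two n * cayley_coef (i - n) * (qcoef (m - int i) * ?R (k - i)))"
      by (subst sum_triangle_antidiagonal) (auto intro!: sum.cong simp: mult.assoc)
    also have "\<dots> = (\<Sum>i\<le>k. of_nat i * (cayley_coef i * qcoef (m - int i) * ?R (k - i)))"
      unfolding sum_distrib_right[symmetric] cayley_coef_rec by (simp add: mult.assoc)
    also have "(\<Sum>n\<le>k. \<Sum>j\<le>k - n. cayley_coef j * qcoef (m - int j) * ddeg n (?R (k - n - j)))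
        = (\<Sum>j\<le>k. cayley_coef j * qcoef (m - int j) * (\<Sum>n\<le>k - j. ddeg n (?R (k - j - n))))"
      by (subst sum_triangle_swap) (simp add: sum_distrib_left add.commute)
    also have "\<dots> = (\<Sum>j\<le>k. of_nat (k - j) * (cayley_coef j * qcoef (m - int j) * ?R (k - j)))"
      by (simp only: skewing_rec[symmetric] mult_ac)
    also have "(\<Sum>i\<le>k. of_nat i * (cayley_coef i * qcoef (m - int i) * ?R (k - i))) + \<dots>
        = (\<Sum>i\<le>k. of_nat k * (cayley_coef i * qcoef (m - int i) * ?R (k - i)))"
      unfolding sum.distrib[symmetric] distrib_right[symmetric] of_nat_add[symmetric]
      by (rule sum.cong) auto
    also have "\<dots> = of_nat k * (\<Sum>j\<le>k. cayley_coef j * qcoef (m - int j) * ?R (k - j))"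
      by (simp add: sum_distrib_left)
    finally show ?thesis using False by (auto intro: of_nat_cancel_Gam)
  qed (simp add: cayley_coef_def)
qed

section \<open>Weighted degree and truncation of the sum defining \<open>Qop\<close>\<close>

definition wdeg :: "(nat \<Rightarrow>\<^sub>0 nat) \<Rightarrow> nat" where
  "wdeg m = (\<Sum>i\<in>Poly_Mapping.keys m. (2 * i + 1) * Poly_Mapping.lookup m i)"

lemma wdeg_add_mvar:
  assumes "odd n"
  shows "wdeg (m + mvar n) = wdeg m + n"
proof -
  define A where "A = insert (n div 2) (Poly_Mapping.keys m)"
  have w: "wdeg x = (\<Sum>i\<in>A. (2 * i + 1) * Poly_Mapping.lookup x i)" if "Poly_Mapping.keys x \<subseteq> A" for x
    unfolding wdeg_def by (rule sum.mono_neutral_left) (use that in \<open>auto simp: A_def in_keys_iff\<close>)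
  have "wdeg (m + mvar n) = (\<Sum>i\<in>A. (2 * i + 1) * Poly_Mapping.lookup (m + mvar n) i)"
    by (rule w) (auto simp: A_def in_keys_iff lookup_add lookup_single when_def split: if_splits)
  also have "\<dots> = (\<Sum>i\<in>A. (2 * i + 1) * Poly_Mapping.lookup m i + (if n div 2 = i then n else 0))"
    by (rule sum.cong) (use assms in \<open>auto simp: lookup_add lookup_single when_def elim!: oddE\<close>)
  also have "\<dots> = wdeg m + n"
    by (subst w[of m]) (auto simp: A_def sum.distrib)
  finally show ?thesis .
qed

text \<open>By \<open>skewing_rec\<close>, since \<open>ddeg n\<close> lowers the weighted degree by
  n. It is an upper bound on degrees because elements of \<open>Gam\<close> need not be
  homogeneous.\<close>

lemma skewing_wdeg:
  assumes "\<forall>m\<in>Poly_Mapping.keys f. wdeg m \<le> d" "m \<in> Poly_Mapping.keys (skewing k f)"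
  shows "wdeg m + k \<le> d"
  using assms(2)
proof (induction k arbitrary: m rule: less_induct)
  case (less k)
  show ?case
  proof (cases "k = 0")
    case False
    have "coef (of_nat k * skewing k f) m \<noteq> 0"
      using less.prems False of_nat_ratq_eq_0_iff[of k] by (simp add: in_keys_iff flip: scal_of_nat)
    then have "(\<Sum>n\<le>k. coef (ddeg n (skewing (k - n) f)) m) \<noteq> 0"
      by (simp add: skewing_rec lookup_sum)
    then obtain n where n: "n \<le> k" "coef (ddeg n (skewing (k - n) f)) m \<noteq> 0"
      by (metis (no_types, lifting) sum.neutral atMost_iff)
    then have odd: "odd n" by (auto simp: ddeg_def split: if_splits)
    then have "m + mvar n \<in> Poly_Mapping.keys (skewing (k - n) f)"
      using n by (auto simp: ddeg_def coef_pdiff in_keys_iff simp flip: scal_of_nat)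
    then have "wdeg (m + mvar n) + (k - n) \<le> d"
      using less.IH[of "k - n"] odd n False by (metis odd_pos diff_less gr0I)
    then show ?thesis using n by (simp only: wdeg_add_mvar[OF odd])
  qed (use less.prems assms(1) in simp)
qed

lemma skewing_eventually_zero: "\<exists>K. \<forall>k>K. skewing k f = 0"
proof -
  define d where "d = Max (insert 0 (wdeg ` Poly_Mapping.keys f))"
  have "\<forall>m\<in>Poly_Mapping.keys f. wdeg m \<le> d" by (auto simp: d_def)
  then have "skewing k f = 0" if "k > d" for k
    using skewing_wdeg[of f d _ k] that by (metis add_leD2 all_not_in_conv keys_eq_empty not_less)
  then show ?thesis by blast
qed

lemma skewing_1: "k > 0 \<Longrightarrow> skewing k 1 = 0"
  using skewing_wdeg[of 1 0 _ k] by (auto simp: wdeg_def simp flip: keys_eq_empty)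

text \<open>Any bound past which the skewings of \<open>f\<close> vanish serves as cutoff, so
  several arguments can share one. The sign turns \<open>annihilation\<close> back into
  \<open>skewing\<close>, and \<open>qcoef\<close> absorbs the condition on the index.\<close>

lemma Qop_eq:
  assumes "\<And>l. l > K \<Longrightarrow> skewing l f = 0"
  shows "Qop n f = (\<Sum>l\<le>K. (- 1) ^ l * qcoef (n + int l) * skewing l f)"
proof -
  have ann: "annihilation f $ k = (- 1) ^ k * skewing k f" for k
    by (simp add: skewing_def flip: mult.assoc power_add)
  have "Qop n f = (\<Sum>k | annihilation f $ k \<noteq> 0 \<and> 0 \<le> n + int k. (- 1) ^ k * qcoef (n + int k) * skewing k f)"
    unfolding Qop_def by (rule sum.cong) (auto simp: qcoef_def ann)
  also have "\<dots> = (\<Sum>l\<le>K. (- 1) ^ l * qcoef (n + int l) * skewing l f)"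
  proof (rule sum.mono_neutral_left)
    show "{k. annihilation f $ k \<noteq> 0 \<and> 0 \<le> n + int k} \<subseteq> {..K}"
      using assms ann by (metis (mono_tags, lifting) atMost_iff mem_Collect_eq mult_zero_right not_le subsetI)
  qed (auto simp: ann qcoef_def)
  finally show ?thesis .
qed

lemma Qop_0_1: "Qop 0 1 = 1"
  using Qop_eq[of 0 1 0] by (simp add: skewing_1)

lemma Qop_add: "Qop n (f + g) = Qop n f + Qop n g"
proof -
  obtain K1 K2 where "\<forall>k>K1. skewing k f = 0" "\<forall>k>K2. skewing k g = 0"
    using skewing_eventually_zero by meson
  then show ?thesis
    by (subst (1 2 3) Qop_eq[of "max K1 K2"])
       (auto simp: skewing_add algebra_simps sum.distrib)
qed

lemma Qop_scal: "Qop n (scal c * f) = scal c * Qop n f"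
proof -
  obtain K where K: "skewing k f = 0" if "k > K" for k
    using skewing_eventually_zero by meson
  then have "skewing k (scal c * f) = 0" if "k > K" for k
    using that by (simp add: skewing_scal)
  then show ?thesis
    by (simp only: Qop_eq[of K] K skewing_scal sum_distrib_left mult.left_commute)
qed

lemma Qop_zero [simp]: "Qop n 0 = 0"
  using Qop_scal[of n 0 0] by simp

lemma Qop_sum: "Qop n (sum f A) = (\<Sum>x\<in>A. Qop n (f x))"
  by (induction A rule: infinite_finite_induct) (simp_all add: Qop_add)

section \<open>Relations between skewing operators and \<open>Qop\<close>\<close>

lemma skewing_sign: "skewing k ((- 1) ^ l * f) = (- 1) ^ l * skewing k f"
  using skewing_scal[of k "(- 1) ^ l" f] by (simp add: scal_neg1_power)

text \<open>The skewing operators commute among themselves, so the factor (1 + zw) / (1 - zw) arises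
  only from \<open>qcoef\<close> and passes unchanged to \<open>Qop\<close>.\<close>

lemma skewing_Qop:
  "skewing k (Qop n f) = (\<Sum>j\<le>k. cayley_coef j * Qop (n - int j) (skewing (k - j) f))"
proof -
  obtain K where K: "skewing l f = 0" if "l > K" for l
    using skewing_eventually_zero by meson
  have "skewing k (Qop n f)
      = (\<Sum>l\<le>K. \<Sum>j\<le>k. (- 1) ^ l * (cayley_coef j * qcoef (n + int l - int j) * skewing (k - j) (skewing l f)))"
    by (simp add: Qop_eq[of K, OF K] skewing_sum mult.assoc skewing_sign skewing_qcoef_mult sum_distrib_left)
  also have "\<dots> = (\<Sum>j\<le>k. cayley_coef j * (\<Sum>l\<le>K. (- 1) ^ l * qcoef (n - int j + int l) * skewing l (skewing (k - j) f)))"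
    unfolding sum_distrib_left sum.swap[of _ "{..K}"]
  proof (intro sum.cong[OF refl])
    fix j l
    have "n + int l - int j = n - int j + int l" by simp
    then show "(- 1) ^ l * (cayley_coef j * qcoef (n + int l - int j) * skewing (k - j) (skewing l f))
      = cayley_coef j * ((- 1) ^ l * qcoef (n - int j + int l) * skewing l (skewing (k - j) f))"
      by (simp only: skewing_commute[of "k - j" l] mult_ac)
  qed
  also have "\<dots> = (\<Sum>j\<le>k. cayley_coef j * Qop (n - int j) (skewing (k - j) f))"
  proof -
    have "skewing l (skewing (k - j) f) = 0" if "l > K" for l j
      using K[OF that] by (subst skewing_commute) simp
    then show ?thesis by (simp add: Qop_eq[of K])
  qed
  finally show ?thesis .
qed

text \<open>The preceding relation multiplied by the denominator 1 - zw: the long sum collapses to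
  terms in which n drops by at most one.\<close>

lemma skewing_Qop_Suc:
  "skewing (Suc k) (Qop n f) =
     skewing k (Qop (n - 1) f) + Qop n (skewing (Suc k) f) + Qop (n - 1) (skewing k f)"
proof -
  let ?X = "\<lambda>j. Qop (n - 1 - int j) (skewing (k - j) f)"
  have "skewing (Suc k) (Qop n f) = Qop n (skewing (Suc k) f) + (\<Sum>j\<le>k. 2 * ?X j)"
    unfolding skewing_Qop sum.atMost_Suc_shift by (simp add: cayley_coef_def algebra_simps)
  also have "(\<Sum>j\<le>k. 2 * ?X j) = (\<Sum>j\<le>k. cayley_coef j * ?X j + (if j = 0 then ?X 0 else 0))"
    by (rule sum.cong) (auto simp: cayley_coef_def)
  also have "\<dots> = skewing k (Qop (n - 1) f) + Qop (n - 1) (skewing k f)"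
    by (simp add: sum.distrib skewing_Qop)
  finally show ?thesis by simp
qed

text \<open>Let A = a + l and B = a + i. Up to a common sign both sums consist of the terms (-1)^u
  q_u q_(A+B-u), the first over u \<le> A and the second over u \<ge> A. Each term gets coefficient
  2, the middle one as 1 + 1. The total is twice the coefficient of z^(A+B) in the product of
  \<open>creation_inverse\<close>, which is 0 as A + B > 0.\<close>

lemma qcoef_alternating_sum:
  assumes "a > 0"
  shows "(\<Sum>j\<le>a + l. (- 1) ^ j * cayley_coef j * (qcoef (int (a + i + j)) * qcoef (int (a + l) - int j)))
    + (\<Sum>j\<le>a + i. (- 1) ^ j * cayley_coef j * (qcoef (int (a + l + j)) * qcoef (int (a + i) - int j))) = 0"
proof -
  let ?A = "a + l" and ?B = "a + i"
  define t where "t u = (- 1) ^ u * (creation $ u * creation $ (?A + ?B - u))" for u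
  define s :: Gam where "s = (- 1) ^ ?A"
  have sgn: "(- 1) ^ j = s * (- 1) ^ u" if "even (j + ?A + u)" for j u
    using that by (cases "even j"; cases "even u") (auto simp: s_def)
  have q: "qcoef (int x - int y) = creation $ (x - y)" if "y \<le> x" for x y
    using that by (simp flip: of_nat_diff)
  have 1: "(\<Sum>j\<le>?A. (- 1) ^ j * cayley_coef j * (qcoef (int (?B + j)) * qcoef (int ?A - int j)))
      = s * (\<Sum>u\<le>?A. cayley_coef (?A - u) * t u)"
    unfolding sum_distrib_left
  proof (rule sum.reindex_bij_witness[where i = "\<lambda>u. ?A - u" and j = "\<lambda>j. ?A - j"])
    fix j assume "j \<in> {..?A}"
    then have "qcoef (int ?A - int j) = creation $ (?A - j)" "?A - (?A - j) = j"
        "?A + ?B - (?A - j) = ?B + j" "(- 1) ^ j = s * (- 1) ^ (?A - j)"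
      by (auto simp only: q atMost_iff intro!: sgn) auto
    then show "s * (cayley_coef (?A - (?A - j)) * t (?A - j))
        = (- 1) ^ j * cayley_coef j * (qcoef (int (?B + j)) * qcoef (int ?A - int j))"
      by (simp only: t_def qcoef_of_nat mult_ac)
  qed auto
  have 2: "(\<Sum>j\<le>?B. (- 1) ^ j * cayley_coef j * (qcoef (int (?A + j)) * qcoef (int ?B - int j)))
      = s * (\<Sum>u\<in>{?A..?A + ?B}. cayley_coef (u - ?A) * t u)"
    unfolding sum_distrib_left
  proof (rule sum.reindex_bij_witness[where i = "\<lambda>u. u - ?A" and j = "\<lambda>j. ?A + j"])
    fix j assume "j \<in> {..?B}"
    then have "qcoef (int ?B - int j) = creation $ (?B - j)" "?A + j - ?A = j"
        "?A + ?B - (?A + j) = ?B - j" "(- 1) ^ j = s * (- 1) ^ (?A + j)"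
      by (auto simp only: q atMost_iff intro!: sgn) auto
    then show "s * (cayley_coef (?A + j - ?A) * t (?A + j))
        = (- 1) ^ j * cayley_coef j * (qcoef (int (?A + j)) * qcoef (int ?B - int j))"
      by (simp only: t_def qcoef_of_nat mult_ac)
  qed auto
  have "(\<Sum>u\<le>?A + ?B. 2 * t u) = 2 * (creation * dilate (- 1) creation) $ (?A + ?B)"
    unfolding mult.commute[of creation] fps_mult_nth
    by (simp add: sum_distrib_left t_def scal_neg1_power atMost_atLeast0 mult.assoc)
  also have "\<dots> = 0" using assms by (simp add: creation_inverse)
  finally have 3: "(\<Sum>u\<le>?A + ?B. 2 * t u) = 0" .
  have "(\<Sum>u\<le>?A. cayley_coef (?A - u) * t u) = (\<Sum>u<?A. 2 * t u) + t ?A"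
    unfolding lessThan_Suc_atMost[symmetric] sum.lessThan_Suc by (auto simp: cayley_coef_def intro!: sum.cong)
  moreover have "(\<Sum>u\<in>{?A..?A + ?B}. cayley_coef (u - ?A) * t u) = t ?A + (\<Sum>u\<in>{?A<..?A + ?B}. 2 * t u)"
    by (subst sum.head) (auto simp: cayley_coef_def intro!: sum.cong)
  moreover have "(\<Sum>u\<le>?A + ?B. 2 * t u) = (\<Sum>u<?A. 2 * t u) + 2 * t ?A + (\<Sum>u\<in>{?A<..?A + ?B}. 2 * t u)"
  proof -
    have "{..?A + ?B} = {..<?A} \<union> insert ?A {?A<..?A + ?B}" by auto
    then show ?thesis by (simp only:) (subst sum.union_disjoint, auto)
  qed
  ultimately have "(\<Sum>u\<le>?A. cayley_coef (?A - u) * t u) + (\<Sum>u\<in>{?A..?A + ?B}. cayley_coef (u - ?A) * t u) = 0"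
    using 3 by (simp add: algebra_simps)
  then show ?thesis unfolding 1 2 by (simp flip: distrib_left)
qed

text \<open>Expansion gives a double sum of \<open>S i l * W i l\<close>, where \<open>W\<close> is
  symmetric because skewings commute and \<open>S\<close> is antisymmetric by
  \<open>qcoef_alternating_sum\<close>. The sum equals its own negative.\<close>

lemma Qop_Qop_self:
  assumes "a > 0"
  shows "Qop (int a) (Qop (int a) f) = 0"
proof -
  obtain K where K: "skewing l f = 0" if "l > K" for l
    using skewing_eventually_zero by meson
  have KR: "skewing l (skewing i f) = 0" if "l > K" for l i
    using K[OF that] by (subst skewing_commute) simp
  let ?RR = "\<lambda>i l. skewing l (skewing i f)"
  have QR: "Qop n (skewing i f) = (\<Sum>l\<le>K. (- 1) ^ l * qcoef (n + int l) * ?RR i l)" for n i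
    by (rule Qop_eq) (rule KR)
  have RQ: "skewing k (Qop (int a) f)
      = (\<Sum>j\<le>k. \<Sum>l\<le>K. (- 1) ^ l * cayley_coef j * qcoef (int (a + l) - int j) * ?RR (k - j) l)" for k
    unfolding skewing_Qop QR sum_distrib_left
  proof (intro sum.cong[OF refl], goal_cases)
    case (1 j l)
    have "int a - int j + int l = int (a + l) - int j" by simp
    then show ?case
      by (simp only: mult_ac)
  qed
  \<comment> \<open>For k beyond this bound, either k - j > K and the inner skewing vanishes, or j >
    a + l and the index of \<open>qcoef\<close> is negative.\<close>
  define K' where "K' = a + 2 * K"
  have "skewing k (Qop (int a) f) = 0" if "k > K'" for k
    unfolding RQ
  proof (intro sum.neutral ballI)
    fix j l assume "j \<in> {..k}" "l \<in> {..K}"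
    then show "(- 1) ^ l * cayley_coef j * qcoef (int (a + l) - int j) * ?RR (k - j) l = 0"
      using that K[of "k - j"] by (cases "a + l < j") (auto simp: K'_def)
  qed
  then have "Qop (int a) (Qop (int a) f)
      = (\<Sum>k\<le>K'. (- 1) ^ k * qcoef (int a + int k) * skewing k (Qop (int a) f))"
    by (rule Qop_eq)
  also have "\<dots> = (\<Sum>k\<le>K'. \<Sum>j\<le>k. \<Sum>l\<le>K. (- 1) ^ (j + (k - j) + l) * cayley_coef j
      * (qcoef (int (a + (k - j) + j)) * qcoef (int (a + l) - int j)) * ?RR (k - j) l)"
    unfolding RQ sum_distrib_left
  proof (intro sum.cong[OF refl])
    fix k j l :: nat assume "j \<in> {..k}"
    then have "j + (k - j) + l = k + l" "a + (k - j) + j = a + k" by auto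
    then show "(- 1) ^ k * qcoef (int a + int k) * ((- 1) ^ l * cayley_coef j * qcoef (int (a + l) - int j) * ?RR (k - j) l)
        = (- 1) ^ (j + (k - j) + l) * cayley_coef j
          * (qcoef (int (a + (k - j) + j)) * qcoef (int (a + l) - int j)) * ?RR (k - j) l"
      by (simp only: power_add of_nat_add mult_ac)
  qed
  also have "\<dots> = (\<Sum>j\<le>K'. \<Sum>i\<le>K' - j. \<Sum>l\<le>K. (- 1) ^ (j + i + l) * cayley_coef j
      * (qcoef (int (a + i + j)) * qcoef (int (a + l) - int j)) * ?RR i l)"
    by (rule sum_triangle_antidiagonal[symmetric])
  also have "\<dots> = (\<Sum>i\<le>K'. \<Sum>j\<le>K' - i. \<Sum>l\<le>K. (- 1) ^ (j + i + l) * cayley_coef j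
      * (qcoef (int (a + i + j)) * qcoef (int (a + l) - int j)) * ?RR i l)"
    by (rule sum_triangle_swap)
  also have "\<dots> = (\<Sum>i\<le>K. \<Sum>j\<le>K' - i. \<Sum>l\<le>K. (- 1) ^ (j + i + l) * cayley_coef j
      * (qcoef (int (a + i + j)) * qcoef (int (a + l) - int j)) * ?RR i l)"
    by (rule sum.mono_neutral_right) (auto simp: K'_def K)
  also have "\<dots> = (\<Sum>i\<le>K. \<Sum>l\<le>K. \<Sum>j\<le>K' - i. (- 1) ^ (j + i + l) * cayley_coef j
      * (qcoef (int (a + i + j)) * qcoef (int (a + l) - int j)) * ?RR i l)"
    by (rule sum.cong[OF refl], rule sum.swap)
  \<comment> \<open>For i, l \<le> K the bound a + l is at most K' - i, and beyond it
    \<open>qcoef\<close> has negative index. The range now fits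
    \<open>qcoef_alternating_sum\<close>.\<close>
  also have "\<dots> = (\<Sum>i\<le>K. \<Sum>l\<le>K. \<Sum>j\<le>a + l. (- 1) ^ (j + i + l) * cayley_coef j
      * (qcoef (int (a + i + j)) * qcoef (int (a + l) - int j)) * ?RR i l)"
    by (intro sum.cong[OF refl] sum.mono_neutral_right) (auto simp: K'_def)
  also have "\<dots> = (\<Sum>i\<le>K. \<Sum>l\<le>K. (\<Sum>j\<le>a + l. (- 1) ^ j * cayley_coef j
      * (qcoef (int (a + i + j)) * qcoef (int (a + l) - int j))) * ((- 1) ^ (i + l) * ?RR i l))"
    unfolding sum_distrib_right by (intro sum.cong[OF refl]) (simp only: power_add mult_ac)
  finally have eq: "Qop (int a) (Qop (int a) f) = \<dots>" .
  define S where "S i l = (\<Sum>j\<le>a + l. (- 1) ^ j * cayley_coef j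
      * (qcoef (int (a + i + j)) * qcoef (int (a + l) - int j)))" for i l
  define W where "W i l = (- 1) ^ (i + l) * ?RR i l" for i l
  have QQ: "Qop (int a) (Qop (int a) f) = (\<Sum>i\<le>K. \<Sum>l\<le>K. S i l * W i l)"
    using eq by (simp only: S_def W_def)
  have "S l i = - S i l" for i l
    using qcoef_alternating_sum[OF assms, of l i] by (simp add: S_def eq_neg_iff_add_eq_0 add.commute)
  moreover have "W l i = W i l" for i l
    unfolding W_def by (subst skewing_commute) (simp add: add.commute)
  ultimately have anti: "S l i * W l i = - (S i l * W i l)" for i l
    by (metis mult_minus_left)
  have "(\<Sum>i\<le>K. \<Sum>l\<le>K. S l i * W l i) = (\<Sum>i\<le>K. \<Sum>l\<le>K. - (S i l * W i l))"
    by (intro sum.cong refl anti)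
  then have "(\<Sum>i\<le>K. \<Sum>l\<le>K. S l i * W l i) = - (\<Sum>i\<le>K. \<Sum>l\<le>K. S i l * W i l)"
    by (simp only: sum_negf)
  moreover have "(\<Sum>i\<le>K. \<Sum>l\<le>K. S l i * W l i) = (\<Sum>i\<le>K. \<Sum>l\<le>K. S i l * W i l)"
    by (rule sum.swap)
  ultimately have "of_nat 2 * Qop (int a) (Qop (int a) f) = of_nat 2 * 0"
    unfolding QQ by (simp add: eq_neg_iff_add_eq_0)
  then show ?thesis by (rule of_nat_cancel_Gam) simp
qed

lemma form_g_series_mult:
  "form (g_series $ k * f) h
    = (\<Sum>i\<le>k. qq ^ i * (- 1) ^ (k - i) * form f (skewing (k - i) (skewing i h)))"
proof -
  have "g_series $ k * f
      = (\<Sum>i\<le>k. scal (qq ^ i * (- 1) ^ (k - i)) * (creation $ i * (creation $ (k - i) * f)))"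
    by (simp add: g_series_creation fps_mult_nth sum_distrib_right atMost_atLeast0 scal_mult mult_ac sum_distrib_left)
  then show ?thesis
    by (simp add: form_sum_left form_scal_left form_creation_mult)
qed

section \<open>Shifted diagrams\<close>

text \<open>The number of squares of the shifted diagram on the diagonal \<open>j - i = d\<close>.\<close>

definition above :: "nat list \<Rightarrow> nat \<Rightarrow> nat" where
  "above lam d = length (filter (\<lambda>x. d < x) lam)"

lemma above_Nil [simp]: "above [] d = 0"
  by (simp add: above_def)

lemma above_Cons: "above (x # xs) d = (if d < x then 1 else 0) + above xs d"
  by (simp add: above_def)

lemma above_append: "above (xs @ ys) d = above xs d + above ys d"
  by (simp add: above_def)

lemma above_eq_0: "(\<And>x. x \<in> set lam \<Longrightarrow> x \<le> d) \<Longrightarrow> above lam d = 0"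
  by (auto simp: above_def filter_empty_conv leD)

lemma above_eq_0_iff: "above lam d = 0 \<longleftrightarrow> (\<forall>x\<in>set lam. x \<le> d)"
  by (auto simp: above_def filter_empty_conv)

lemma strict_partition_distinct: "strict_partition lam \<Longrightarrow> distinct lam"
  unfolding strict_partition_def by (induction lam) auto

lemma above_card: "strict_partition lam \<Longrightarrow> above lam d = card {x \<in> set lam. d < x}"
  unfolding above_def by (metis distinct_card distinct_filter set_filter strict_partition_distinct)

lemma above_0: "strict_partition lam \<Longrightarrow> above lam 0 = length lam"
  by (auto simp: above_def strict_partition_def intro!: arg_cong[where f = length] filter_True) (metis gr0I)

text \<open>The count changes by at most one from a diagonal to the next; the local descriptions of
  strips and components rest on this.\<close>

lemma above_Suc:
  assumes "strict_partition lam"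
  shows "above lam d = above lam (Suc d) + (if Suc d \<in> set lam then 1 else 0)"
proof -
  have "{x \<in> set lam. d < x} = {x \<in> set lam. Suc d < x} \<union> (if Suc d \<in> set lam then {Suc d} else {})"
    by (auto, metis Suc_lessI)
  then show ?thesis
    unfolding above_card[OF assms] by (auto simp: card_insert_if)
qed

lemma above_antimono: "d \<le> e \<Longrightarrow> above lam e \<le> above lam d"
  unfolding above_def by (induction lam) auto

lemma less_above_iff:
  assumes "sorted_wrt (>) lam"
  shows "k < above lam d \<longleftrightarrow> k < length lam \<and> d < lam ! k"
  using assms
proof (induction lam arbitrary: k)
  case (Cons x xs)
  show ?case
  proof (cases "d < x")
    case True
    then show ?thesis using Cons by (cases k) (auto simp: above_Cons)
  next
    case False
    then have "above (x # xs) d = 0" using Cons.prems by (intro above_eq_0) force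
    moreover have "\<not> d < (x # xs) ! k" if "k < length (x # xs)"
      using nth_mem[OF that] Cons.prems False by fastforce
    ultimately show ?thesis by auto
  qed
qed simp

lemma sum_list_above:
  assumes "\<forall>x\<in>set lam. x \<le> N"
  shows "sum_list lam = (\<Sum>d\<le>N. above lam d)"
  using assms
proof (induction lam)
  case (Cons x xs)
  have "(\<Sum>d\<le>N. if d < x then 1 else 0) = card {d. d \<le> N \<and> d < x}"
    by (simp add: sum.If_cases Int_def)
  also have "{d. d \<le> N \<and> d < x} = {..<x}" using Cons.prems by auto
  finally show ?case using Cons by (simp add: above_Cons sum.distrib)
qed simp

section \<open>Diagrams, containment and strips in terms of diagonal counts\<close>

lemma shifted_diagram_iff:
  assumes "strict_partition lam"
  shows "(i, j) \<in> shifted_diagram lam \<longleftrightarrow> 1 \<le> i \<and> i \<le> j \<and> i \<le> above lam (j - i)"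
proof (cases "1 \<le> i \<and> i \<le> length lam \<and> i \<le> j")
  case True
  then have "lam ! (i - 1) \<in> set lam" by (intro nth_mem) auto
  then have "lam ! (i - 1) \<noteq> 0" using assms by (metis strict_partition_def)
  then show ?thesis
    using True less_above_iff[of lam "i - 1" "j - i"] assms
    by (auto simp: shifted_diagram_def strict_partition_def)
next
  case False
  have "above lam (j - i) \<le> length lam" by (simp add: above_def)
  then show ?thesis using False by (auto simp: shifted_diagram_def)
qed

lemma contained_iff:
  assumes "strict_partition mu" "strict_partition lam"
  shows "contained mu lam \<longleftrightarrow> (\<forall>d. above mu d \<le> above lam d)"
proof
  assume c: "contained mu lam"
  show "\<forall>d. above mu d \<le> above lam d"
  proof
    fix d
    show "above mu d \<le> above lam d"
    proof (cases "above mu d = 0")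
      case False
      then have "(above mu d, above mu d + d) \<in> shifted_diagram mu"
        by (simp add: shifted_diagram_iff[OF assms(1)])
      then have "(above mu d, above mu d + d) \<in> shifted_diagram lam"
        using c by (auto simp: contained_def)
      then show ?thesis by (simp add: shifted_diagram_iff[OF assms(2)])
    qed simp
  qed
next
  assume "\<forall>d. above mu d \<le> above lam d"
  then show "contained mu lam"
    unfolding contained_def by (auto simp: shifted_diagram_iff assms) (metis order_trans)
qed

lemma skew_iff:
  assumes "strict_partition mu" "strict_partition lam"
  shows "(i, j) \<in> skew lam mu \<longleftrightarrow> 1 \<le> i \<and> i \<le> j \<and> above mu (j - i) < i \<and> i \<le> above lam (j - i)"
  by (auto simp: skew_def shifted_diagram_iff assms)

definition strip :: "nat list \<Rightarrow> nat list \<Rightarrow> bool" where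
  "strip lam nu \<longleftrightarrow> (\<forall>d. above nu d \<le> above lam d \<and> above lam d \<le> Suc (above nu d))"

lemma on_diagonal_skew:
  assumes "strict_partition mu" "strict_partition lam"
  shows "on_diagonal d (skew lam mu)
    = (if d < 0 then {} else (\<lambda>i. (i, i + nat d)) ` {above mu (nat d)<..above lam (nat d)})"
proof (cases "d < 0")
  case False
  show ?thesis
  proof (intro equalityI subsetI)
    fix s assume s: "s \<in> on_diagonal d (skew lam mu)"
    obtain i j where ij: "s = (i, j)" by (cases s)
    have "(i, j) \<in> skew lam mu" "int j - int i = d" using s ij by (auto simp: on_diagonal_def)
    then have "j = i + nat d" using False by simp
    then show "s \<in> (if d < 0 then {} else (\<lambda>i. (i, i + nat d)) ` {above mu (nat d)<..above lam (nat d)})"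
      using \<open>(i, j) \<in> skew lam mu\<close> ij False by (auto simp: skew_iff[OF assms])
  qed (use False in \<open>auto simp: on_diagonal_def skew_iff[OF assms]\<close>)
qed (auto simp: on_diagonal_def skew_iff[OF assms])

lemma card_on_diagonal_skew:
  assumes "strict_partition mu" "strict_partition lam"
  shows "card (on_diagonal d (skew lam mu)) = (if d < 0 then 0 else above lam (nat d) - above mu (nat d))"
  by (auto simp: on_diagonal_skew[OF assms] card_image inj_on_def)

text \<open>A 2 by 2 block has two squares on one diagonal. Conversely, two skew squares on a
  diagonal d > 0 may be taken in consecutive rows; the other corners of their block lie on the
  diagonals d - 1 and d + 1, where the counts differ by at most one, so they are skew squares too.
  The case d = 0 is the separate condition on the main diagonal.\<close>

lemma generalized_strip_iff:
  assumes nu: "strict_partition nu" and lam: "strict_partition lam"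
  shows "contained nu lam \<and> generalized_strip (skew lam nu) \<longleftrightarrow> strip lam nu"
proof
  assume "contained nu lam \<and> generalized_strip (skew lam nu)"
  then have strip: "generalized_strip (skew lam nu)" and "contained nu lam" by auto
  then have le: "above nu d \<le> above lam d" for d using contained_iff[OF nu lam] by auto
  have "above lam d \<le> Suc (above nu d)" for d
  proof (rule ccontr)
    assume "\<not> ?thesis"
    then have big: "above nu d + 2 \<le> above lam d" by simp
    show False
    proof (cases d)
      case 0
      have "{s \<in> skew lam nu. fst s = snd s} = on_diagonal 0 (skew lam nu)"
        by (auto simp: on_diagonal_def)
      moreover have "card {s \<in> skew lam nu. fst s = snd s} \<le> 1" using strip by (simp add: generalized_strip_def)
      ultimately have "above lam 0 - above nu 0 \<le> 1"
        using card_on_diagonal_skew[OF nu lam, of 0] by simp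
      then show False using big 0 by simp
    next
      case (Suc d')
      \<comment> \<open>The row of the first square of diagonal d outside \<open>nu\<close>.\<close>
      define r where "r = Suc (above nu d)"
      have "above lam d \<le> Suc (above lam (Suc d))" "above nu (Suc d) \<le> above nu d"
          "above nu d' \<le> Suc (above nu d)" "above lam d \<le> above lam d'"
        using above_Suc[OF lam, of d] above_Suc[OF nu, of d] above_Suc[OF nu, of d'] above_Suc[OF lam, of d'] Suc
        by auto
      then have "{(r, r + d), (r, r + d + 1), (r + 1, r + d), (r + 1, r + d + 1)} \<subseteq> skew lam nu"
        using big Suc by (auto simp: skew_iff[OF nu lam] r_def)
      then show False using strip by (auto simp: generalized_strip_def)
    qed
  qed
  then show "strip lam nu" using le by (simp add: strip_def)
next
  assume s: "strip lam nu"
  then have c: "contained nu lam" by (simp add: contained_iff[OF nu lam] strip_def)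
  have "generalized_strip (skew lam nu)"
    unfolding generalized_strip_def
  proof
    show "\<nexists>i j. {(i, j), (i, j + 1), (i + 1, j), (i + 1, j + 1)} \<subseteq> skew lam nu"
    proof clarify
      fix i j assume "{(i, j), (i, j + 1), (i + 1, j), (i + 1, j + 1)} \<subseteq> skew lam nu"
      then have "above nu (j - i) < i" "i + 1 \<le> above lam (j - i)"
        by (auto simp: skew_iff[OF nu lam])
      then show False using s by (metis Suc_eq_plus1 Suc_leI Suc_n_not_le_n order_trans Suc_le_mono strip_def)
    qed
    have "{s \<in> skew lam nu. fst s = snd s} = on_diagonal 0 (skew lam nu)"
      by (auto simp: on_diagonal_def)
    then show "card {s \<in> skew lam nu. fst s = snd s} \<le> 1"
      using s card_on_diagonal_skew[OF nu lam, of 0] by (auto simp: strip_def intro: le_diff_conv[THEN iffD2])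
  qed
  then show "contained nu lam \<and> generalized_strip (skew lam nu)" using c by simp
qed

lemma generalized_double_strip_iff:
  assumes "strict_partition lam" "strict_partition mu"
  shows "generalized_double_strip lam mu \<longleftrightarrow> (\<exists>nu. strict_partition nu \<and> strip lam nu \<and> strip nu mu)"
  unfolding generalized_double_strip_def using generalized_strip_iff assms by metis

section \<open>Connected components as maximal intervals of diagonals\<close>

definition run :: "nat set \<Rightarrow> nat \<Rightarrow> nat set" where
  "run U a = {d. a \<le> d \<and> {a..d} \<subseteq> U}"

definition bottoms :: "nat set \<Rightarrow> nat set" where
  "bottoms U = {a \<in> U. a = 0 \<or> a - 1 \<notin> U}"

text \<open>Adjacency of exactly the consecutive indices makes the cells a disjoint union of paths.
  Each component is named by the least index in it, and injectivity serves to reindex products over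
  components.\<close>

lemma components_path:
  fixes cell :: "nat \<Rightarrow> square"
  assumes inj: "inj_on cell U"
    and adj: "\<And>d e. d \<in> U \<Longrightarrow> e \<in> U \<Longrightarrow> adjacent (cell d) (cell e) \<longleftrightarrow> e = Suc d \<or> d = Suc e"
  shows "components (cell ` U) = (\<lambda>a. cell ` run U a) ` bottoms U"
    and "inj_on (\<lambda>a. cell ` run U a) (bottoms U)"
proof -
  define r where "r = {(s, s'). s \<in> cell ` U \<and> s' \<in> cell ` U \<and> adjacent s s'}"
  define R where "R = {(a, b). a \<in> cell ` U \<and> b \<in> cell ` U \<and> (a, b) \<in> r\<^sup>*}"
  have up: "(cell d, cell e) \<in> r\<^sup>* \<and> (cell e, cell d) \<in> r\<^sup>*" if "d \<le> e" "{d..e} \<subseteq> U" for d e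
    using that
  proof (induction e rule: dec_induct)
    case (step e)
    have eU: "e \<in> U" "Suc e \<in> U" using step by auto
    have IH: "(cell d, cell e) \<in> r\<^sup>* \<and> (cell e, cell d) \<in> r\<^sup>*" using step by (auto intro!: step.IH)
    have "(cell e, cell (Suc e)) \<in> r" "(cell (Suc e), cell e) \<in> r"
      using eU adj by (auto simp: r_def)
    then show ?case using IH by (meson rtrancl.rtrancl_into_rtrancl converse_rtrancl_into_rtrancl)
  qed simp
  have conn: "\<exists>e\<in>U. s = cell e \<and> {min d e..max d e} \<subseteq> U" if "d \<in> U" "(cell d, s) \<in> r\<^sup>*" for d s
    using that(2)
  proof (induction rule: rtrancl_induct)
    case base
    then show ?case using that(1) by (intro bexI[of _ d]) auto
  next
    case (step y z)
    then obtain e where e: "e \<in> U" "y = cell e" "{min d e..max d e} \<subseteq> U" by auto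
    obtain f where f: "f \<in> U" "z = cell f" "adjacent (cell e) (cell f)"
      using step(2) e by (auto simp: r_def)
    then have ef: "f = Suc e \<or> e = Suc f" using adj e by auto
    have "{min d f..max d f} \<subseteq> insert f {min d e..max d e}" using ef by (auto simp: min_def max_def split: if_splits)
    then show ?case using f e by blast
  qed
  have bottom: "\<exists>a\<in>bottoms U. d \<in> run U a" if "d \<in> U" for d
    using that
  proof (induction d)
    case (Suc d)
    show ?case
    proof (cases "d \<in> U")
      case True
      then obtain a where "a \<in> bottoms U" "d \<in> run U a" using Suc.IH by auto
      then have "Suc d \<in> run U a" using Suc.prems by (auto simp: run_def le_Suc_eq)
      then show ?thesis using \<open>a \<in> bottoms U\<close> by auto
    qed (use Suc.prems in \<open>auto simp: bottoms_def run_def\<close>)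
  qed (auto simp: bottoms_def run_def)
  have runU: "run U a \<subseteq> U" for a by (auto simp: run_def)
  have cls: "R `` {cell d} = cell ` run U a" if "a \<in> bottoms U" "d \<in> run U a" for a d
  proof (intro equalityI subsetI)
    fix s assume "s \<in> R `` {cell d}"
    then have "(cell d, s) \<in> r\<^sup>*" by (simp add: R_def)
    moreover have "d \<in> U" using that runU by blast
    ultimately obtain e where e: "e \<in> U" "s = cell e" "{min d e..max d e} \<subseteq> U"
      using conn by blast
    have "a \<le> e"
    proof (rule ccontr)
      assume "\<not> a \<le> e"
      then have "a - 1 \<in> {min d e..max d e}" "a \<noteq> 0" using that by (auto simp: run_def)
      then show False using e that by (auto simp: bottoms_def)
    qed
    moreover have "{a..e} \<subseteq> {a..d} \<union> {min d e..max d e}" by auto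
    moreover have "{a..d} \<subseteq> U" using that(2) by (simp add: run_def)
    ultimately have "e \<in> run U a" using e(3) unfolding run_def by blast
    then show "s \<in> cell ` run U a" using e by auto
  next
    fix s assume "s \<in> cell ` run U a"
    then obtain e where e: "e \<in> run U a" "s = cell e" by auto
    have "(cell d, cell a) \<in> r\<^sup>*" "(cell a, cell e) \<in> r\<^sup>*"
      using up[of a d] up[of a e] that e by (auto simp: run_def)
    then have "(cell d, s) \<in> r\<^sup>*" using e(2) by (metis rtrancl_trans)
    moreover have "d \<in> U" "e \<in> U" using e(1) that(2) runU by blast+
    ultimately show "s \<in> R `` {cell d}" using e(2) by (simp add: R_def)
  qed
  have "components (cell ` U) = (cell ` U) // R"
    by (simp add: components_def R_def r_def)
  also have "\<dots> = (\<lambda>a. cell ` run U a) ` bottoms U"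
  proof (intro equalityI subsetI)
    fix C assume "C \<in> (cell ` U) // R"
    then obtain d where d: "d \<in> U" "C = R `` {cell d}" by (auto simp: quotient_def)
    obtain a where "a \<in> bottoms U" "d \<in> run U a" using bottom[OF d(1)] by blast
    then show "C \<in> (\<lambda>a. cell ` run U a) ` bottoms U" using cls d(2) by (intro image_eqI) simp_all
  next
    fix C assume "C \<in> (\<lambda>a. cell ` run U a) ` bottoms U"
    then obtain a where a: "a \<in> bottoms U" "C = cell ` run U a" by auto
    then have "a \<in> run U a" by (auto simp: bottoms_def run_def)
    then have "C = R `` {cell a}" "a \<in> U" using cls[OF a(1)] a(2) runU by auto
    then show "C \<in> (cell ` U) // R" by (auto intro: quotientI)
  qed
  finally show "components (cell ` U) = (\<lambda>a. cell ` run U a) ` bottoms U" .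
  show "inj_on (\<lambda>a. cell ` run U a) (bottoms U)"
  proof (rule inj_onI)
    fix a b assume ab: "a \<in> bottoms U" "b \<in> bottoms U" "cell ` run U a = cell ` run U b"
    then have "run U a = run U b" using inj_on_image_eq_iff[OF inj runU runU] by simp
    moreover have "a \<in> run U a" "b \<in> run U b" using ab by (auto simp: bottoms_def run_def)
    ultimately have "a \<in> run U b" "b \<in> run U a" by auto
    then show "a = b" by (auto simp: run_def)
  qed
qed

definition ones :: "nat list \<Rightarrow> nat list \<Rightarrow> nat set" where
  "ones lam mu = {d. above lam d = Suc (above mu d)}"

text \<open>The last square of \<open>lam\<close> on the diagonal, hence the skew square if the
  diagonal carries just one.\<close>

definition cell :: "nat list \<Rightarrow> nat \<Rightarrow> square" where
  "cell lam d = (above lam d, above lam d + d)"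

text \<open>Rows are listed from top to bottom, hence by decreasing diagonal: the lowest diagonals
  of a run form the last row.\<close>

definition run_rows :: "nat list \<Rightarrow> nat set \<Rightarrow> nat list" where
  "run_rows lam A = map (\<lambda>i. card {d \<in> A. above lam d = i}) (sorted_list_of_set (above lam ` A))"

lemma row_lengths_cells: "row_lengths (cell lam ` A) = run_rows lam A"
proof -
  have "card {j. (i, j) \<in> cell lam ` A} = card {d \<in> A. above lam d = i}" for i
  proof -
    have "{j. (i, j) \<in> cell lam ` A} = (\<lambda>d. i + d) ` {d \<in> A. above lam d = i}"
      by (auto simp: cell_def)
    then show ?thesis by (simp add: card_image)
  qed
  moreover have "fst ` cell lam ` A = above lam ` A" by (auto simp: cell_def image_image)
  ultimately show ?thesis by (simp add: row_lengths_def run_rows_def)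
qed

lemma beta_eq:
  assumes mu: "strict_partition mu" and lam: "strict_partition lam"
  shows "beta lam mu = cell lam ` ones lam mu"
proof (intro equalityI subsetI)
  fix s assume "s \<in> beta lam mu"
  then obtain d where d: "card (on_diagonal d (skew lam mu)) = 1" "s \<in> on_diagonal d (skew lam mu)"
    by (auto simp: beta_def)
  then have "\<not> d < 0" "above lam (nat d) = Suc (above mu (nat d))"
    by (auto simp: card_on_diagonal_skew[OF mu lam] split: if_splits)
  then show "s \<in> cell lam ` ones lam mu"
    using d(2) by (intro image_eqI[of _ _ "nat d"]) (auto simp: on_diagonal_skew[OF mu lam] cell_def ones_def)
next
  fix s assume "s \<in> cell lam ` ones lam mu"
  then obtain d where "above lam d = Suc (above mu d)" "s = cell lam d" by (auto simp: ones_def)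
  then show "s \<in> beta lam mu"
    unfolding beta_def
    by (intro UN_I[of "int d"])
       (simp add: card_on_diagonal_skew[OF mu lam], auto simp: on_diagonal_skew[OF mu lam] cell_def)
qed

lemma c_strip_eq:
  assumes "strict_partition mu" "strict_partition lam"
  shows "c_strip lam mu = card {d. above lam d = above mu d + 2}"
proof -
  have "{d. card (on_diagonal d (skew lam mu)) = 2} = int ` {d. above lam d = above mu d + 2}"
  proof (intro equalityI subsetI)
    fix d assume "d \<in> {d. card (on_diagonal d (skew lam mu)) = 2}"
    then show "d \<in> int ` {d. above lam d = above mu d + 2}"
      by (intro image_eqI[of _ _ "nat d"]) (auto simp: card_on_diagonal_skew[OF assms] split: if_splits)
  qed (auto simp: card_on_diagonal_skew[OF assms])
  then show ?thesis by (simp add: c_strip_def card_image)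
qed

text \<open>From diagonal d to d + 1 the last square of \<open>lam\<close> moves either one step to
  the right or one step up. So the squares on consecutive diagonals always share an edge, others
  never do, and \<open>components_path\<close> applies.\<close>

lemma prod_components:
  assumes mu: "strict_partition mu" and lam: "strict_partition lam"
  shows "(\<Prod>xi\<in>components (beta lam mu). w (row_lengths xi))
    = (\<Prod>a\<in>bottoms (ones lam mu). w (run_rows lam (run (ones lam mu) a)))"
proof -
  have step: "above lam d = above lam (Suc d) \<or> above lam d = Suc (above lam (Suc d))" for d
    using above_Suc[OF lam, of d] by auto
  have unit: "\<bar>x\<bar> + \<bar>x + y\<bar> = 1 \<Longrightarrow> y = 1 \<or> y = - 1" for x y :: int
    by arith
  have adj: "adjacent (cell lam d) (cell lam e) \<longleftrightarrow> e = Suc d \<or> d = Suc e" for d e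
  proof
    assume "adjacent (cell lam d) (cell lam e)"
    then show "e = Suc d \<or> d = Suc e" using unit[of "int (above lam d) - int (above lam e)" "int d - int e"]
      unfolding adjacent_def cell_def by (simp add: algebra_simps) linarith
  next
    assume "e = Suc d \<or> d = Suc e"
    then show "adjacent (cell lam d) (cell lam e)"
      using step[of d] step[of e] unfolding adjacent_def cell_def by auto
  qed
  have inj: "inj_on (cell lam) (ones lam mu)" by (auto simp: inj_on_def cell_def)
  show ?thesis
    unfolding beta_eq[OF mu lam] components_path[OF inj adj]
    by (subst prod.reindex[OF components_path(2)[OF inj adj]]) (simp add: row_lengths_cells)
qed

section \<open>Row lengths of a run extended at its lower end\<close>

lemma sorted_list_of_set_insert_max:
  assumes "finite A" "\<And>x. x \<in> A \<Longrightarrow> x < (M::nat)"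
  shows "sorted_list_of_set (insert M A) = sorted_list_of_set A @ [M]"
proof -
  have "M \<notin> A" using assms(2) by blast
  then have "sorted_wrt (<) (sorted_list_of_set A @ [M]) \<and> set (sorted_list_of_set A @ [M]) = insert M A
      \<and> length (sorted_list_of_set A @ [M]) = card (insert M A)"
    using assms by (auto simp: sorted_wrt_append)
  then show ?thesis using assms(1) by (metis sorted_list_of_set_unique finite_insert)
qed

lemma run_rows_singleton: "run_rows lam {a} = [1]"
proof -
  have "{d \<in> {a}. above lam d = above lam a} = {a}" by auto
  then show ?thesis unfolding run_rows_def by (simp del: Collect_conv_if Collect_conv_if2 singleton_iff)
qed

lemma run_rows_new_row:
  assumes "finite A" "\<And>d. d \<in> A \<Longrightarrow> above lam d < above lam a"
  shows "run_rows lam (insert a A) = run_rows lam A @ [1]"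
proof -
  have "sorted_list_of_set (above lam ` insert a A) = sorted_list_of_set (above lam ` A) @ [above lam a]"
    unfolding image_insert using assms by (intro sorted_list_of_set_insert_max) auto
  moreover have "map (\<lambda>i. card {d \<in> insert a A. above lam d = i}) (sorted_list_of_set (above lam ` A))
      = map (\<lambda>i. card {d \<in> A. above lam d = i}) (sorted_list_of_set (above lam ` A))"
  proof (rule map_cong[OF refl])
    fix i assume "i \<in> set (sorted_list_of_set (above lam ` A))"
    then have "i \<noteq> above lam a" using assms by fastforce
    then have "{d \<in> insert a A. above lam d = i} = {d \<in> A. above lam d = i}" by auto
    then show "card {d \<in> insert a A. above lam d = i} = card {d \<in> A. above lam d = i}" by simp
  qed
  moreover have "card {d \<in> insert a A. above lam d = above lam a} = 1"
  proof -
    have "{d \<in> insert a A. above lam d = above lam a} = {a}" using assms(2) by fastforce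
    then show ?thesis by simp
  qed
  ultimately show ?thesis unfolding run_rows_def by (simp only: map_append list.map)
qed

lemma run_rows_same_row:
  assumes "finite A" "b \<in> A" "a \<notin> A" "above lam b = above lam a"
    and "\<And>d. d \<in> A \<Longrightarrow> above lam d \<le> above lam a"
  shows "\<exists>rho k. run_rows lam A = rho @ [k] \<and> run_rows lam (insert a A) = rho @ [Suc k]"
proof -
  define M where "M = above lam a"
  define B where "B = above lam ` A - {M}"
  have im: "above lam ` A = insert M B" "above lam ` insert a A = insert M B"
    using assms(2,4) by (auto simp: M_def B_def) (metis image_eqI)
  have fB: "finite B" using assms by (simp add: B_def)
  have sl: "sorted_list_of_set (insert M B) = sorted_list_of_set B @ [M]"
    using assms by (intro sorted_list_of_set_insert_max) (auto simp: B_def M_def le_less)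
  have "{d \<in> insert a A. above lam d = i} = {d \<in> A. above lam d = i}" if "i \<in> B" for i
    using that by (auto simp: B_def M_def)
  moreover have "{d \<in> insert a A. above lam d = M} = insert a {d \<in> A. above lam d = M}"
    by (auto simp: M_def)
  ultimately show ?thesis
    using assms(1,3) fB unfolding run_rows_def im sl by auto
qed

lemma run_rows_pos:
  assumes "finite A"
  shows "0 \<notin> set (run_rows lam A)"
  using assms by (auto simp: run_rows_def card_eq_0_iff)

section \<open>Weights of double strips\<close>

definition comp_sum :: "'a::field \<Rightarrow> nat list \<Rightarrow> 'a" where
  "comp_sum t rho = (\<Sum>tau | refines rho tau. (- 1) ^ (length rho - length tau) * f_comp t tau)"

lemma refines_Nil: "refines [] tau \<longleftrightarrow> tau = []"
proof
  assume "refines [] tau"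
  then obtain bs where "\<forall>b\<in>set bs. b \<noteq> []" "concat bs = []" "map sum_list bs = tau"
    by (auto simp: refines_def)
  then show "tau = []" by (cases bs) auto
qed (auto simp: refines_def)

lemma refines_singleton: "refines [a] tau \<longleftrightarrow> tau = [a]"
proof
  assume "refines [a] tau"
  then obtain bs where bs: "\<forall>b\<in>set bs. b \<noteq> []" "concat bs = [a]" "map sum_list bs = tau"
    by (auto simp: refines_def)
  then obtain b bs' where b: "bs = b # bs'" by (cases bs) auto
  then have "b = [a]" "concat bs' = []" using bs by (auto simp: append_eq_Cons_conv)
  then show "tau = [a]" using bs b refines_Nil[of "map sum_list bs'"] by (auto simp: refines_def)
next
  assume "tau = [a]"
  then show "refines [a] tau" unfolding refines_def by (intro exI[of _ "[[a]]"]) simp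
qed

lemma refines_Cons_Cons:
  "{tau. refines (a # b # rho) tau}
    = (\<lambda>tau. a # tau) ` {tau. refines (b # rho) tau} \<union> {tau. refines ((a + b) # rho) tau}"
proof (intro equalityI subsetI)
  fix tau assume "tau \<in> {tau. refines (a # b # rho) tau}"
  then obtain bs where bs: "\<forall>b\<in>set bs. b \<noteq> []" "concat bs = a # b # rho" "map sum_list bs = tau"
    by (auto simp: refines_def)
  then obtain xs bs' where b: "bs = xs # bs'" by (cases bs) auto
  then obtain ys where xs: "xs = a # ys" using bs by (cases xs) auto
  show "tau \<in> (\<lambda>tau. a # tau) ` {tau. refines (b # rho) tau} \<union> {tau. refines ((a + b) # rho) tau}"
  proof (cases ys)
    case Nil
    then have "refines (b # rho) (map sum_list bs')" using bs b xs by (auto simp: refines_def)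
    then show ?thesis using bs b xs Nil by auto
  next
    case (Cons y zs)
    then have "refines ((a + b) # rho) tau"
      unfolding refines_def using bs b xs by (intro exI[of _ "((a + b) # zs) # bs'"]) auto
    then show ?thesis by simp
  qed
next
  fix tau assume "tau \<in> (\<lambda>tau. a # tau) ` {tau. refines (b # rho) tau} \<union> {tau. refines ((a + b) # rho) tau}"
  then consider (1) tau' where "tau = a # tau'" "refines (b # rho) tau'" | (2) "refines ((a + b) # rho) tau" by auto
  then show "tau \<in> {tau. refines (a # b # rho) tau}"
  proof cases
    case 1
    then obtain bs where "\<forall>b\<in>set bs. b \<noteq> []" "concat bs = b # rho" "map sum_list bs = tau'"
      by (auto simp: refines_def)
    then show ?thesis unfolding refines_def using 1 by (auto intro!: exI[of _ "[a] # bs"])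
  next
    case 2
    then obtain bs where bs: "\<forall>b\<in>set bs. b \<noteq> []" "concat bs = (a + b) # rho" "map sum_list bs = tau"
      by (auto simp: refines_def)
    then obtain xs bs' where b: "bs = xs # bs'" by (cases bs) auto
    then obtain ys where xs: "xs = (a + b) # ys" using bs by (cases xs) auto
    show ?thesis unfolding refines_def using bs b xs by (auto intro!: exI[of _ "(a # b # ys) # bs'"])
  qed
qed

lemma finite_refines: "finite {tau. refines rho tau}"
proof (induction "length rho" arbitrary: rho rule: less_induct)
  case less
  consider "rho = []" | a where "rho = [a]" | a b r where "rho = a # b # r" by (metis neq_Nil_conv)
  then show ?case
  proof cases
    case 1
    then have "{tau. refines rho tau} = {[]}" by (auto simp: refines_Nil)
    then show ?thesis by simp
  next
    case (2 a)
    then have "{tau. refines rho tau} = {[a]}" by (auto simp: refines_singleton)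
    then show ?thesis by simp
  next
    case (3 a b r)
    then show ?thesis using less.hyps[of "b # r"] less.hyps[of "(a + b) # r"] by (simp add: refines_Cons_Cons)
  qed
qed

lemma refines_length: "refines rho tau \<Longrightarrow> length tau \<le> length rho"
proof (induction "length rho" arbitrary: rho tau rule: less_induct)
  case less
  consider "rho = []" | a where "rho = [a]" | a b r where "rho = a # b # r" by (metis neq_Nil_conv)
  then show ?case
  proof cases
    case (3 a b r)
    then have "tau \<in> (\<lambda>tau. a # tau) ` {tau. refines (b # r) tau} \<union> {tau. refines ((a + b) # r) tau}"
      using less.prems refines_Cons_Cons[of a b r] by blast
    then show ?thesis
      using less.hyps[of "b # r"] less.hyps[of "(a + b) # r" tau] 3 by auto
  qed (use less.prems in \<open>auto simp: refines_Nil refines_singleton\<close>)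
qed

lemma refines_hd_ge: "refines (c # rho) (x # tau) \<Longrightarrow> c \<le> x"
proof -
  assume "refines (c # rho) (x # tau)"
  then obtain bs where bs: "\<forall>b\<in>set bs. b \<noteq> []" "concat bs = c # rho" "map sum_list bs = x # tau"
    unfolding refines_def by (elim exE conjE) (rule that)
  then obtain xs bs' where b: "bs = xs # bs'" by (cases bs) auto
  then obtain ys where xs: "xs = c # ys" using bs by (cases xs) auto
  show "c \<le> x" using bs b xs by auto
qed

lemma comp_sum_singleton: "comp_sum t [a] = f_num t a"
  by (simp add: comp_sum_def refines_singleton f_comp_def)

text \<open>A coarsening either keeps the first part or merges it with its neighbour, and the merger
  costs one part and hence a sign. With b > 0 the heads separate the two cases: a against at least a
  + b.\<close>

lemma comp_sum_Cons_Cons: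
  assumes "b > 0"
  shows "comp_sum t (a # b # rho) = f_num t a * comp_sum t (b # rho) - comp_sum t ((a + b) # rho)"
proof -
  let ?A = "(\<lambda>tau. a # tau) ` {tau. refines (b # rho) tau}"
  let ?B = "{tau. refines ((a + b) # rho) tau}"
  let ?g = "\<lambda>tau. (- 1) ^ (length (a # b # rho) - length tau) * f_comp t tau"
  have disj: "?A \<inter> ?B = {}" using refines_hd_ge assms by fastforce
  have "comp_sum t (a # b # rho) = sum ?g ?A + sum ?g ?B"
    unfolding comp_sum_def refines_Cons_Cons
    by (rule sum.union_disjoint) (auto simp: finite_refines disj)
  also have "sum ?g ?A = f_num t a * comp_sum t (b # rho)"
    unfolding comp_sum_def sum_distrib_left
    by (subst sum.reindex) (auto simp: f_comp_def mult.left_commute)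
  also have "sum ?g ?B = - comp_sum t ((a + b) # rho)"
    unfolding comp_sum_def sum_negf[symmetric]
  proof (rule sum.cong[OF refl])
    fix tau assume "tau \<in> ?B"
    then have "length tau \<le> length ((a + b) # rho)" using refines_length by blast
    then have "length (a # b # rho) - length tau = Suc (length ((a + b) # rho) - length tau)" by simp
    then show "?g tau = - ((- 1) ^ (length ((a + b) # rho) - length tau) * f_comp t tau)"
      by (simp del: list.size)
  qed
  finally show ?thesis by simp
qed

text \<open>Mirror image of the recursion at the head, by induction through it. The scan of the
  diagonals extends the row list at its end.\<close>

lemma comp_sum_snoc:
  assumes "a > 0" "b > 0" "0 \<notin> set rho"
  shows "comp_sum t (rho @ [a, b]) = comp_sum t (rho @ [a]) * f_num t b - comp_sum t (rho @ [a + b])"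
  using assms
proof (induction "length rho" arbitrary: rho rule: less_induct)
  case less
  consider "rho = []" | c where "rho = [c]" | c e r where "rho = c # e # r" by (metis neq_Nil_conv)
  then show ?case
  proof cases
    case 1
    then show ?thesis using assms by (simp add: comp_sum_Cons_Cons comp_sum_singleton)
  next
    case (2 c)
    then show ?thesis using assms by (simp add: comp_sum_Cons_Cons comp_sum_singleton algebra_simps)
  next
    case (3 c e r)
    then have IH: "comp_sum t ((e # r) @ [a, b]) = comp_sum t ((e # r) @ [a]) * f_num t b - comp_sum t ((e # r) @ [a + b])"
        "comp_sum t (((c + e) # r) @ [a, b])
          = comp_sum t (((c + e) # r) @ [a]) * f_num t b - comp_sum t (((c + e) # r) @ [a + b])"
      by (intro less.hyps; use less.prems in simp)+
    have "e > 0" using less.prems 3 by simp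
    then show ?thesis
      using IH unfolding 3 append_Cons by (simp only: comp_sum_Cons_Cons) (simp only: algebra_simps)
  qed
qed

text \<open>A state holds the weights for the current single square lying in the inner strip (first)
  or in the outer strip (second). The left neighbour of an inner square is inner, hence the
  triangular shape; a change from outer to inner opens a component of the inner strip, hence the
  2.\<close>

definition same_row :: "'a::field \<Rightarrow> 'a \<times> 'a \<Rightarrow> 'a \<times> 'a" where
  "same_row t v = (- fst v - 2 * snd v, t * snd v)"

text \<open>The square below an outer one is outer; a change from inner to outer opens a component
  of the outer strip, hence the 2.\<close>

definition new_row :: "'a::field \<Rightarrow> 'a \<times> 'a \<Rightarrow> 'a \<times> 'a" where
  "new_row t v = (- fst v, t * snd v + 2 * t * fst v)"

text \<open>The bottom row comes first, as the scan reaches it last. A run starts with weight -1 for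
  an inner and t for an outer square; the value at the empty list is a default.\<close>

fun row_state :: "'a::field \<Rightarrow> nat list \<Rightarrow> 'a \<times> 'a" where
  "row_state t [] = (0, 0)"
| "row_state t [i] = (same_row t ^^ (i - 1)) (- 1, t)"
| "row_state t (i # j # r) = (same_row t ^^ (i - 1)) (new_row t (row_state t (j # r)))"

lemma row_state_Suc: "k > 0 \<Longrightarrow> row_state t (Suc k # r) = same_row t (row_state t (k # r))"
  by (cases k; cases r) auto

lemma row_state_add: "k > 0 \<Longrightarrow> row_state t ((k + n) # r) = (same_row t ^^ n) (row_state t (k # r))"
  by (induction n) (simp_all add: row_state_Suc)

text \<open>\<open>same_row\<close> is triangular with eigenvalues -1 and t, so its powers have a
  closed form with denominator t + 1. This is where f_i comes from.\<close>

lemma row_state_singleton: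
  assumes "t + 1 \<noteq> 0" "i > 0"
  shows "2 * (fst (row_state t [i]) + snd (row_state t [i])) = f_num t i"
proof -
  have "(same_row t ^^ n) (- 1, t) = (((t - 1) * (- 1) ^ n - 2 * t ^ Suc n) / (t + 1), t ^ Suc n)" for n
  proof (induction n)
    case 0
    then show ?case using assms by (simp add: field_simps)
  next
    case (Suc n)
    then show ?case using assms by (simp add: same_row_def field_simps)
  qed
  then show ?thesis using assms by (cases i) (simp_all add: f_num_def field_simps)
qed

lemma same_row_pow_linear:
  "(same_row t ^^ n) (c * fst v - fst w, c * snd v - snd w)
    = (c * fst ((same_row t ^^ n) v) - fst ((same_row t ^^ n) w),
       c * snd ((same_row t ^^ n) v) - snd ((same_row t ^^ n) w))"
  by (induction n) (simp_all add: same_row_def algebra_simps)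

text \<open>Vertical adjacency is a free start of a new row minus horizontal adjacency; iterating this
  turns the transfer recursion into the alternating sum over coarsenings.\<close>

lemma new_row_eq:
  fixes t :: "'a::field"
  shows "new_row t v = (2 * (fst v + snd v) * fst (- 1, t) - fst (same_row t v),
                  2 * (fst v + snd v) * snd (- 1 :: 'a, t) - snd (same_row t v))"
  by (simp add: new_row_def same_row_def algebra_simps)

text \<open>By \<open>new_row_eq\<close> the state after a new row of length b is the doubled total
  so far times the state of a fresh run of length b, minus the state with this row merged into the
  preceding one. \<open>same_row_pow_linear\<close> carries this along the row, and doubled totals
  then obey \<open>comp_sum_snoc\<close>.\<close>

lemma row_state_comp_sum:
  fixes t :: "'a::field"
  assumes t: "t + 1 \<noteq> 0" and "r \<noteq> []" "0 \<notin> set r"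
  shows "2 * (fst (row_state t r) + snd (row_state t r)) = comp_sum t (rev r)"
  using assms(2,3)
proof (induction "length r" arbitrary: r rule: less_induct)
  case less
  then consider b where "r = [b]" | b a s where "r = b # a # s" by (metis neq_Nil_conv)
  then show ?case
  proof cases
    case (1 b)
    then show ?thesis using less.prems row_state_singleton[OF t, of b] by (simp add: comp_sum_singleton)
  next
    case (2 b a s)
    then have pos: "a > 0" "b > 0" "0 \<notin> set (rev s)" using less.prems by auto
    define v where "v = row_state t (a # s)"
    have v: "2 * (fst v + snd v) = comp_sum t (rev s @ [a])"
      using less.hyps[of "a # s"] 2 less.prems by (simp add: v_def)
    have w: "2 * (fst ((same_row t ^^ b) v) + snd ((same_row t ^^ b) v)) = comp_sum t (rev s @ [a + b])"
      using less.hyps[of "(a + b) # s"] 2 less.prems pos by (simp add: v_def row_state_add)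
    have sr: "(same_row t ^^ (b - 1)) (same_row t v) = (same_row t ^^ b) v"
      using pos by (cases b) (simp_all add: funpow_swap1)
    have "row_state t r = (comp_sum t (rev s @ [a]) * fst (row_state t [b]) - fst ((same_row t ^^ b) v),
        comp_sum t (rev s @ [a]) * snd (row_state t [b]) - snd ((same_row t ^^ b) v))"
    proof -
      have nr: "new_row t v = (comp_sum t (rev s @ [a]) * fst (- 1, t) - fst (same_row t v),
          comp_sum t (rev s @ [a]) * snd (- 1 :: 'a, t) - snd (same_row t v))"
        by (subst new_row_eq) (simp only: v)
      have "row_state t r = (same_row t ^^ (b - 1)) (new_row t v)" using 2 by (simp add: v_def)
      also have "\<dots> = (same_row t ^^ (b - 1)) (comp_sum t (rev s @ [a]) * fst (- 1, t) - fst (same_row t v),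
          comp_sum t (rev s @ [a]) * snd (- 1 :: 'a, t) - snd (same_row t v))"
        by (rule arg_cong[OF nr])
      finally show ?thesis unfolding same_row_pow_linear sr row_state.simps .
    qed
    then have "2 * (fst (row_state t r) + snd (row_state t r))
        = comp_sum t (rev s @ [a]) * (2 * (fst (row_state t [b]) + snd (row_state t [b])))
          - 2 * (fst ((same_row t ^^ b) v) + snd ((same_row t ^^ b) v))"
      by (simp del: row_state.simps add: algebra_simps)
    then show ?thesis
      using 2 comp_sum_snoc[OF pos, of t] by (simp only: w row_state_singleton[OF t pos(2)]) simp
  qed
qed

section \<open>Summation over the intermediate partition, one diagonal at a time\<close>

definition strict_in :: "nat \<Rightarrow> nat \<Rightarrow> nat list set" where
  "strict_in d N = {nu. strict_partition nu \<and> set nu \<subseteq> {d<..N}}"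

lemma strict_partition_snoc: "strict_partition (nu @ [x]) \<longleftrightarrow> strict_partition nu \<and> x > 0 \<and> (\<forall>y\<in>set nu. x < y)"
  by (auto simp: strict_partition_def sorted_wrt_append)

lemma strict_in_self: "strict_in N N = {[]}"
  by (auto simp: strict_in_def strict_partition_def)

lemma strict_in_Suc:
  assumes "d < N"
  shows "strict_in d N = strict_in (Suc d) N \<union> (\<lambda>nu. nu @ [Suc d]) ` strict_in (Suc d) N"
proof (intro equalityI subsetI)
  fix nu assume nu: "nu \<in> strict_in d N"
  show "nu \<in> strict_in (Suc d) N \<union> (\<lambda>nu. nu @ [Suc d]) ` strict_in (Suc d) N"
  proof (cases "Suc d \<in> set nu")
    case False
    have "set nu \<subseteq> {Suc d<..N}"
    proof
      fix x assume x: "x \<in> set nu"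
      then have "d < x" "x \<le> N" "x \<noteq> Suc d" using nu False by (auto simp: strict_in_def)
      then show "x \<in> {Suc d<..N}" by simp
    qed
    then show ?thesis using nu by (auto simp: strict_in_def)
  next
    case True
    then obtain xs x where xs: "nu = xs @ [x]" by (metis append_butlast_last_id empty_iff empty_set)
    have s: "strict_partition xs" "\<forall>y\<in>set xs. x < y" "d < x"
      using nu xs by (auto simp: strict_in_def strict_partition_snoc)
    then have "x = Suc d" using True xs by force
    then have "xs \<in> strict_in (Suc d) N" using nu s xs by (auto simp: strict_in_def)
    then show ?thesis using xs \<open>x = Suc d\<close> by auto
  qed
qed (use assms in \<open>force simp: strict_in_def strict_partition_snoc\<close>)

lemma finite_strict_in: "finite (strict_in d N)"
proof (cases "d \<le> N")
  case True
  then show ?thesis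
    by (induction d rule: inc_induct) (simp_all add: strict_in_self strict_in_Suc)
next
  case False
  then have "strict_in d N \<subseteq> {[]}" by (auto simp: strict_in_def)
  then show ?thesis by (rule finite_subset) simp
qed

lemma sum_strict_in_Suc:
  assumes "d < N"
  shows "sum F (strict_in d N) = (\<Sum>nu\<in>strict_in (Suc d) N. F nu + F (nu @ [Suc d]))"
proof -
  have "strict_in (Suc d) N \<inter> (\<lambda>nu. nu @ [Suc d]) ` strict_in (Suc d) N = {}"
    by (auto simp: strict_in_def)
  then show ?thesis
    unfolding strict_in_Suc[OF assms]
    by (subst sum.union_disjoint) (auto simp: finite_strict_in sum.reindex inj_on_def sum.distrib)
qed

text \<open>The weight of a diagonal meeting the outer strip in \<open>a'\<close> and the inner strip in \<open>b'\<close> squares,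
  when the next diagonal meets them in \<open>a\<close> and \<open>b\<close> squares.\<close>

definition diag_weight :: "'a::field \<Rightarrow> int \<Rightarrow> int \<Rightarrow> int \<Rightarrow> int \<Rightarrow> 'a" where
  "diag_weight t a' b' a b =
     (if a' = 0 then 1 else if a' = 1 then t * (if a = 0 then 2 else 1) else 0)
     * (if b' = 0 then 1 else if b' = 1 then - (if b = 0 then 2 else 1) else 0)"

definition gap :: "nat list \<Rightarrow> nat list \<Rightarrow> nat \<Rightarrow> int" where
  "gap lam nu d = int (above lam d) - int (above nu d)"

definition chain_weight :: "'a::field \<Rightarrow> nat list \<Rightarrow> nat list \<Rightarrow> nat \<Rightarrow> nat list \<Rightarrow> 'a" where
  "chain_weight t lam mu d nu =
     diag_weight t (gap lam nu d) (gap nu mu d) (gap lam nu (Suc d)) (gap nu mu (Suc d))"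

text \<open>The parts exceeding d determine \<open>nu\<close> on all diagonals from d on, so the
  full sum is built up by lowering d. The state s is the number of squares of the outer strip on
  diagonal d.\<close>

definition transfer :: "'a::field \<Rightarrow> nat list \<Rightarrow> nat list \<Rightarrow> nat \<Rightarrow> nat \<Rightarrow> int \<Rightarrow> 'a" where
  "transfer t lam mu N d s = (\<Sum>nu\<in>strict_in d N.
     if gap lam nu d = s then \<Prod>e\<in>{d..N}. chain_weight t lam mu e nu else 0)"

text \<open>The finished part of the weight: the double diagonals from d on and the components lying
  entirely beyond d.\<close>

definition outer :: "'a::field \<Rightarrow> nat list \<Rightarrow> nat list \<Rightarrow> nat \<Rightarrow> nat \<Rightarrow> 'a" where
  "outer t lam mu N d = (- t) ^ card {e \<in> {d..N}. gap lam mu e = 2}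
     * (\<Prod>a\<in>{a \<in> bottoms (ones lam mu). d < a}. comp_sum t (run_rows lam (run (ones lam mu) a)))"

definition run_state :: "'a::field \<Rightarrow> nat list \<Rightarrow> nat list \<Rightarrow> nat \<Rightarrow> 'a \<times> 'a" where
  "run_state t lam mu d = row_state t (rev (run_rows lam (run (ones lam mu) d)))"

lemma gap_split: "gap nu mu d = gap lam mu d - gap lam nu d"
  by (simp add: gap_def)

text \<open>Here c records whether \<open>Suc d\<close> is a part of \<open>nu\<close> and x whether
  it is a part of \<open>lam\<close>; together they fix the change of the gap. States other than 0
  and 1 have weight 0.\<close>

lemma transfer_Suc:
  assumes d: "d < N" and lam: "strict_partition lam"
  defines "x \<equiv> if Suc d \<in> set lam then 1 else 0 :: int"
  shows "transfer t lam mu N d s' = (\<Sum>s\<in>{0, 1}. \<Sum>c\<in>{0, 1}. if s + x - c = s'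
    then diag_weight t s' (gap lam mu d - s') s (gap lam mu (Suc d) - s) * transfer t lam mu N (Suc d) s
    else 0)"
proof -
  let ?P = "\<lambda>nu. \<Prod>e\<in>{Suc d..N}. chain_weight t lam mu e nu"
  let ?W = "\<lambda>s. diag_weight t s' (gap lam mu d - s') s (gap lam mu (Suc d) - s)"
  let ?ext = "\<lambda>c nu. nu @ (if c = (1::int) then [Suc d] else [])"
  have ext: "(if gap lam (?ext c nu) d = s' then \<Prod>e\<in>{d..N}. chain_weight t lam mu e (?ext c nu) else 0)
      = (\<Sum>s\<in>{0, 1}. if s + x - c = s' then ?W s * (if gap lam nu (Suc d) = s then ?P nu else 0) else 0)"
    if nu: "nu \<in> strict_in (Suc d) N" and c: "c \<in> {0, 1}" for c nu
  proof -
    have nuS: "strict_partition nu" "Suc d \<notin> set nu" using nu by (auto simp: strict_in_def)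
    have above: "above (?ext c nu) e = above nu e" if "e \<ge> Suc d" for e
      using that by (simp add: above_append above_Cons)
    have "above (?ext c nu) d = above nu (Suc d) + nat c"
      using above_Suc[OF nuS(1), of d] nuS(2) c by (auto simp: above_append above_Cons)
    then have gd: "gap lam (?ext c nu) d = gap lam nu (Suc d) + x - c"
      using above_Suc[OF lam, of d] c by (auto simp: gap_def x_def)
    have gap: "gap lam (?ext c nu) e = gap lam nu e" "gap (?ext c nu) mu e = gap nu mu e" if "e \<ge> Suc d" for e
      using above[OF that] by (simp_all only: gap_def)
    have "(\<Prod>e\<in>{d..N}. chain_weight t lam mu e (?ext c nu))
        = chain_weight t lam mu d (?ext c nu) * (\<Prod>e\<in>{Suc d..N}. chain_weight t lam mu e (?ext c nu))"
      using d by (simp add: prod.atLeast_Suc_atMost)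
    also have "(\<Prod>e\<in>{Suc d..N}. chain_weight t lam mu e (?ext c nu)) = ?P nu"
      by (rule prod.cong[OF refl]) (simp add: chain_weight_def gap del: append.simps)
    also have "chain_weight t lam mu d (?ext c nu) = diag_weight t (gap lam (?ext c nu) d)
        (gap lam mu d - gap lam (?ext c nu) d) (gap lam nu (Suc d)) (gap lam mu (Suc d) - gap lam nu (Suc d))"
      unfolding chain_weight_def gap[OF order_refl]
      by (simp only: gap_split[of "?ext c nu" mu d lam] gap_split[of nu mu "Suc d" lam])
    finally have prod: "(\<Prod>e\<in>{d..N}. chain_weight t lam mu e (?ext c nu)) = \<dots> * ?P nu" .
    have P0: "?P nu = 0" if "gap lam nu (Suc d) \<notin> {0, 1}"
    proof -
      have "chain_weight t lam mu (Suc d) nu = 0" using that by (auto simp: chain_weight_def diag_weight_def)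
      then show ?thesis using d by (intro prod_zero) auto
    qed
    show ?thesis
      unfolding prod gd
      by (cases "gap lam nu (Suc d) = 0"; cases "gap lam nu (Suc d) = 1") (auto simp: P0)
  qed
  have "transfer t lam mu N d s' = (\<Sum>nu\<in>strict_in (Suc d) N. \<Sum>c\<in>{0, 1}.
      if gap lam (?ext c nu) d = s' then \<Prod>e\<in>{d..N}. chain_weight t lam mu e (?ext c nu) else 0)"
    unfolding transfer_def sum_strict_in_Suc[OF d] by (simp cong: if_cong)
  also have "\<dots> = (\<Sum>nu\<in>strict_in (Suc d) N. \<Sum>c\<in>{0, 1}. \<Sum>s\<in>{0, 1}.
      if s + x - c = s' then ?W s * (if gap lam nu (Suc d) = s then ?P nu else 0) else 0)"
    by (intro sum.cong[OF refl] ext)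
  also have "\<dots> = (\<Sum>s\<in>{0, 1}. \<Sum>c\<in>{0, 1}. \<Sum>nu\<in>strict_in (Suc d) N.
      if s + x - c = s' then ?W s * (if gap lam nu (Suc d) = s then ?P nu else 0) else 0)"
    by (subst sum.swap[of _ "strict_in (Suc d) N"], subst sum.swap[of _ "{0, 1}" "strict_in (Suc d) N"])
       (simp add: add.commute add.left_commute sum.distrib)
  also have "\<dots> = (\<Sum>s\<in>{0, 1}. \<Sum>c\<in>{0, 1}. if s + x - c = s' then ?W s * transfer t lam mu N (Suc d) s else 0)"
    by (intro sum.cong[OF refl]) (auto simp: transfer_def sum_distrib_left)
  finally show ?thesis .
qed

section \<open>Evaluation of the transfer recursion for a double strip\<close>

context
  fixes t :: "'a::field" and lam mu :: "nat list" and N :: nat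
  assumes t: "t + 1 \<noteq> 0"
    and lam: "strict_partition lam" and mu: "strict_partition mu"
    and lamN: "\<forall>x\<in>set lam. x \<le> N"
    and gap: "\<And>d. gap lam mu d \<in> {0, 1, 2}"
begin

lemma ones_iff: "d \<in> ones lam mu \<longleftrightarrow> gap lam mu d = 1"
  by (auto simp: ones_def gap_def)

lemma gap_ge_N: "d \<ge> N \<Longrightarrow> gap lam mu d = 0"
  using gap[of d] above_eq_0[of lam d] lamN by (force simp: gap_def)

lemma ones_bound: "ones lam mu \<subseteq> {..<N}"
  using gap_ge_N by (auto simp: ones_iff) (metis not_less zero_neq_one)

lemma finite_ones: "finite (ones lam mu)"
  using ones_bound finite_subset by blast

lemma finite_run: "finite (run (ones lam mu) d)"
  by (rule finite_subset[OF _ finite_ones]) (auto simp: run_def)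

lemma finite_bottoms: "finite (bottoms (ones lam mu))"
  by (rule finite_subset[OF _ finite_ones]) (auto simp: bottoms_def)

lemma run_last: "d \<in> ones lam mu \<Longrightarrow> Suc d \<notin> ones lam mu \<Longrightarrow> run (ones lam mu) d = {d}"
  by (auto simp: run_def subset_iff) (metis Suc_leI le_SucI le_eq_less_or_eq order_refl)

lemma run_step:
  assumes "d \<in> ones lam mu"
  shows "run (ones lam mu) d = insert d (run (ones lam mu) (Suc d))"
proof -
  have "{d..e} = insert d {Suc d..e}" if "d \<le> e" for e using that by auto
  then show ?thesis
    using assms by (auto simp: run_def)
qed

lemma run_state_last: "d \<in> ones lam mu \<Longrightarrow> Suc d \<notin> ones lam mu \<Longrightarrow> run_state t lam mu d = (- 1, t)"
  by (simp add: run_state_def run_last run_rows_singleton)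

lemma run_state_step:
  assumes d: "d \<in> ones lam mu" "Suc d \<in> ones lam mu"
  shows "run_state t lam mu d =
    (if Suc d \<in> set lam then new_row t else same_row t) (run_state t lam mu (Suc d))"
proof -
  let ?R = "run (ones lam mu) (Suc d)"
  have mem: "Suc d \<in> ?R" using d by (simp add: run_def)
  have le: "above lam e \<le> above lam (Suc d)" if "e \<in> ?R" for e
    using that by (auto simp: run_def intro: above_antimono)
  show ?thesis
  proof (cases "Suc d \<in> set lam")
    case True
    then have "above lam d = Suc (above lam (Suc d))" using above_Suc[OF lam, of d] by simp
    then have rr: "run_rows lam (run (ones lam mu) d) = run_rows lam ?R @ [1]"
      unfolding run_step[OF d(1)] using le by (intro run_rows_new_row finite_run) (simp add: less_Suc_eq_le)
    have "rev (run_rows lam ?R) \<noteq> []"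
      using mem finite_run[of "Suc d"] by (auto simp: run_rows_def)
    then obtain j r where "rev (run_rows lam ?R) = j # r" by (cases "rev (run_rows lam ?R)") auto
    then show ?thesis using True by (simp add: run_state_def rr)
  next
    case False
    then have "above lam (Suc d) = above lam d" using above_Suc[OF lam, of d] by simp
    then obtain rho k where rr: "run_rows lam ?R = rho @ [k]" "run_rows lam (run (ones lam mu) d) = rho @ [Suc k]"
      using run_rows_same_row[of ?R "Suc d" d lam] mem le finite_run[of "Suc d"]
      unfolding run_step[OF d(1)] by (auto simp: run_def)
    have "k > 0" using run_rows_pos[OF finite_run, of lam "Suc d"] rr by auto
    then show ?thesis using False by (simp add: run_state_def rr row_state_Suc)
  qed
qed

lemma run_state_comp_sum:
  assumes "d \<in> ones lam mu"
  shows "comp_sum t (run_rows lam (run (ones lam mu) d))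
    = 2 * (fst (run_state t lam mu d) + snd (run_state t lam mu d))"
proof -
  have "d \<in> run (ones lam mu) d" using assms by (simp add: run_def)
  then have "run_rows lam (run (ones lam mu) d) \<noteq> []"
    using finite_run[of d] by (auto simp: run_rows_def)
  then show ?thesis
    using row_state_comp_sum[OF t, of "rev (run_rows lam (run (ones lam mu) d))"] run_rows_pos[OF finite_run]
    by (simp add: run_state_def)
qed

lemma outer_N: "outer t lam mu N N = 1"
proof -
  have "{e \<in> {N..N}. gap lam mu e = 2} = {}" using gap_ge_N[of N] by auto
  moreover have "{a \<in> bottoms (ones lam mu). N < a} = {}" using ones_bound by (auto simp: bottoms_def)
  ultimately show ?thesis by (simp only: outer_def card.empty prod.empty power_0 mult_1)
qed

lemma outer_Suc:
  assumes "d < N"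
  shows "outer t lam mu N d = (if gap lam mu d = 2 then - t else 1)
    * (if gap lam mu d \<noteq> 1 \<and> gap lam mu (Suc d) = 1
       then 2 * (fst (run_state t lam mu (Suc d)) + snd (run_state t lam mu (Suc d))) else 1)
    * outer t lam mu N (Suc d)"
proof -
  let ?B = "bottoms (ones lam mu)"
  let ?S = "\<lambda>a. comp_sum t (run_rows lam (run (ones lam mu) a))"
  have "{e \<in> {d..N}. gap lam mu e = 2}
      = (if gap lam mu d = 2 then insert d {e \<in> {Suc d..N}. gap lam mu e = 2} else {e \<in> {Suc d..N}. gap lam mu e = 2})"
    using assms by (auto simp: Suc_le_eq le_less)
  then have 1: "(- t) ^ card {e \<in> {d..N}. gap lam mu e = 2}
      = (if gap lam mu d = 2 then - t else 1) * (- t) ^ card {e \<in> {Suc d..N}. gap lam mu e = 2}"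
    by (simp del: mult_minus_left)
  have b: "Suc d \<in> ?B \<longleftrightarrow> gap lam mu d \<noteq> 1 \<and> gap lam mu (Suc d) = 1"
    by (auto simp: bottoms_def ones_iff)
  have "{a \<in> ?B. d < a} = (if Suc d \<in> ?B then insert (Suc d) {a \<in> ?B. Suc d < a} else {a \<in> ?B. Suc d < a})"
    by (auto simp: Suc_lessI) (metis Suc_lessI)+
  then have 2: "(\<Prod>a\<in>{a \<in> ?B. d < a}. ?S a)
      = (if Suc d \<in> ?B then ?S (Suc d) else 1) * (\<Prod>a\<in>{a \<in> ?B. Suc d < a}. ?S a)"
    using finite_bottoms by simp
  have "Suc d \<in> ?B \<Longrightarrow> Suc d \<in> ones lam mu" by (simp add: bottoms_def)
  then show ?thesis
    unfolding outer_def 1 2 b[symmetric] by (simp add: run_state_comp_sum del: mult_minus_left)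
qed

text \<open>A run starting after an empty diagonal receives a factor 2 from its first square; one
  starting after a double diagonal inherits the 2 held there. Closing a run adds its two states,
  which gives its factor by \<open>run_state_comp_sum\<close>. If it closes onto a double diagonal,
  both states enter with -2t, so a factor 2 is left over for the double stretch.\<close>

lemma transfer_invariant:
  assumes "d \<le> N"
  shows "(gap lam mu d = 0 \<longrightarrow> transfer t lam mu N d 0 = outer t lam mu N d \<and> transfer t lam mu N d 1 = 0)
    \<and> (gap lam mu d = 1 \<longrightarrow> transfer t lam mu N d 0 = 2 * outer t lam mu N d * fst (run_state t lam mu d)
        \<and> transfer t lam mu N d 1 = 2 * outer t lam mu N d * snd (run_state t lam mu d))
    \<and> (gap lam mu d = 2 \<longrightarrow> transfer t lam mu N d 0 = 0 \<and> transfer t lam mu N d 1 = 2 * outer t lam mu N d)"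
  using assms
proof (induction d rule: inc_induct)
  case base
  have a: "above nu e = 0" if "nu \<in> {lam, mu, []}" "e \<ge> N" for nu e
    using that above_eq_0[of lam e] lamN gap_ge_N[of e] by (force simp: gap_def)
  have "transfer t lam mu N N s = (if s = 0 then 1 else 0)" for s
    by (auto simp: transfer_def strict_in_self chain_weight_def gap_def a diag_weight_def)
  then show ?case using gap_ge_N[of N] by (simp add: outer_N)
next
  case (step d)
  note T = transfer_Suc[OF step(2) lam, where mu = mu and t = t]
  note E = outer_Suc[OF step(2)]
  have g: "gap lam mu d + (if Suc d \<in> set mu then 1 else 0) = gap lam mu (Suc d) + (if Suc d \<in> set lam then 1 else 0)"
    using above_Suc[OF lam, of d] above_Suc[OF mu, of d] by (simp add: gap_def)
  have D: "gap lam mu d \<in> {0, 1, 2}" "gap lam mu (Suc d) \<in> {0, 1, 2}" by (rule gap)+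
  note IH = step.IH
  note w = diag_weight_def
  consider (00) "gap lam mu d = 0" "gap lam mu (Suc d) = 0"
    | (01) "gap lam mu d = 0" "gap lam mu (Suc d) = 1" "Suc d \<notin> set lam"
    | (10) "gap lam mu d = 1" "gap lam mu (Suc d) = 0" "Suc d \<in> set lam"
    | (11) "gap lam mu d = 1" "gap lam mu (Suc d) = 1"
    | (12) "gap lam mu d = 1" "gap lam mu (Suc d) = 2" "Suc d \<notin> set lam"
    | (21) "gap lam mu d = 2" "gap lam mu (Suc d) = 1" "Suc d \<in> set lam"
    | (22) "gap lam mu d = 2" "gap lam mu (Suc d) = 2"
    using D g by (auto split: if_splits)
  then show ?case
  proof cases
    case 00
    then show ?thesis using IH by (simp add: T E w)
  next
    case 01
    then show ?thesis using IH by (simp add: T E w algebra_simps)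
  next
    case 10
    then have "run_state t lam mu d = (- 1, t)" by (intro run_state_last) (simp_all add: ones_iff)
    then show ?thesis using 10 IH by (simp add: T E w algebra_simps)
  next
    case 11
    then have "run_state t lam mu d =
        (if Suc d \<in> set lam then new_row t else same_row t) (run_state t lam mu (Suc d))"
      by (intro run_state_step) (simp_all add: ones_iff)
    then show ?thesis using 11 IH by (simp add: T E w same_row_def new_row_def algebra_simps)
  next
    case 12
    then have "run_state t lam mu d = (- 1, t)" by (intro run_state_last) (simp_all add: ones_iff)
    then show ?thesis using 12 IH by (simp add: T E w algebra_simps)
  next
    case 21
    then show ?thesis using IH by (simp add: T E w algebra_simps)
  next
    case 22
    then show ?thesis using IH by (simp add: T E w algebra_simps)
  qed
qed

text \<open>At the main diagonal a run that reaches it is closed by adding its two states. If the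
  main diagonal is double, that is, if the lengths differ by 2, the factor 2 held by the stretch
  survives.\<close>

lemma wt_eq:
  "wt t lam mu = (\<Sum>nu\<in>strict_in 0 N. \<Prod>e\<le>N. chain_weight t lam mu e nu)"
proof -
  have "(\<Sum>nu\<in>strict_in 0 N. \<Prod>e\<le>N. chain_weight t lam mu e nu) = transfer t lam mu N 0 0 + transfer t lam mu N 0 1"
    unfolding transfer_def sum.distrib[symmetric]
  proof (rule sum.cong[OF refl])
    fix nu
    show "(\<Prod>e\<le>N. chain_weight t lam mu e nu)
      = (if gap lam nu 0 = 0 then \<Prod>e\<in>{0..N}. chain_weight t lam mu e nu else 0)
        + (if gap lam nu 0 = 1 then \<Prod>e\<in>{0..N}. chain_weight t lam mu e nu else 0)"
    proof (cases "gap lam nu 0 \<in> {0, 1}")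
      case False
      then have "chain_weight t lam mu 0 nu = 0" by (auto simp: chain_weight_def diag_weight_def)
      then have "(\<Prod>e\<le>N. chain_weight t lam mu e nu) = 0" by (intro prod_zero) auto
      then show ?thesis using False by simp
    qed (auto simp: atMost_atLeast0)
  qed
  also have "\<dots> = (- t) ^ card {e \<in> {0..N}. gap lam mu e = 2} * (if gap lam mu 0 = 2 then 2 else 1)
      * (\<Prod>a\<in>bottoms (ones lam mu). comp_sum t (run_rows lam (run (ones lam mu) a)))"
  proof -
    have B: "bottoms (ones lam mu) = (if gap lam mu 0 = 1 then {0} else {}) \<union> {a \<in> bottoms (ones lam mu). 0 < a}"
      by (auto simp: bottoms_def ones_iff) (metis gr0I)
    have P: "(\<Prod>a\<in>bottoms (ones lam mu). comp_sum t (run_rows lam (run (ones lam mu) a)))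
        = (if gap lam mu 0 = 1 then comp_sum t (run_rows lam (run (ones lam mu) 0)) else 1)
          * (\<Prod>a\<in>{a \<in> bottoms (ones lam mu). 0 < a}. comp_sum t (run_rows lam (run (ones lam mu) a)))"
      by (subst B, subst prod.union_disjoint) (auto simp: finite_bottoms)
    consider "gap lam mu 0 = 0" | "gap lam mu 0 = 1" | "gap lam mu 0 = 2" using gap[of 0] by auto
    then show ?thesis
    proof cases
      case 2
      then have "0 \<in> ones lam mu" by (simp add: ones_iff)
      then show ?thesis
        using transfer_invariant[of 0] 2 unfolding P by (simp add: outer_def run_state_comp_sum algebra_simps)
    qed (use transfer_invariant[of 0] in \<open>simp_all add: P outer_def\<close>)
  qed
  also have "{e \<in> {0..N}. gap lam mu e = 2} = {e. above lam e = above mu e + 2}"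
  proof (intro equalityI subsetI)
    fix e assume e: "e \<in> {e. above lam e = above mu e + 2}"
    then have "gap lam mu e = 2" by (simp add: gap_def)
    then show "e \<in> {e \<in> {0..N}. gap lam mu e = 2}" using gap_ge_N[of e] by (cases "e \<le> N") auto
  qed (auto simp: gap_def)
  also have "gap lam mu 0 = 2 \<longleftrightarrow> length lam = length mu + 2"
    by (auto simp: gap_def above_0 lam mu)
  finally have "(\<Sum>nu\<in>strict_in 0 N. \<Prod>e\<le>N. chain_weight t lam mu e nu)
      = (- t) ^ c_strip lam mu * (if length lam = length mu + 2 then 2 else 1)
        * (\<Prod>xi\<in>components (beta lam mu). comp_sum t (row_lengths xi))"
    unfolding c_strip_eq[OF mu lam] prod_components[OF mu lam] .
  then show ?thesis
    by (simp add: wt_def comp_sum_def)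
qed

end

text \<open>A component of a strip occupies an interval of diagonals and has one upper end, so the
  exponent is the number of components.\<close>

definition strip_weight :: "nat list \<Rightarrow> nat list \<Rightarrow> 'a::field" where
  "strip_weight lam nu = 2 ^ card {d. gap lam nu d = 1 \<and> gap lam nu (Suc d) = 0}"

lemma strip_gap: "strip lam nu \<longleftrightarrow> (\<forall>d. gap lam nu d \<in> {0, 1})"
proof -
  have "above nu d \<le> above lam d \<and> above lam d \<le> Suc (above nu d) \<longleftrightarrow> gap lam nu d \<in> {0, 1}" for d
    by (auto simp: gap_def)
  then show ?thesis by (simp add: strip_def)
qed

section \<open>The Pieri rule\<close>

lemma strict_partition_Cons:
  "strict_partition (n # lam) \<longleftrightarrow> strict_partition lam \<and> n > 0 \<and> (\<forall>x\<in>set lam. x < n)"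
  by (auto simp: strict_partition_def)

lemma strip_bound:
  assumes "strip lam nu" "\<forall>x\<in>set lam. x \<le> N"
  shows "\<forall>x\<in>set nu. x \<le> N"
  using assms above_eq_0_iff[of lam N] above_eq_0_iff[of nu N] by (metis le_zero_eq strip_def)

lemma strip_sum_list_le:
  assumes "strip lam nu"
  shows "sum_list nu \<le> sum_list lam"
proof -
  define N where "N = Max (insert 0 (set lam))"
  have "\<forall>x\<in>set lam. x \<le> N" by (simp add: N_def)
  then show ?thesis
    using strip_bound[OF assms] assms
    by (auto simp: sum_list_above[of _ N] strip_def intro!: sum_mono)
qed

lemma strict_partition_eqI:
  assumes "strict_partition lam" "strict_partition nu" "\<And>d. above lam d = above nu d"
  shows "lam = nu"
proof -
  have mem: "x \<in> set l \<longleftrightarrow> x > 0 \<and> above l (x - 1) \<noteq> above l x" if "strict_partition l" for x l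
    using above_Suc[OF that, of "x - 1"] that by (cases x) (auto simp: strict_partition_def)
  have "set lam = set nu" using mem[OF assms(1)] mem[OF assms(2)] assms(3) by auto
  moreover have "sorted (rev l)" if "strict_partition l" for l
    using that by (auto simp: strict_partition_def sorted_wrt_rev elim: sorted_wrt_mono_rel[rotated])
  ultimately have "rev lam = rev nu"
    using assms strict_partition_distinct by (intro sorted_distinct_set_unique) auto
  then show ?thesis by simp
qed

definition strips :: "nat list \<Rightarrow> nat \<Rightarrow> nat list set" where
  "strips lam k = {nu. strict_partition nu \<and> strip lam nu \<and> sum_list nu + k = sum_list lam}"

lemma strips_subset: "\<forall>x\<in>set lam. x \<le> N \<Longrightarrow> strips lam k \<subseteq> strict_in 0 N"
  using strip_bound by (auto simp: strips_def strict_in_def strict_partition_def intro: gr0I)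

lemma finite_strips: "finite (strips lam k)"
  by (rule finite_subset[OF strips_subset[of lam "Max (insert 0 (set lam))"] finite_strict_in]) auto

lemma strip_weight_self: "strip_weight lam lam = 1"
  by (simp add: strip_weight_def gap_def)

lemma strips_0:
  assumes "strict_partition lam"
  shows "strips lam 0 = {lam}"
proof (intro equalityI subsetI)
  fix nu assume "nu \<in> strips lam 0"
  then have nu: "strict_partition nu" "strip lam nu" "sum_list nu = sum_list lam" by (auto simp: strips_def)
  define N where "N = Max (insert 0 (set lam))"
  have N: "\<forall>x\<in>set lam. x \<le> N" by (simp add: N_def)
  note N' = strip_bound[OF nu(2) N]
  have "above nu d = above lam d" for d
  proof (cases "d \<le> N")
    case True
    then show ?thesis
      using sum_mono_inv[of "above nu" "{..N}" "above lam" d] nu(2,3)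
      by (auto simp: sum_list_above[OF N] sum_list_above[OF N'] strip_def)
  next
    case False
    then have "\<forall>x\<in>set nu. x \<le> d" "\<forall>x\<in>set lam. x \<le> d" using N N' by force+
    then show ?thesis by (simp add: above_eq_0)
  qed
  then show "nu \<in> {lam}" using strict_partition_eqI[OF nu(1) assms] by simp
qed (use assms in \<open>simp add: strips_def strip_def\<close>)

lemma strict_partition_hd:
  assumes "strict_partition nu" "n \<in> set nu" "\<forall>x\<in>set nu. x \<le> n"
  obtains nu' where "nu = n # nu'" "strict_partition nu'" "\<forall>x\<in>set nu'. x < n"
proof -
  obtain y ys where y: "nu = y # ys" using assms(2) by (cases nu) auto
  then have "y = n" using assms by (force simp: strict_partition_Cons)
  then show thesis using that y assms by (auto simp: strict_partition_Cons)
qed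

lemma gap_Cons_Cons: "gap (n # lam) (n # nu) d = gap lam nu d"
  by (simp add: gap_def above_Cons)

lemma strip_Cons_Cons: "strip (n # lam) (n # nu) \<longleftrightarrow> strip lam nu"
  by (simp add: strip_gap gap_Cons_Cons)

lemma strip_weight_Cons_Cons: "strip_weight (n # lam) (n # nu) = strip_weight lam nu"
  by (simp add: strip_weight_def gap_Cons_Cons)

text \<open>A square added beyond all others opens a new component unless it attaches to a square on
  the preceding diagonal, which then ceases to be an upper end.\<close>

lemma card_starts_update:
  fixes g g' :: "nat \<Rightarrow> int"
  assumes g': "\<And>d. g' d = g d + (if d = m then 1 else 0)"
    and m: "m > 0" and g: "\<And>d. d \<ge> m \<Longrightarrow> g d = 0"
  shows "card {d. g' d = 1 \<and> g' (Suc d) = 0}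
    = card {d. g d = 1 \<and> g (Suc d) = 0} + (if g (m - 1) = 1 then 0 else 1)"
proof -
  define A where "A = {d. g d = 1 \<and> g (Suc d) = 0}"
  have "A \<subseteq> {..m}" using g by (auto simp: A_def not_less) (metis nle_le zero_neq_one)
  then have fin: "finite A" by (rule finite_subset) simp
  have eq: "{d. g' d = 1 \<and> g' (Suc d) = 0} = insert m (A - {m - 1})"
    using g[of m] g[of "Suc m"] m by (auto simp: A_def g' split: if_splits)
  have "m \<notin> A" using g[of m] by (simp add: A_def)
  moreover have "m - 1 \<in> A \<longleftrightarrow> g (m - 1) = 1" using m g[of m] by (simp add: A_def)
  ultimately show ?thesis
    unfolding eq A_def[symmetric] using fin card.remove[OF fin, of "m - 1"] by simp
qed

text \<open>If n survives as a part of \<open>nu\<close>, the first rows coincide and can be struck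
  from both partitions.\<close>

lemma strips_Cons_split:
  assumes "strict_partition (n # lam)"
  shows "(\<Sum>nu\<in>strips (n # lam) k. F nu)
    = (\<Sum>nu\<in>strips lam k. F (n # nu)) + (\<Sum>nu\<in>{nu \<in> strips (n # lam) k. n \<notin> set nu}. F nu)"
proof -
  have ss: "strict_partition lam" "n > 0" "\<forall>x\<in>set lam. x < n" using assms by (auto simp: strict_partition_Cons)
  have b: "\<forall>x\<in>set nu. x \<le> n" if "strip (n # lam) nu" for nu
    by (rule strip_bound[OF that]) (use ss in \<open>auto intro: less_imp_le\<close>)
  have b': "\<forall>x\<in>set nu. x < n" if "strip lam nu" for nu
    using strip_bound[OF that, of "n - 1"] ss by fastforce
  have "{nu \<in> strips (n # lam) k. n \<in> set nu} = (\<lambda>nu. n # nu) ` strips lam k"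
  proof (intro equalityI subsetI)
    fix nu assume nu: "nu \<in> {nu \<in> strips (n # lam) k. n \<in> set nu}"
    then obtain nu' where "nu = n # nu'" "strict_partition nu'"
      using strict_partition_hd b by (metis (mono_tags, lifting) mem_Collect_eq strips_def)
    then show "nu \<in> (\<lambda>nu. n # nu) ` strips lam k"
      using nu by (auto simp: strips_def strip_Cons_Cons)
  next
    fix nu assume "nu \<in> (\<lambda>nu. n # nu) ` strips lam k"
    then show "nu \<in> {nu \<in> strips (n # lam) k. n \<in> set nu}"
      using b' ss by (auto simp: strips_def strip_Cons_Cons strict_partition_Cons)
  qed
  then have "(\<Sum>nu\<in>strips lam k. F (n # nu)) = (\<Sum>nu\<in>{nu \<in> strips (n # lam) k. n \<in> set nu}. F nu)"
    by (simp add: sum.reindex)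
  moreover have "strips (n # lam) k
      = {nu \<in> strips (n # lam) k. n \<in> set nu} \<union> {nu \<in> strips (n # lam) k. n \<notin> set nu}" by auto
  ultimately show ?thesis
    using finite_strips[of "n # lam" k] by (subst (1) \<open>strips (n # lam) k = _\<close>, subst sum.union_disjoint) auto
qed

text \<open>If the largest part is not kept, the last square of the first row belongs to the strip
  and can be removed. It is a component of its own, worth a factor 2, precisely when m is a part of
  \<open>nu\<close>, since the square before it then lies outside the strip.\<close>

lemma strips_without_largest:
  assumes "strict_partition (m # lam)"
  shows "{nu \<in> strips (Suc m # lam) (Suc k). Suc m \<notin> set nu} = strips (m # lam) k"
    and "nu \<in> strips (m # lam) k \<Longrightarrow>
      strip_weight (Suc m # lam) nu = (if m \<in> set nu then 2 else 1) * strip_weight (m # lam) nu"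
proof -
  have ss: "strict_partition lam" "m > 0" "\<forall>x\<in>set lam. x < m" using assms by (auto simp: strict_partition_Cons)
  have g: "gap (Suc m # lam) nu d = gap (m # lam) nu d + (if d = m then 1 else 0)" for nu d
    by (auto simp: gap_def above_Cons)
  have g0: "gap (m # lam) nu d = 0" if "\<forall>x\<in>set nu. x \<le> m" "d \<ge> m" for nu d
    using that ss above_eq_0[of lam d] above_eq_0[of nu d] by (force simp: gap_def above_Cons)
  have eq: "strip (Suc m # lam) nu \<longleftrightarrow> strip (m # lam) nu" if "\<forall>x\<in>set nu. x \<le> m" for nu
  proof -
    have "gap (m # lam) nu d + (if d = m then 1 else 0) \<in> {0, 1} \<longleftrightarrow> gap (m # lam) nu d \<in> {0, 1}" for d
      using g0[OF that, of d] by auto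
    then show ?thesis unfolding strip_gap g by simp
  qed
  have b: "\<forall>x\<in>set nu. x \<le> m" if "strip (m # lam) nu" for nu
    by (rule strip_bound[OF that]) (use ss in \<open>auto intro: less_imp_le\<close>)
  have b': "\<forall>x\<in>set nu. x \<le> m" if "strip (Suc m # lam) nu" "Suc m \<notin> set nu" for nu
    using strip_bound[OF that(1), of "Suc m"] that(2) ss by (auto simp: le_Suc_eq less_imp_le)
  show "{nu \<in> strips (Suc m # lam) (Suc k). Suc m \<notin> set nu} = strips (m # lam) k"
    using eq b b' by (fastforce simp: strips_def)
  assume nu: "nu \<in> strips (m # lam) k"
  then have st: "strict_partition nu" and bn: "\<forall>x\<in>set nu. x \<le> m" using b by (auto simp: strips_def)
  have "above lam (m - 1) = 0" using ss by (intro above_eq_0) auto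
  moreover have "above nu (m - 1) = (if m \<in> set nu then 1 else 0)"
    using above_Suc[OF st, of "m - 1"] above_eq_0[of nu m] bn ss by simp
  ultimately have "gap (m # lam) nu (m - 1) = 1 \<longleftrightarrow> m \<notin> set nu"
    using ss by (simp add: gap_def above_Cons)
  then show "strip_weight (Suc m # lam) nu = (if m \<in> set nu then 2 else 1) * strip_weight (m # lam) nu"
    using card_starts_update[OF g ss(2) g0[OF bn]] by (simp add: strip_weight_def)
qed

text \<open>With second part m, \<open>nu\<close> must contain m, as otherwise diagonal m - 1 would
  lose two squares. Striking this m leaves a strip of \<open>m # lam\<close> with a square on
  diagonal m - 1; the extra square on diagonal m attaches to it and the weight is unchanged.\<close>

lemma strips_without_largest_adjacent:
  assumes "strict_partition (m # lam)"
  shows "{nu \<in> strips (Suc m # m # lam) (Suc k). Suc m \<notin> set nu}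
      = (\<lambda>nu. m # nu) ` {nu \<in> strips (m # lam) k. m \<notin> set nu}"
    and "nu \<in> strips (m # lam) k \<Longrightarrow> m \<notin> set nu \<Longrightarrow>
      strip_weight (Suc m # m # lam) (m # nu) = strip_weight (m # lam) nu"
proof -
  have ss: "strict_partition lam" "m > 0" "\<forall>x\<in>set lam. x < m" using assms by (auto simp: strict_partition_Cons)
  have g: "gap (Suc m # m # lam) (m # nu) d = gap (m # lam) nu d + (if d = m then 1 else 0)" for nu d
    by (auto simp: gap_def above_Cons)
  have g0: "gap (m # lam) nu d = 0" if "\<forall>x\<in>set nu. x < m" "d \<ge> m" for nu d
    using that ss above_eq_0[of lam d] above_eq_0[of nu d] by (force simp: gap_def above_Cons)
  have eq: "strip (Suc m # m # lam) (m # nu) \<longleftrightarrow> strip (m # lam) nu" if "\<forall>x\<in>set nu. x < m" for nu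
  proof -
    have "gap (m # lam) nu d + (if d = m then 1 else 0) \<in> {0, 1} \<longleftrightarrow> gap (m # lam) nu d \<in> {0, 1}" for d
      using g0[OF that, of d] by auto
    then show ?thesis unfolding strip_gap g by simp
  qed
  have b: "\<forall>x\<in>set nu. x < m" if "strip (m # lam) nu" "m \<notin> set nu" for nu
    using strip_bound[OF that(1), of m] that(2) ss by (auto simp: less_imp_le le_less)
  show "{nu \<in> strips (Suc m # m # lam) (Suc k). Suc m \<notin> set nu}
      = (\<lambda>nu. m # nu) ` {nu \<in> strips (m # lam) k. m \<notin> set nu}"
  proof (intro equalityI subsetI)
    fix nu assume nu: "nu \<in> {nu \<in> strips (Suc m # m # lam) (Suc k). Suc m \<notin> set nu}"
    then have st: "strict_partition nu" "strip (Suc m # m # lam) nu" by (auto simp: strips_def)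
    have bn: "\<forall>x\<in>set nu. x \<le> m"
      using strip_bound[OF st(2), of "Suc m"] nu ss by (auto simp: le_Suc_eq less_imp_le)
    have "2 \<le> above (Suc m # m # lam) (m - 1)" using ss by (simp add: above_Cons less_SucI)
    then have "above nu (m - 1) \<noteq> 0" using st(2) by (auto simp: strip_def dest!: spec[of _ "m - 1"])
    then have "m \<in> set nu"
      using above_Suc[OF st(1), of "m - 1"] above_eq_0[of nu m] bn ss by (auto split: if_splits)
    then obtain nu' where "nu = m # nu'" "strict_partition nu'" "\<forall>x\<in>set nu'. x < m"
      using strict_partition_hd[OF st(1)] bn by blast
    then show "nu \<in> (\<lambda>nu. m # nu) ` {nu \<in> strips (m # lam) k. m \<notin> set nu}"
      using nu eq by (auto simp: strips_def)
  next
    fix nu assume "nu \<in> (\<lambda>nu. m # nu) ` {nu \<in> strips (m # lam) k. m \<notin> set nu}"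
    then obtain nu' where nu': "nu = m # nu'" "nu' \<in> strips (m # lam) k" "m \<notin> set nu'" by auto
    then have "\<forall>x\<in>set nu'. x < m" using b by (auto simp: strips_def)
    then show "nu \<in> {nu \<in> strips (Suc m # m # lam) (Suc k). Suc m \<notin> set nu}"
      using nu' eq ss by (auto simp: strips_def strict_partition_Cons)
  qed
  assume nu: "nu \<in> strips (m # lam) k" "m \<notin> set nu"
  then have st: "strict_partition nu" and bn: "\<forall>x\<in>set nu. x < m" using b by (auto simp: strips_def)
  have "above lam (m - 1) = 0" "above nu (m - 1) = 0" using ss bn by (auto intro!: above_eq_0)
  then have "gap (m # lam) nu (m - 1) = 1" using ss by (simp add: gap_def above_Cons)
  then show "strip_weight (Suc m # m # lam) (m # nu) = strip_weight (m # lam) nu"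
    using card_starts_update[OF g ss(2) g0[OF bn]] by (simp add: strip_weight_def)
qed

lemma schurQ_Cons: "schurQ (n # lam) = Qop (int n) (schurQ lam)"
  by (simp add: schurQ_def)

text \<open>The relation between \<open>Qop\<close> and the skewing operators reduces the largest part by one; the
  term in which it collides with the second largest part vanishes.\<close>

lemma skewing_schurQ:
  assumes "strict_partition lam"
  shows "skewing k (schurQ lam) = (\<Sum>nu\<in>strips lam k. scal (strip_weight lam nu) * schurQ nu)"
  using assms
proof (induction lam arbitrary: k)
  case Nil
  show ?case
  proof (cases "k = 0")
    case True
    then show ?thesis by (simp add: strips_0[OF Nil] strip_weight_self)
  next
    case False
    then have "strips [] k = {}" by (auto simp: strips_def)
    then show ?thesis using False by (simp add: schurQ_def skewing_1)
  qed
next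
  case (Cons n lam)
  have IH: "skewing k (schurQ lam) = (\<Sum>nu\<in>strips lam k. scal (strip_weight lam nu) * schurQ nu)" for k
    using Cons by (simp add: strict_partition_Cons)
  show ?case using Cons.prems
  proof (induction n arbitrary: k)
    case 0
    then show ?case by (simp add: strict_partition_Cons)
  next
    case (Suc m)
    have ss: "strict_partition lam" "\<forall>x\<in>set lam. x \<le> m" using Suc.prems by (auto simp: strict_partition_Cons)
    show ?case
    proof (cases k)
      case 0
      then show ?thesis by (simp add: strips_0[OF Suc.prems] strip_weight_self)
    next
      case (Suc k')
      let ?W = "\<lambda>lam nu. scal (strip_weight lam nu) * schurQ nu"
      let ?S = "{nu \<in> strips (Suc m # lam) (Suc k'). Suc m \<notin> set nu}"
      have QW: "Qop (int j) (skewing i (schurQ lam)) = (\<Sum>nu\<in>strips lam i. scal (strip_weight lam nu) * schurQ (j # nu))" for i j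
        by (simp add: IH Qop_sum Qop_scal schurQ_Cons)
      have "skewing k (schurQ (Suc m # lam))
          = skewing k' (Qop (int m) (schurQ lam)) + Qop (int (Suc m)) (skewing (Suc k') (schurQ lam))
            + Qop (int m) (skewing k' (schurQ lam))"
        unfolding Suc schurQ_Cons skewing_Qop_Suc by simp
      also have "Qop (int (Suc m)) (skewing (Suc k') (schurQ lam))
          = (\<Sum>nu\<in>strips lam (Suc k'). ?W (Suc m # lam) (Suc m # nu))"
        by (simp only: QW strip_weight_Cons_Cons)
      also have "skewing k' (Qop (int m) (schurQ lam)) + (\<Sum>nu\<in>strips lam (Suc k'). ?W (Suc m # lam) (Suc m # nu))
          + Qop (int m) (skewing k' (schurQ lam))
          = (\<Sum>nu\<in>strips lam (Suc k'). ?W (Suc m # lam) (Suc m # nu))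
            + (skewing k' (Qop (int m) (schurQ lam)) + Qop (int m) (skewing k' (schurQ lam)))"
        by (simp only: add_ac)
      also have "skewing k' (Qop (int m) (schurQ lam)) + Qop (int m) (skewing k' (schurQ lam))
          = (\<Sum>nu\<in>?S. ?W (Suc m # lam) nu)"
      proof -
        consider (zero) "m = 0" | (adjacent) "m > 0" "m \<in> set lam" | (free) "m > 0" "m \<notin> set lam" by auto
        then show ?thesis
        proof cases
          \<comment> \<open>Lowering the part 1 leaves \<open>Qop 0 1 = 1\<close>; for k' = 0 both
            terms contribute 1, matching the weight 2 of a single square.\<close>
          case zero
          then have lam: "lam = []" using ss by (cases lam) (auto simp: strict_partition_def)
          have "strip [Suc 0] []" by (auto simp: strip_def above_Cons)
          then have S: "?S = (if k' = 0 then {[]} else {})"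
            unfolding lam zero
            by (auto simp: strips_def strict_partition_def) (metis list.set_intros(1) neq_Nil_conv)
          have "strip_weight [Suc 0] [] = (2::ratq)"
          proof -
            have "{d. gap [Suc 0] [] d = 1 \<and> gap [Suc 0] [] (Suc d) = 0} = {0}"
              by (auto simp: gap_def above_Cons split: if_splits)
            then show ?thesis by (simp add: strip_weight_def)
          qed
          then show ?thesis
            unfolding S unfolding lam zero by (simp add: schurQ_def Qop_0_1 skewing_1 scal_numeral)
        next
          case adjacent
          then obtain lam' where lam: "lam = m # lam'" "strict_partition lam'"
            using strict_partition_hd[OF ss(1) _ ss(2)] by blast
          have st: "strict_partition (m # lam')" using ss lam by simp
          have z: "schurQ (m # m # nu) = 0" for nu
            by (simp add: schurQ_Cons Qop_Qop_self adjacent)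
          have z': "schurQ (m # nu) = 0" if "nu \<in> strips lam k'" "m \<in> set nu" for nu
          proof -
            have "strict_partition nu" "\<forall>x\<in>set nu. x \<le> m"
              using that strip_bound[of lam nu m] ss by (auto simp: strips_def)
            then show ?thesis using strict_partition_hd[of nu m] that z by metis
          qed
          have "(\<Sum>nu\<in>?S. ?W (Suc m # lam) nu)
              = (\<Sum>nu\<in>{nu \<in> strips lam k'. m \<notin> set nu}. ?W (Suc m # lam) (m # nu))"
            unfolding lam strips_without_largest_adjacent(1)[OF st] by (simp add: sum.reindex)
          also have "\<dots> = (\<Sum>nu\<in>{nu \<in> strips lam k'. m \<notin> set nu}. scal (strip_weight lam nu) * schurQ (m # nu))"
            by (rule sum.cong[OF refl]) (simp add: lam strips_without_largest_adjacent(2)[OF st, where k = k'])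
          also have "\<dots> = (\<Sum>nu\<in>strips lam k'. scal (strip_weight lam nu) * schurQ (m # nu))"
            by (rule sum.mono_neutral_left) (auto simp: finite_strips z')
          also have "\<dots> = Qop (int m) (skewing k' (schurQ lam))" by (simp only: QW)
          finally show ?thesis
            using z[of lam'] by (simp add: lam schurQ_Cons)
        next
          \<comment> \<open>A partition containing m arises twice, once from the induction
            hypothesis for \<open>m # lam\<close> and once from \<open>Qop\<close> applied to the
            skewing of \<open>lam\<close>; this is the factor 2 of an isolated last square.\<close>
          case free
          then have st: "strict_partition (m # lam)"
            using ss by (auto simp: strict_partition_Cons le_less)
          have "(\<Sum>nu\<in>?S. ?W (Suc m # lam) nu)
              = (\<Sum>nu\<in>strips (m # lam) k'. ?W (m # lam) nu + (if m \<in> set nu then ?W (m # lam) nu else 0))"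
            unfolding strips_without_largest(1)[OF st]
          proof (rule sum.cong[OF refl])
            fix nu assume "nu \<in> strips (m # lam) k'"
            then show "?W (Suc m # lam) nu = ?W (m # lam) nu + (if m \<in> set nu then ?W (m # lam) nu else 0)"
              unfolding strips_without_largest(2)[OF st \<open>nu \<in> strips (m # lam) k'\<close>]
              by (simp add: scal_mult scal_numeral algebra_simps)
          qed
          also have "\<dots> = skewing k' (Qop (int m) (schurQ lam))
              + (\<Sum>nu\<in>strips (m # lam) k'. if m \<in> set nu then ?W (m # lam) nu else 0)"
            using Suc.IH[OF st, of k'] by (simp add: sum.distrib schurQ_Cons)
          also have "(\<Sum>nu\<in>strips (m # lam) k'. if m \<in> set nu then ?W (m # lam) nu else 0)
              = (\<Sum>nu\<in>strips lam k'. ?W (m # lam) (m # nu))"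
            by (subst strips_Cons_split[OF st]) simp
          also have "\<dots> = Qop (int m) (skewing k' (schurQ lam))"
            by (simp only: QW strip_weight_Cons_Cons)
          finally show ?thesis by simp
        qed
      qed
      finally show ?thesis
        unfolding strips_Cons_split[OF Suc.prems] Suc by simp
    qed
  qed
qed

section \<open>Iterated removal of double strips\<close>

definition strip_factor :: "'a::field \<Rightarrow> int \<Rightarrow> int \<Rightarrow> 'a" where
  "strip_factor c a' a = (if a' = 0 then 1 else if a' = 1 then c * (if a = 0 then 2 else 1) else 0)"

lemma diag_weight_factor:
  "diag_weight t a' b' a b = strip_factor t a' a * strip_factor (- 1) b' b"
  by (simp add: diag_weight_def strip_factor_def)

text \<open>Each square contributes c and each upper end of a component a 2, while a gap outside {0,
  1} makes the product vanish. The local factors thus also test whether the pair is a strip.\<close>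

lemma prod_strip_factor:
  assumes "\<forall>x\<in>set lam. x \<le> N" "\<forall>x\<in>set nu. x \<le> N"
  shows "(\<Prod>e\<le>N. strip_factor c (gap lam nu e) (gap lam nu (Suc e)))
    = (if strip lam nu then c ^ (sum_list lam - sum_list nu) * strip_weight lam nu else 0)"
proof -
  have gap0: "gap lam nu e = 0" if "e \<ge> N" for e
    using that assms above_eq_0[of lam e] above_eq_0[of nu e] by (force simp: gap_def)
  show ?thesis
  proof (cases "strip lam nu")
    case True
    then have g: "gap lam nu e = 0 \<or> gap lam nu e = 1" for e by (auto simp: strip_gap)
    have "(\<Prod>e\<le>N. strip_factor c (gap lam nu e) (gap lam nu (Suc e)))
        = (\<Prod>e\<le>N. c ^ nat (gap lam nu e) * (if gap lam nu e = 1 \<and> gap lam nu (Suc e) = 0 then 2 else 1))"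
      by (rule prod.cong[OF refl]) (use g in \<open>auto simp: strip_factor_def\<close>)
    also have "\<dots> = c ^ (\<Sum>e\<le>N. nat (gap lam nu e)) * 2 ^ card {e \<in> {..N}. gap lam nu e = 1 \<and> gap lam nu (Suc e) = 0}"
      by (simp add: prod.distrib power_sum prod.If_cases Int_def)
    also have "{e \<in> {..N}. gap lam nu e = 1 \<and> gap lam nu (Suc e) = 0} = {e. gap lam nu e = 1 \<and> gap lam nu (Suc e) = 0}"
      using gap0 by (auto simp: not_less) (metis nle_le zero_neq_one)
    also have "(\<Sum>e\<le>N. nat (gap lam nu e)) = sum_list lam - sum_list nu"
      unfolding sum_list_above[OF assms(1)] sum_list_above[OF assms(2)]
      by (subst sum_subtractf_nat[symmetric]) (use True in \<open>auto simp: gap_def strip_def intro!: sum.cong\<close>)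
    finally show ?thesis using True by (simp add: strip_weight_def)
  next
    case False
    then obtain e where e: "gap lam nu e \<notin> {0, 1}" by (auto simp: strip_gap)
    then have "e \<le> N" using gap0[of e] by (cases "e \<le> N") auto
    moreover have "strip_factor c (gap lam nu e) (gap lam nu (Suc e)) = 0" using e by (auto simp: strip_factor_def)
    ultimately have "(\<Prod>e\<le>N. strip_factor c (gap lam nu e) (gap lam nu (Suc e))) = 0"
      by (intro prod_zero) auto
    then show ?thesis using False by simp
  qed
qed

lemma prod_chain_weight:
  assumes "\<forall>x\<in>set lam. x \<le> N" "\<forall>x\<in>set nu. x \<le> N" "\<forall>x\<in>set mu. x \<le> N"
  shows "(\<Prod>e\<le>N. chain_weight t lam mu e nu)
    = (if strip lam nu \<and> strip nu mu
       then t ^ (sum_list lam - sum_list nu) * (- 1) ^ (sum_list nu - sum_list mu)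
         * (strip_weight lam nu * strip_weight nu mu) else 0)"
  unfolding chain_weight_def diag_weight_factor prod.distrib
    prod_strip_factor[OF assms(1,2)] prod_strip_factor[OF assms(2,3)]
  by simp

text \<open>For a double strip all gaps are at most 2 and the transfer recursion applies; otherwise
  no \<open>nu\<close> passes both strip tests and every term is 0.\<close>

lemma sum_chain_weight:
  assumes t: "t + 1 \<noteq> 0" and lam: "strict_partition lam" "\<forall>x\<in>set lam. x \<le> N"
    and mu: "mu \<in> strict_in 0 N"
  shows "(\<Sum>nu\<in>strict_in 0 N. \<Prod>e\<le>N. chain_weight t lam mu e nu)
    = (if generalized_double_strip lam mu then wt t lam mu else 0)"
proof (cases "generalized_double_strip lam mu")
  case True
  have mu': "strict_partition mu" using mu by (simp add: strict_in_def)
  obtain nu where "strip lam nu" "strip nu mu"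
    using True generalized_double_strip_iff[OF lam(1) mu'] by auto
  then have "gap lam mu d \<in> {0, 1, 2}" for d
    using gap_split[of nu mu d lam] by (auto simp: strip_gap dest!: spec[of _ d])
  then show ?thesis using wt_eq[OF t lam(1) mu' lam(2)] True by simp
next
  case False
  have "(\<Prod>e\<le>N. chain_weight t lam mu e nu) = 0" if "nu \<in> strict_in 0 N" for nu
  proof -
    have "\<not> (strip lam nu \<and> strip nu mu)"
      using False that mu lam(1) generalized_double_strip_iff by (auto simp: strict_in_def)
    moreover have "\<forall>x\<in>set nu. x \<le> N" "\<forall>x\<in>set mu. x \<le> N" using that mu by (auto simp: strict_in_def)
    ultimately show ?thesis using prod_chain_weight[OF lam(2), of nu mu t] by auto
  qed
  then have "(\<Sum>nu\<in>strict_in 0 N. \<Prod>e\<le>N. chain_weight t lam mu e nu) = 0"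
    by (intro sum.neutral ballI)
  then show ?thesis using False by simp
qed

definition double_strips :: "nat list \<Rightarrow> nat \<Rightarrow> nat list set" where
  "double_strips lam k = {mu. strict_partition mu \<and> contained mu lam \<and> k_generalized_double_strip k lam mu}"

lemma double_strips_eq:
  assumes lam: "strict_partition lam" "\<forall>x\<in>set lam. x \<le> N"
  shows "double_strips lam k
    = {mu \<in> strict_in 0 N. generalized_double_strip lam mu \<and> sum_list mu + k = sum_list lam}"
proof -
  have "mu \<in> strict_in 0 N \<and> contained mu lam" if mu: "strict_partition mu" and gds: "generalized_double_strip lam mu" for mu
  proof -
    obtain nu where nu: "strict_partition nu" "strip lam nu" "strip nu mu"
      using gds generalized_double_strip_iff[OF lam(1) mu] by auto
    then have "\<forall>x\<in>set mu. x \<le> N" using strip_bound lam(2) by blast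
    moreover have "contained mu lam"
      using nu by (auto simp: contained_iff[OF mu lam(1)] strip_def intro: order_trans)
    ultimately show ?thesis using mu by (auto simp: strict_in_def strict_partition_def intro: gr0I)
  qed
  then show ?thesis
    by (auto simp: double_strips_def k_generalized_double_strip_def strict_in_def)
qed

lemma finite_double_strips: "strict_partition lam \<Longrightarrow> finite (double_strips lam k)"
  using double_strips_eq[of lam "Max (insert 0 (set lam))"] finite_strict_in by simp

lemma qq_plus_1: "qq + 1 \<noteq> 0"
proof -
  have "qq + 1 = to_fract ([:0, 1:] + 1)" by (simp add: qq_def)
  also have "[:0, 1:] + 1 = [:1, 1 :: rat:]" by (simp add: one_pCons)
  also have "to_fract [:1, 1 :: rat:] \<noteq> 0" by simp
  finally show ?thesis .
qed

text \<open>The generating function of \<open>g\<^sub>k\<close> factors as \<open>q(qz) q(-z)\<close>, where \<open>q(z)\<close> is that of the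
  \<open>creation\<close> coefficients, so multiplication by \<open>g\<^sub>k\<close> is adjoint to removing two strips.\<close>

lemma form_g_series_schurQ:
  assumes lam: "strict_partition lam"
  shows "form (g_series $ k * f) (schurQ lam)
    = (\<Sum>mu\<in>double_strips lam k. wt qq lam mu * form f (schurQ mu))"
proof -
  define N where "N = Max (insert 0 (set lam))"
  have N: "\<forall>x\<in>set lam. x \<le> N" by (simp add: N_def)
  let ?X = "strict_in 0 N"
  let ?F = "\<lambda>mu. form f (schurQ mu)"
  let ?w = "\<lambda>lam nu. strip_weight lam nu :: ratq"
  have XN: "\<forall>x\<in>set nu. x \<le> N" if "nu \<in> ?X" for nu using that by (auto simp: strict_in_def)
  have strips: "(\<Sum>nu\<in>strips l i. G nu) = (\<Sum>nu\<in>?X. if strip l nu \<and> sum_list nu + i = sum_list l then G nu else 0)"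
    if "\<forall>x\<in>set l. x \<le> N" for l i and G :: "nat list \<Rightarrow> ratq"
  proof -
    have "strips l i = {nu \<in> ?X. strip l nu \<and> sum_list nu + i = sum_list l}"
      using strips_subset[OF that] by (auto simp: strips_def strict_in_def)
    then show ?thesis by (simp only: sum.inter_filter finite_strict_in)
  qed
  have "form f (skewing j (skewing i (schurQ lam)))
      = (\<Sum>nu\<in>strips lam i. \<Sum>mu\<in>strips nu j. ?w lam nu * (?w nu mu * ?F mu))" for i j
  proof -
    have "skewing j (skewing i (schurQ lam))
        = (\<Sum>nu\<in>strips lam i. scal (?w lam nu) * skewing j (schurQ nu))"
      by (simp add: skewing_schurQ[OF lam] skewing_sum skewing_scal)
    also have "\<dots> = (\<Sum>nu\<in>strips lam i. scal (?w lam nu) * (\<Sum>mu\<in>strips nu j. scal (?w nu mu) * schurQ mu))"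
      by (rule sum.cong[OF refl]) (simp add: strips_def skewing_schurQ)
    finally show ?thesis
      by (simp add: form_sum_right form_scal_right sum_distrib_left)
  qed
  then have "form (g_series $ k * f) (schurQ lam)
      = (\<Sum>i\<le>k. \<Sum>nu\<in>strips lam i. \<Sum>mu\<in>strips nu (k - i).
          qq ^ i * (- 1) ^ (k - i) * (?w lam nu * (?w nu mu * ?F mu)))"
    by (simp add: form_g_series_mult sum_distrib_left)
  \<comment> \<open>Both sums are extended to one fixed finite set, with the strip and size
    conditions as indicators, so that their order can be exchanged.\<close>
  also have "\<dots> = (\<Sum>i\<le>k. \<Sum>nu\<in>?X. \<Sum>mu\<in>?X.
      if strip lam nu \<and> sum_list nu + i = sum_list lam \<and> strip nu mu \<and> sum_list mu + (k - i) = sum_list nu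
      then qq ^ i * (- 1) ^ (k - i) * (?w lam nu * (?w nu mu * ?F mu)) else 0)"
    unfolding strips[OF N]
    by (intro sum.cong[OF refl]) (auto simp: strips[OF XN])
  also have "\<dots> = (\<Sum>mu\<in>?X. \<Sum>nu\<in>?X. \<Sum>i\<le>k.
      if strip lam nu \<and> sum_list nu + i = sum_list lam \<and> strip nu mu \<and> sum_list mu + (k - i) = sum_list nu
      then qq ^ i * (- 1) ^ (k - i) * (?w lam nu * (?w nu mu * ?F mu)) else 0)"
    by (subst sum.swap, subst sum.swap, subst (2) sum.swap) (rule refl)
  also have "\<dots> = (\<Sum>mu\<in>?X. \<Sum>nu\<in>?X. if sum_list mu + k = sum_list lam
      then (\<Prod>e\<le>N. chain_weight qq lam mu e nu) * ?F mu else 0)"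
  proof (intro sum.cong[OF refl])
    fix mu nu assume X: "mu \<in> ?X" "nu \<in> ?X"
    have P: "(\<Prod>e\<le>N. chain_weight qq lam mu e nu)
      = (if strip lam nu \<and> strip nu mu
       then qq ^ (sum_list lam - sum_list nu) * (- 1) ^ (sum_list nu - sum_list mu) * (?w lam nu * ?w nu mu) else 0)"
      by (rule prod_chain_weight[OF N XN[OF X(2)] XN[OF X(1)]])
    show "(\<Sum>i\<le>k. if strip lam nu \<and> sum_list nu + i = sum_list lam \<and> strip nu mu \<and> sum_list mu + (k - i) = sum_list nu
      then qq ^ i * (- 1) ^ (k - i) * (?w lam nu * (?w nu mu * ?F mu)) else 0)
      = (if sum_list mu + k = sum_list lam then (\<Prod>e\<le>N. chain_weight qq lam mu e nu) * ?F mu else 0)"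
    proof (cases "strip lam nu \<and> strip nu mu \<and> sum_list mu + k = sum_list lam")
      case True
      then have le: "sum_list nu \<le> sum_list lam" "sum_list mu \<le> sum_list nu" using strip_sum_list_le by auto
      \<comment> \<open>Once \<open>mu\<close> and \<open>nu\<close> are fixed, their sizes leave a
        single possible i.\<close>
      have iff: "sum_list nu + i = sum_list lam \<and> sum_list mu + (k - i) = sum_list nu \<longleftrightarrow> i = sum_list lam - sum_list nu"
        if "i \<le> k" for i using True le that by auto
      have "(\<Sum>i\<le>k. if strip lam nu \<and> sum_list nu + i = sum_list lam \<and> strip nu mu \<and> sum_list mu + (k - i) = sum_list nu
          then qq ^ i * (- 1) ^ (k - i) * (?w lam nu * (?w nu mu * ?F mu)) else 0)
        = (\<Sum>i\<le>k. if i = sum_list lam - sum_list nu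
          then qq ^ i * (- 1) ^ (k - i) * (?w lam nu * (?w nu mu * ?F mu)) else 0)"
        by (rule sum.cong[OF refl]) (use True iff in auto)
      also have "\<dots> = qq ^ (sum_list lam - sum_list nu) * (- 1) ^ (k - (sum_list lam - sum_list nu))
          * (?w lam nu * (?w nu mu * ?F mu))"
        using True le by (auto simp: sum.delta)
      also have "k - (sum_list lam - sum_list nu) = sum_list nu - sum_list mu" using True le by auto
      finally show ?thesis using True unfolding P by (simp add: mult_ac)
    next
      case False
      then have "\<not> (strip lam nu \<and> sum_list nu + i = sum_list lam \<and> strip nu mu \<and> sum_list mu + (k - i) = sum_list nu)"
        if "i \<le> k" for i using that by auto
      then have "(\<Sum>i\<le>k. if strip lam nu \<and> sum_list nu + i = sum_list lam \<and> strip nu mu \<and> sum_list mu + (k - i) = sum_list nu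
          then qq ^ i * (- 1) ^ (k - i) * (?w lam nu * (?w nu mu * ?F mu)) else 0) = 0"
        by (intro sum.neutral) auto
      then show ?thesis using False unfolding P by auto
    qed
  qed
  also have "\<dots> = (\<Sum>mu\<in>?X. if sum_list mu + k = sum_list lam
      then (\<Sum>nu\<in>?X. \<Prod>e\<le>N. chain_weight qq lam mu e nu) * ?F mu else 0)"
    by (rule sum.cong[OF refl]) (simp add: sum_distrib_right)
  also have "\<dots> = (\<Sum>mu\<in>?X. if generalized_double_strip lam mu \<and> sum_list mu + k = sum_list lam
      then wt qq lam mu * ?F mu else 0)"
    by (rule sum.cong[OF refl]) (auto simp: sum_chain_weight[OF qq_plus_1 lam N])
  also have "\<dots> = (\<Sum>mu\<in>double_strips lam k. wt qq lam mu * ?F mu)"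
    unfolding double_strips_eq[OF lam N] by (simp only: sum.inter_filter finite_strict_in)
  finally show ?thesis .
qed

section \<open>Sequences of double strips and the character formula\<close>

lemma strip_sequences_Nil: "strict_partition lam \<Longrightarrow> strip_sequences lam [] = {[lam]}"
  by (auto simp: strip_sequences_def length_Suc_conv)

lemma strip_sequences_hd: "L \<in> strip_sequences lam mu \<Longrightarrow> L ! 0 = lam"
  by (simp add: strip_sequences_def)

lemma strip_sequences_Cons:
  assumes lam: "strict_partition lam"
  shows "strip_sequences lam (k # mu) = (\<Union>nu\<in>double_strips lam k. (\<lambda>L. lam # L) ` strip_sequences nu mu)"
proof (intro equalityI subsetI)
  fix L assume L: "L \<in> strip_sequences lam (k # mu)"
  then obtain L' where L': "L = lam # L'" by (cases L) (auto simp: strip_sequences_def)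
  have len: "length L' = length mu + 1" using L L' by (simp add: strip_sequences_def)
  have strict: "strict_partition (L' ! i)" if "i \<le> length mu" for i
    using L L' that by (auto simp: strip_sequences_def dest!: spec[of _ "Suc i"])
  have step: "contained (L ! Suc i) (L ! i) \<and> k_generalized_double_strip ((k # mu) ! i) (L ! i) (L ! Suc i)"
    if "i \<le> length mu" for i
    using L that by (auto simp: strip_sequences_def dest!: bspec[of _ _ "Suc i"])
  have "L' ! 0 \<in> double_strips lam k"
    using step[of 0] strict[of 0] L' by (simp add: double_strips_def)
  moreover have "L' \<in> strip_sequences (L' ! 0) mu"
    unfolding strip_sequences_def
  proof (intro CollectI conjI ballI)
    fix i assume "i \<in> {1..length mu}"
    then show "contained (L' ! i) (L' ! (i - 1))"
      "k_generalized_double_strip (mu ! (i - 1)) (L' ! (i - 1)) (L' ! i)"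
      using step[of i] L' by (cases i; simp)+
  qed (use len strict in auto)
  ultimately show "L \<in> (\<Union>nu\<in>double_strips lam k. (\<lambda>L. lam # L) ` strip_sequences nu mu)"
    using L' by blast
next
  fix L assume "L \<in> (\<Union>nu\<in>double_strips lam k. (\<lambda>L. lam # L) ` strip_sequences nu mu)"
  then obtain nu L' where nu: "nu \<in> double_strips lam k" and L': "L' \<in> strip_sequences nu mu" "L = lam # L'" by auto
  show "L \<in> strip_sequences lam (k # mu)"
    unfolding strip_sequences_def
  proof (intro CollectI conjI ballI allI impI)
    fix i assume "i \<le> length (k # mu)"
    then show "strict_partition (L ! i)" using L' lam by (cases i) (auto simp: strip_sequences_def)
  next
    fix i assume i: "i \<in> {1..length (k # mu)}"
    then obtain j where j: "i = Suc j" by (cases i) auto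
    show "contained (L ! i) (L ! (i - 1))" "k_generalized_double_strip ((k # mu) ! (i - 1)) (L ! (i - 1)) (L ! i)"
      using nu L' i j by (cases j; auto simp: strip_sequences_def double_strips_def dest!: bspec[of _ _ j])+
  qed (use L' in \<open>auto simp: strip_sequences_def\<close>)
qed

lemma finite_strip_sequences: "strict_partition lam \<Longrightarrow> finite (strip_sequences lam mu)"
proof (induction mu arbitrary: lam)
  case (Cons k mu)
  then show ?case
    by (auto simp: strip_sequences_Cons finite_double_strips) (simp add: double_strips_def)
qed (simp add: strip_sequences_Nil)

text \<open>The factors of \<open>g_part mu\<close> are moved across the form one at a time, each
  removing a double strip of its own size. Equality of sizes makes the last partition empty, so the
  remaining pairing is that of 1 with 1.\<close>

lemma form_g_part_schurQ:
  assumes "strict_partition lam" "sum_list lam = sum_list mu"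
  shows "form (g_part mu) (schurQ lam)
    = (\<Sum>L\<in>strip_sequences lam mu. \<Prod>i = 1..length mu. wt qq (L ! (i - 1)) (L ! i))"
  using assms
proof (induction mu arbitrary: lam)
  case Nil
  then have "lam = []" by (cases lam) (auto simp: strict_partition_def)
  then show ?case using Nil by (simp add: strip_sequences_Nil g_part_def schurQ_def form_1_1)
next
  case (Cons k mu)
  let ?W = "\<lambda>L. \<Prod>i = 1..length mu. wt qq (L ! (i - 1)) (L ! i)"
  have W: "(\<Prod>i = 1..length (k # mu). wt qq ((lam # L) ! (i - 1)) ((lam # L) ! i)) = wt qq lam (L ! 0) * ?W L"
    for L
  proof -
    have "(\<Prod>i = 1..length (k # mu). wt qq ((lam # L) ! (i - 1)) ((lam # L) ! i))
        = (\<Prod>i<Suc (length mu). wt qq ((lam # L) ! i) (L ! i))"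
      by (rule prod.reindex_bij_witness[where i = Suc and j = "\<lambda>i. i - 1"]) auto
    also have "\<dots> = wt qq lam (L ! 0) * (\<Prod>i<length mu. wt qq (L ! i) (L ! Suc i))"
      by (simp add: prod.lessThan_Suc_shift del: prod.lessThan_Suc)
    also have "(\<Prod>i<length mu. wt qq (L ! i) (L ! Suc i)) = ?W L"
      by (rule prod.reindex_bij_witness[where i = "\<lambda>i. i - 1" and j = Suc]) auto
    finally show ?thesis .
  qed
  have nu: "strict_partition nu" "sum_list nu = sum_list mu" if "nu \<in> double_strips lam k" for nu
    using that Cons.prems by (auto simp: double_strips_def k_generalized_double_strip_def)
  have "form (g_part (k # mu)) (schurQ lam) = form (g_series $ k * g_part mu) (schurQ lam)"
    by (simp add: g_part_def)
  also have "\<dots> = (\<Sum>nu\<in>double_strips lam k. \<Sum>L\<in>strip_sequences nu mu. wt qq lam (L ! 0) * ?W L)"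
    unfolding form_g_series_schurQ[OF Cons.prems(1)]
    by (rule sum.cong[OF refl]) (simp add: Cons.IH nu sum_distrib_left strip_sequences_hd)
  also have "\<dots> = (\<Sum>nu\<in>double_strips lam k. \<Sum>L\<in>(\<lambda>L. lam # L) ` strip_sequences nu mu.
      \<Prod>i = 1..length (k # mu). wt qq (L ! (i - 1)) (L ! i))"
    by (rule sum.cong[OF refl], subst sum.reindex) (simp_all only: inj_on_def comp_def W list.inject, simp)
  also have "\<dots> = (\<Sum>L\<in>strip_sequences lam (k # mu). \<Prod>i = 1..length (k # mu). wt qq (L ! (i - 1)) (L ! i))"
    unfolding strip_sequences_Cons[OF Cons.prems(1)]
    by (rule sum.UNION_disjoint[symmetric])
       (auto simp: finite_double_strips Cons.prems finite_strip_sequences nu dest: strip_sequences_hd)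
  finally show ?case .
qed

theorem corollary3p13:
  fixes n m :: nat and lam mu :: "nat list"
  assumes "lam \<in> SP n"
    and "mu \<in> OP n"
    and "length mu = m"
  shows "zeta lam mu =
    2 powi (- int (eps lam)) * (qq - 1) powi (- int m)
      * (\<Sum>L\<in>strip_sequences lam mu. \<Prod>i = 1..m. wt qq (L ! (i - 1)) (L ! i))"
proof -
  have "strict_partition lam" "sum_list lam = sum_list mu"
    using assms by (auto simp: SP_def OP_def)
  then show ?thesis
    using assms(3) by (simp add: zeta_def form_g_part_schurQ)
qed

end
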